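(* Let $\tau>0$, $\mathbf{V}^{0}\in X_{\infty}$, $\mathbf{V}^{0}_{\tau}\in C^{0}([-\tau,0],X_{\infty})$ with $\mathbf{V}^{0}_{\tau}(\cdot,0)=\mathbf{V}^{0}$, and $\mathbf{F}\in C^{0}([0,\infty),X_{\infty})$. Let $\mathbf{V}\in C^{0}([-\tau,\infty),X_{\infty})\cap C^{1}([0,\infty),X_{\infty})$ be the unique classical solution of $$\partial_{t}\mathbf{V}(\cdot,t)+\mathcal{B}_{\infty}\mathbf{V}(\cdot,t-\tau)=\mathbf{F}(\cdot,t)\ (t>0),\qquad \mathbf{V}(\cdot,0)=\mathbf{V}^{0},\qquad \mathbf{V}(\cdot,t)=\mathbf{V}^{0}_{\tau}(\cdot,t)\ (t\in(-\tau,0)).$$ With the functions $\Phi_n^k$, the coefficients $V^{0,k}_{n}=\langle V^{0,k},\Phi^k_n\rangle_{L^2(\Omega)}$, $V^{0,k}_{\tau,n}(t)=\langle V^{0,k}_\tau(\cdot,t),\Phi^k_n\rangle_{L^2(\Omega)}$, $F^k_n(t)=\langle F^k(\cdot,t),\Phi^k_n\rangle_{L^2(\Omega)}$, and the eigenvalues $\mu_{n,k}$ and eigenvectors $\mathbf{v}_{n,k}$ of the matrices $\mathbf{B}_n$ given in the context, the following hold. (i) Uniformly in $\bar\Omega$, $$\mathbf{V}^{0}=\sum_{n=0}^{\infty}\big(V^{0,k}_{n}\Phi^{k}_{n}\big)_{k=1,2,3},\qquad \mathbf{V}^{0}_{\tau}(\cdot,t)=\sum_{n=0}^{\infty}\big(V^{0,k}_{\tau,n}(t)\Phi^{k}_{n}\big)_{k=1,2,3}\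 (t\in[-\tau,0]),\qquad \mathbf{F}(\cdot,t)=\sum_{n=0}^{\infty}\big(F^{k}_{n}(t)\Phi^{k}_{n}\big)_{k=1,2,3}\ (t\ge0).$$ (ii) For every $n$ the eigenvectors $\mathbf{v}_{n,0},\mathbf{v}_{n,1},\mathbf{v}_{n,2}$ are linearly independent (but in general not orthonormal). Hence, with $\mathbf{D}_{n}=\mathrm{diag}(\mu_{n,0},\mu_{n,1},\mu_{n,2})$ and $\mathbf{S}_{n}$ the matrix with columns $\mathbf{v}_{n,0},\mathbf{v}_{n,1},\mathbf{v}_{n,2}$, the matrix $\mathbf{S}_n$ is invertible and $\mathbf{B}_{n}=\mathbf{S}_{n}\mathbf{D}_{n}\mathbf{S}_{n}^{-1}$. (iii) Similarly to (i), the solution expands as $$\mathbf{V}(\cdot,t)=\sum_{n=0}^{\infty}\big(V^{1}_{n}(t)\Phi^{1}_{n},\,V^{2}_{n}(t)\Phi^{2}_{n},\,V^{3}_{n}(t)\Phi^{3}_{n}\big)^{T},$$ where $\mathbf{V}_{n}=(V_n^1,V_n^2,V_n^3)^T$ is given by $\mathbf{V}_{n}(t)=\mathbf{V}^{0}_{\tau,n}(t)$ for $t\in[-\tau,0)$, $\mathbf{V}_{n}(0)=\mathbf{V}^{0}_{n}$, and for $t>0$ $$\mathbf{V}_{n}(t)=\mathbf{S}_{n}\exp_{\tau}(-\mathbf{D}_{n},t-\tau)\mathbf{S}_{n}^{-1}\mathbf{V}^{0}_{n}-\mathbf{S}_{n}\mathbf{D}_{n}\int_{-\tau}^{0}\exp_{\tau}(-\mathbf{D}_{n},t-2\tau-s)\mathbf{S}_{n}^{-1}\mathbf{V}^{0}_{\tau,n}(s)\,\mathrm{d}s+\int_{0}^{t}\mathbf{S}_{n}\exp_{\tau}(-\mathbf{D}_{n},t-\tau-s)\mathbf{S}_{n}^{-1}\mathbf{F}_{n}(s)\,\mathrm{d}s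 .$$ Here, writing $S^{jk}$ for the entries of $\mathbf{S}_n$, $$\mathbf{S}_n^{-1}=\frac{1}{\det \mathbf{S}_n}\begin{pmatrix}S^{22}S^{33}-S^{23}S^{32}&-S^{12}S^{33}+S^{13}S^{32}&S^{12}S^{23}-S^{13}S^{22}\\-S^{21}S^{33}+S^{23}S^{31}&S^{11}S^{33}-S^{13}S^{31}&-S^{11}S^{23}+S^{13}S^{21}\\S^{21}S^{32}-S^{22}S^{31}&-S^{11}S^{32}+S^{12}S^{31}&S^{11}S^{22}-S^{12}S^{21}\end{pmatrix},$$ $$\det\mathbf{S}_n=S^{11}S^{22}S^{33}+S^{12}S^{23}S^{31}+S^{13}S^{21}S^{32}-S^{31}S^{22}S^{13}-S^{32}S^{23}S^{11}-S^{33}S^{21}S^{12}.$$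
   Context: Let $\Omega=(0,l)$ with $l>0$, and let $a,b,c,d$ be real constants with $a>0$, $c>0$, $b/d>0$. Let $X=L^{2}(\Omega)\times L^{2}(\Omega)\times L^{2}(\Omega)$ be the Hilbert space with inner product $$\langle\mathbf{V},\mathbf{W}\rangle_{X}=\langle V^{1},W^{1}\rangle_{L^{2}(\Omega)}+a\langle V^{2},W^{2}\rangle_{L^{2}(\Omega)}+\tfrac{b}{d}\langle V^{3},W^{3}\rangle_{L^{2}(\Omega)}.$$ The operator $\mathcal{B}:D(\mathcal{B})\subset X\to X$ is given by $$\mathcal{B}\mathbf{V}=\begin{pmatrix}0&-a\partial_{x}&b\partial_{x}\\-\partial_{x}&0&0\\d\partial_{x}&0&-c\partial_{xx}\end{pmatrix}\mathbf{V},\qquad D(\mathcal{B})=\{\mathbf{V}\in H^{1}_{0}(\Omega)\times H^{1}(\Omega)\times H^{2}(\Omega): \partial_{x}V^{3}|_{\partial\Omega}=0\}.$$ Put $X_{\infty}=\{\mathbf{V}\in\bigcap_{n\ge0}D(\mathcal{B}^{n}): \|\mathbf{V}\|_{X_{\infty}}<\infty\}$ with inner product $\langle\mathbf{V},\mathbf{W}\rangle_{X_{\infty}}=\sum_{k=0}^{\infty}\frac{1}{k!}\langle\mathcal{B}^{k}\mathbf{V},\mathcal{B}^{k}\mathbf{W}\rangle_{X}$, and let $\mathcal{B}_{\infty}=\mathcal{B}|_{X_{\infty}}$. A classical solution satisfies the equations pointwise. Fourier system: $\nu_{n}=\pi n/l$ for $n\in\mathbb{N}_0$; $\boldsymbol{\Phi}_{0}(x)=\sqrt{\tfrac{1}{2l}}(0,1,1)^{T}$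 and $\boldsymbol{\Phi}_{n}(x)=\sqrt{\tfrac{2}{3l}}(\sin(\nu_{n}x),\cos(\nu_{n}x),\cos(\nu_{n}x))^{T}$ for $n\ge1$, with components $\Phi_n^1,\Phi_n^2,\Phi_n^3$. Superscripts $k=1,2,3$ on $\mathbf{V}^0=(V^{0,k})_k$, $\mathbf{V}^0_\tau=(V^{0,k}_\tau)_k$, $\mathbf{F}=(F^k)_k$ denote components, and $\mathbf{V}^0_n=(V^{0,k}_n)_{k=1,2,3}$, $\mathbf{V}^0_{\tau,n}(t)=(V^{0,k}_{\tau,n}(t))_{k=1,2,3}$, $\mathbf{F}_n(t)=(F^k_n(t))_{k=1,2,3}$ collect the coefficients defined in the claim. Matrices: let $$\mathbf{B}_{n}=\begin{pmatrix}0&a\nu_{n}&-b\nu_{n}\\-\nu_{n}&0&0\\d\nu_{n}&0&c\nu_{n}^{2}\end{pmatrix}.$$ Its eigenvalues $\mu_{n,k}$, $k=0,1,2$, are $\mu_{0,k}=0$ and, for $n\ge1$, $\mu_{n,k}=\tfrac13\big(c\nu_n^2-Ce^{2ik\pi/3}-e^{-2ik\pi/3}\tfrac{\Delta_0}{C}\big)$ with $\Delta_{0}=c^{2}\nu_{n}^{4}-3(a+bd)\nu_{n}^{2}$, $\Delta_{1}=-2c^{3}\nu_{n}^{6}+9c(a+bd)\nu_{n}^{4}-27ac\nu_{n}^{4}$, $C=\sqrt[3]{\tfrac12(\Delta_{1}+\sqrt{\Delta_{1}^{2}-4\Delta_{0}^{3}})}$ (principal branches of the complex roots). Corresponding eigenvectors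 are $\mathbf{v}_{0,k}=\mathbf{e}_{k+1}$ (standard basis vectors) and $\mathbf{v}_{n,k}=(-b\nu_n\mu_{n,k},\,b\nu_n^2,\,a\nu_n^2+\mu_{n,k}^2)^T$ for $n\ge1$. The delayed exponential of a square matrix $\mathbf{A}$ is $\exp_{\tau}(\mathbf{A},t)=0$ for $t<-\tau$ and $\exp_{\tau}(\mathbf{A},t)=\mathbf{I}+\sum_{k=1}^{\lfloor t/\tau\rfloor+1}\frac{(t-(k-1)\tau)^{k}}{k!}\mathbf{A}^{k}$ for $t\ge-\tau$.
   Formalization: Φ_0, Φ_n use factors √(1/l), √(2/l) instead of √(1/(2l)), √(2/(3l)), with which (i), (iii) fail; (ii) and the S_n^{-1} formula assume, for n≥1, C≠0 and Δ_1²≠4Δ_0³ (else μ_{n,k} is undefined or eigenvectors are dependent); (iii) assumes this for all n≥1. *)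

theory Defs
  imports "HOL-Analysis.Analysis"
begin

section \<open>Lebesgue and Sobolev spaces on the interval (0,l)\<close>

text \<open>
  Elements of the function spaces are represented by functions on the whole real line; the values
  outside the interval are irrelevant, and up to and including the operator \<open>opB\<close> everything depends
  on the functions only up to equality almost everywhere on the interval.
\<close>

definition L2 :: "real \<Rightarrow> (real \<Rightarrow> real) set" where
  "L2 l = {f. f \<in> borel_measurable (lebesgue_on {0<..<l}) \<and>
              integrable (lebesgue_on {0<..<l}) (\<lambda>x. (f x)\<^sup>2)}"

definition L2_inner :: "real \<Rightarrow> (real \<Rightarrow> real) \<Rightarrow> (real \<Rightarrow> real) \<Rightarrow> real" where
  "L2_inner l f g = integral\<^sup>L (lebesgue_on {0<..<l}) (\<lambda>x. f x * g x)"

definition test_functions :: "real \<Rightarrow> (real \<Rightarrow> real) set" where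
  "test_functions l = {\<phi>. (\<forall>n x. (deriv ^^ n) \<phi> differentiable (at x)) \<and>
                          compact (closure {x. \<phi> x \<noteq> 0}) \<and> closure {x. \<phi> x \<noteq> 0} \<subseteq> {0<..<l}}"

definition has_weak_deriv :: "real \<Rightarrow> (real \<Rightarrow> real) \<Rightarrow> (real \<Rightarrow> real) \<Rightarrow> bool" where
  "has_weak_deriv l f g \<longleftrightarrow> f \<in> L2 l \<and> g \<in> L2 l \<and>
     (\<forall>\<phi>\<in>test_functions l. L2_inner l f (deriv \<phi>) = - L2_inner l g \<phi>)"

text \<open>
  A weak derivative is unique only almost everywhere; the representative that is continuous on
  the closed interval is chosen whenever there is one, so that equations between derivatives of
  smooth functions make sense pointwise.
\<close>

definition weak_deriv :: "real \<Rightarrow> (real \<Rightarrow> real) \<Rightarrow> real \<Rightarrow> real" where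
  "weak_deriv l f = (SOME g. has_weak_deriv l f g \<and>
     ((\<exists>h. has_weak_deriv l f h \<and> continuous_on {0..l} h) \<longrightarrow> continuous_on {0..l} g))"

definition H1 :: "real \<Rightarrow> (real \<Rightarrow> real) set" where
  "H1 l = {f. \<exists>g. has_weak_deriv l f g}"

definition H1_norm :: "real \<Rightarrow> (real \<Rightarrow> real) \<Rightarrow> real" where
  "H1_norm l f = sqrt (L2_inner l f f + L2_inner l (weak_deriv l f) (weak_deriv l f))"

definition H10 :: "real \<Rightarrow> (real \<Rightarrow> real) set" where
  "H10 l = {f \<in> H1 l. \<forall>\<epsilon>>0. \<exists>\<phi>\<in>test_functions l. H1_norm l (\<lambda>x. f x - \<phi> x) < \<epsilon>}"

definition H2 :: "real \<Rightarrow> (real \<Rightarrow> real) set" where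
  "H2 l = {f \<in> H1 l. weak_deriv l f \<in> H1 l}"

definition zero_trace :: "real \<Rightarrow> (real \<Rightarrow> real) \<Rightarrow> bool" where
  "zero_trace l f \<longleftrightarrow> (\<exists>h. continuous_on {0..l} h \<and>
     (AE x in lebesgue_on {0<..<l}. f x = h x) \<and> h 0 = 0 \<and> h l = 0)"


section \<open>The Hilbert space X, the operator B and the space of its smooth vectors\<close>

abbreviation comp :: "3 \<Rightarrow> (real \<Rightarrow> real^3) \<Rightarrow> real \<Rightarrow> real" where
  "comp k V \<equiv> (\<lambda>x. V x $ k)"

definition X_space :: "real \<Rightarrow> (real \<Rightarrow> real^3) set" where
  "X_space l = {V. \<forall>k. comp k V \<in> L2 l}"

definition X_inner ::
  "real \<Rightarrow> real \<Rightarrow> real \<Rightarrow> real \<Rightarrow> (real \<Rightarrow> real^3) \<Rightarrow> (real \<Rightarrow> real^3) \<Rightarrow> real" where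
  "X_inner l a b d V W = L2_inner l (comp 1 V) (comp 1 W) + a * L2_inner l (comp 2 V) (comp 2 W)
                         + b / d * L2_inner l (comp 3 V) (comp 3 W)"

definition opB ::
  "real \<Rightarrow> real \<Rightarrow> real \<Rightarrow> real \<Rightarrow> real \<Rightarrow> (real \<Rightarrow> real^3) \<Rightarrow> real \<Rightarrow> real^3" where
  "opB l a b c d V = (\<lambda>x. vector
     [- a * weak_deriv l (comp 2 V) x + b * weak_deriv l (comp 3 V) x,
      - weak_deriv l (comp 1 V) x,
      d * weak_deriv l (comp 1 V) x - c * weak_deriv l (weak_deriv l (comp 3 V)) x])"

definition dom_B :: "real \<Rightarrow> (real \<Rightarrow> real^3) set" where
  "dom_B l = {V. comp 1 V \<in> H10 l \<and> comp 2 V \<in> H1 l \<and> comp 3 V \<in> H2 l \<and>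
                 zero_trace l (weak_deriv l (comp 3 V))}"

definition dom_B_power ::
  "real \<Rightarrow> real \<Rightarrow> real \<Rightarrow> real \<Rightarrow> real \<Rightarrow> nat \<Rightarrow> (real \<Rightarrow> real^3) set" where
  "dom_B_power l a b c d n = {V \<in> X_space l. \<forall>k<n. (opB l a b c d ^^ k) V \<in> dom_B l}"

definition Xinf_inner ::
  "real \<Rightarrow> real \<Rightarrow> real \<Rightarrow> real \<Rightarrow> real \<Rightarrow> (real \<Rightarrow> real^3) \<Rightarrow> (real \<Rightarrow> real^3) \<Rightarrow> real" where
  "Xinf_inner l a b c d V W =
     (\<Sum>k. X_inner l a b d ((opB l a b c d ^^ k) V) ((opB l a b c d ^^ k) W) / fact k)"

definition Xinf_norm ::
  "real \<Rightarrow> real \<Rightarrow> real \<Rightarrow> real \<Rightarrow> real \<Rightarrow> (real \<Rightarrow> real^3) \<Rightarrow> real" where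
  "Xinf_norm l a b c d V = sqrt (Xinf_inner l a b c d V V)"

text \<open>
  Every class in the intersection of the domains of the powers has exactly one representative that
  is continuous on the closed interval. The elements of \<open>Xinf\<close> are these representatives, so that
  their values at points of the closed interval are meaningful. Finiteness of the norm is
  convergence of the defining series of nonnegative terms.
\<close>

definition Xinf :: "real \<Rightarrow> real \<Rightarrow> real \<Rightarrow> real \<Rightarrow> real \<Rightarrow> (real \<Rightarrow> real^3) set" where
  "Xinf l a b c d = {V. continuous_on {0..l} V \<and> (\<forall>n. V \<in> dom_B_power l a b c d n) \<and>
     summable (\<lambda>k. X_inner l a b d ((opB l a b c d ^^ k) V) ((opB l a b c d ^^ k) V) / fact k)}"

text \<open>Time-dependent functions take the time as their first argument.\<close>

definition C0_Xinf ::
  "real \<Rightarrow> real \<Rightarrow> real \<Rightarrow> real \<Rightarrow> real \<Rightarrow> real set \<Rightarrow> (real \<Rightarrow> real \<Rightarrow> real^3) set" where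
  "C0_Xinf l a b c d T = {U. (\<forall>t\<in>T. U t \<in> Xinf l a b c d) \<and>
     (\<forall>t\<in>T. ((\<lambda>s. Xinf_norm l a b c d (\<lambda>x. U s x - U t x)) \<longlongrightarrow> 0) (at t within T))}"

definition C1_Xinf ::
  "real \<Rightarrow> real \<Rightarrow> real \<Rightarrow> real \<Rightarrow> real \<Rightarrow> real set \<Rightarrow> (real \<Rightarrow> real \<Rightarrow> real^3) set" where
  "C1_Xinf l a b c d T = {U \<in> C0_Xinf l a b c d T. \<exists>U'\<in>C0_Xinf l a b c d T.
     \<forall>t\<in>T. ((\<lambda>s. Xinf_norm l a b c d (\<lambda>x. (U s x - U t x) /\<^sub>R (s - t) - U' t x)) \<longlongrightarrow> 0) (at t within T)}"


section \<open>The delay problem\<close>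

definition classical_solution ::
  "real \<Rightarrow> real \<Rightarrow> real \<Rightarrow> real \<Rightarrow> real \<Rightarrow> real \<Rightarrow> (real \<Rightarrow> real^3) \<Rightarrow> (real \<Rightarrow> real \<Rightarrow> real^3) \<Rightarrow>
   (real \<Rightarrow> real \<Rightarrow> real^3) \<Rightarrow> (real \<Rightarrow> real \<Rightarrow> real^3) \<Rightarrow> bool" where
  "classical_solution l a b c d \<tau> V0 V\<tau> F V \<longleftrightarrow>
     V \<in> C0_Xinf l a b c d {-\<tau>..} \<and> V \<in> C1_Xinf l a b c d {0..} \<and>
     (\<forall>t>0. \<forall>x\<in>{0<..<l}.
        ((\<lambda>s. V s x) has_vector_derivative (F t x - opB l a b c d (V (t - \<tau>)) x)) (at t)) \<and>
     (\<forall>x\<in>{0..l}. V 0 x = V0 x) \<and>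
     (\<forall>t\<in>{-\<tau><..<0}. \<forall>x\<in>{0..l}. V t x = V\<tau> t x)"


section \<open>Fourier coefficients\<close>

definition freq :: "real \<Rightarrow> nat \<Rightarrow> real" where
  "freq l n = pi * real n / l"

text \<open>
  The expansions below are taken component by component, with coefficients that are inner products
  in \<open>L2\<close> of the single components. Hence the factors have to normalise each component separately.
  With the factors \<open>sqrt (1/(2*l))\<close> and \<open>sqrt (2/(3*l))\<close>, which normalise the triple of
  components as a whole, the series would reproduce one half of the mean and one third of the
  remaining part of a function.
\<close>

definition Phi :: "real \<Rightarrow> nat \<Rightarrow> real \<Rightarrow> real^3" where
  "Phi l n x = (if n = 0 then sqrt (1 / l) *\<^sub>R vector [0, 1, 1]
     else sqrt (2 / l) *\<^sub>R vector [sin (freq l n * x), cos (freq l n * x), cos (freq l n * x)])"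

definition fourier_coeff :: "real \<Rightarrow> nat \<Rightarrow> (real \<Rightarrow> real^3) \<Rightarrow> real^3" where
  "fourier_coeff l n V = (\<chi> k. L2_inner l (comp k V) (comp k (Phi l n)))"

definition cvec :: "real^3 \<Rightarrow> complex^3" where
  "cvec v = (\<chi> k. complex_of_real (v $ k))"


section \<open>The matrices, their eigenvalues and eigenvectors\<close>

definition matB :: "real \<Rightarrow> real \<Rightarrow> real \<Rightarrow> real \<Rightarrow> real \<Rightarrow> nat \<Rightarrow> complex^3^3" where
  "matB l a b c d n = (let \<nu> = complex_of_real (freq l n) in vector
     [vector [0, of_real a * \<nu>, - of_real b * \<nu>],
      vector [- \<nu>, 0, 0],
      vector [of_real d * \<nu>, 0, of_real c * \<nu>\<^sup>2]])"

definition Delta0 :: "real \<Rightarrow> real \<Rightarrow> real \<Rightarrow> real \<Rightarrow> real \<Rightarrow> nat \<Rightarrow> real" where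
  "Delta0 l a b c d n = c^2 * freq l n ^ 4 - 3 * (a + b * d) * freq l n ^ 2"

definition Delta1 :: "real \<Rightarrow> real \<Rightarrow> real \<Rightarrow> real \<Rightarrow> real \<Rightarrow> nat \<Rightarrow> real" where
  "Delta1 l a b c d n = - 2 * c^3 * freq l n ^ 6 + 9 * c * (a + b * d) * freq l n ^ 4
                        - 27 * a * c * freq l n ^ 4"

definition cardano_C :: "real \<Rightarrow> real \<Rightarrow> real \<Rightarrow> real \<Rightarrow> real \<Rightarrow> nat \<Rightarrow> complex" where
  "cardano_C l a b c d n =
     ((of_real (Delta1 l a b c d n)
        + csqrt (of_real ((Delta1 l a b c d n)\<^sup>2 - 4 * (Delta0 l a b c d n)^3))) / 2) powr (1 / 3)"

definition eigval :: "real \<Rightarrow> real \<Rightarrow> real \<Rightarrow> real \<Rightarrow> real \<Rightarrow> nat \<Rightarrow> nat \<Rightarrow> complex" where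
  "eigval l a b c d n k = (if n = 0 then 0 else
     (of_real (c * (freq l n)\<^sup>2)
      - cardano_C l a b c d n * exp (2 * \<i> * of_nat k * of_real pi / 3)
      - exp (- 2 * \<i> * of_nat k * of_real pi / 3)
        * (of_real (Delta0 l a b c d n) / cardano_C l a b c d n)) / 3)"

definition eigvec :: "real \<Rightarrow> real \<Rightarrow> real \<Rightarrow> real \<Rightarrow> real \<Rightarrow> nat \<Rightarrow> nat \<Rightarrow> complex^3" where
  "eigvec l a b c d n k = (if n = 0 then axis (of_nat (k + 1)) 1 else
     (let \<nu> = complex_of_real (freq l n); \<mu> = eigval l a b c d n k in vector
       [- of_real b * \<nu> * \<mu>, of_real b * \<nu>\<^sup>2, of_real a * \<nu>\<^sup>2 + \<mu>\<^sup>2]))"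

text \<open>
  \<open>Delta1^2 - 4 * Delta0^3\<close> is, up to a nonzero factor, the discriminant of the characteristic
  polynomial of \<open>matB\<close>. If it vanishes, \<open>matB\<close> has a multiple eigenvalue with
  one-dimensional eigenspace and is not diagonalisable, for instance for \<open>a = 1\<close>, \<open>b * d = 8\<close> and
  \<open>c\<^sup>2 * (freq l n)\<^sup>2 = 27\<close>. If \<open>cardano_C\<close> vanishes, the formula for the eigenvalues contains a
  division by zero. Neither degeneration is excluded by the sign conditions on the parameters.
\<close>

definition nondegenerate :: "real \<Rightarrow> real \<Rightarrow> real \<Rightarrow> real \<Rightarrow> real \<Rightarrow> nat \<Rightarrow> bool" where
  "nondegenerate l a b c d n \<longleftrightarrow> n = 0 \<or>
     (cardano_C l a b c d n \<noteq> 0 \<and> (Delta1 l a b c d n)\<^sup>2 - 4 * (Delta0 l a b c d n)^3 \<noteq> 0)"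

definition matS :: "real \<Rightarrow> real \<Rightarrow> real \<Rightarrow> real \<Rightarrow> real \<Rightarrow> nat \<Rightarrow> complex^3^3" where
  "matS l a b c d n = transpose (vector
     [eigvec l a b c d n 0, eigvec l a b c d n 1, eigvec l a b c d n 2])"

definition matD :: "real \<Rightarrow> real \<Rightarrow> real \<Rightarrow> real \<Rightarrow> real \<Rightarrow> nat \<Rightarrow> complex^3^3" where
  "matD l a b c d n = vector
     [vector [eigval l a b c d n 0, 0, 0],
      vector [0, eigval l a b c d n 1, 0],
      vector [0, 0, eigval l a b c d n 2]]"

definition orthonormal_family :: "(nat \<Rightarrow> complex^3) \<Rightarrow> nat set \<Rightarrow> bool" where
  "orthonormal_family v K \<longleftrightarrow>
     (\<forall>j\<in>K. \<forall>k\<in>K. (\<Sum>i\<in>UNIV. v j $ i * cnj (v k $ i)) = (if j = k then 1 else 0))"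


section \<open>The delayed exponential and the coefficients of the solution\<close>

definition delayed_exp :: "real \<Rightarrow> complex^'n^'n \<Rightarrow> real \<Rightarrow> complex^'n^'n" where
  "delayed_exp \<tau> A t = (if t < - \<tau> then 0 else
     mat 1 + (\<Sum>k = 1..nat (\<lfloor>t / \<tau>\<rfloor> + 1).
                ((t - (real k - 1) * \<tau>) ^ k / fact k) *\<^sub>R (((**) A ^^ k) (mat 1))))"

definition sol_coeff ::
  "real \<Rightarrow> real \<Rightarrow> real \<Rightarrow> real \<Rightarrow> real \<Rightarrow> real \<Rightarrow> (real \<Rightarrow> real^3) \<Rightarrow> (real \<Rightarrow> real \<Rightarrow> real^3) \<Rightarrow>
   (real \<Rightarrow> real \<Rightarrow> real^3) \<Rightarrow> nat \<Rightarrow> real \<Rightarrow> complex^3" where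
  "sol_coeff l a b c d \<tau> V0 V\<tau> F n t =
     (let S = matS l a b c d n; D = matD l a b c d n; S' = matrix_inv S in
      if t < 0 then cvec (fourier_coeff l n (V\<tau> t))
      else if t = 0 then cvec (fourier_coeff l n V0)
      else S *v (delayed_exp \<tau> (- D) (t - \<tau>) *v (S' *v cvec (fourier_coeff l n V0)))
         - (S ** D) *v integral {-\<tau>..0} (\<lambda>s.
             delayed_exp \<tau> (- D) (t - 2 * \<tau> - s) *v (S' *v cvec (fourier_coeff l n (V\<tau> s))))
         + integral {0..t} (\<lambda>s.
             S *v (delayed_exp \<tau> (- D) (t - \<tau> - s) *v (S' *v cvec (fourier_coeff l n (F s))))))"


section \<open>Uniform convergence of the expansions\<close>

definition unif_fourier_expansion :: "real \<Rightarrow> (nat \<Rightarrow> real^3) \<Rightarrow> (real \<Rightarrow> real^3) \<Rightarrow> bool" where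
  "unif_fourier_expansion l v V \<longleftrightarrow>
     uniform_limit {0..l} (\<lambda>N x. \<Sum>n<N. (\<chi> k. v n $ k * Phi l n x $ k)) V sequentially"

text \<open>
  The coefficients of the solution are computed with complex eigenvalues, so the expansion of the
  real-valued solution is stated in \<open>complex^3\<close>.
\<close>

definition unif_fourier_expansion_complex ::
  "real \<Rightarrow> (nat \<Rightarrow> complex^3) \<Rightarrow> (real \<Rightarrow> real^3) \<Rightarrow> bool" where
  "unif_fourier_expansion_complex l v V \<longleftrightarrow>
     uniform_limit {0..l} (\<lambda>N x. \<Sum>n<N. (\<chi> k. v n $ k * of_real (Phi l n x $ k)))
       (\<lambda>x. cvec (V x)) sequentially"

end

theory Submission
  imports Defs
begin

text \<open>
  For a vector all of whose iterates under the operator lie in the domain, every weak derivative that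
  occurs is again in \<open>H1\<close> and hence continuous, and the boundary conditions pass from the vector to all
  its iterates. So integration by parts turns the operator into the matrices \<open>B_n\<close> on Fourier
  coefficients. Solving these relations for the coefficients of the vector gains a power of the
  frequency at each step; two steps give decay of order \<open>n\<^sup>-\<^sup>2\<close>, and the series converge
  uniformly, necessarily to the vector itself by completeness of the sine and cosine systems.

  The coefficients of a solution satisfy a linear delay equation with matrix \<open>B_n\<close>. Diagonalising
  \<open>B_n\<close> by Cardano's formulas reduces it to scalar equations, which are solved by variation of
  constants with the delayed exponential as fundamental solution.
\<close>

section \<open>Test functions\<close>

text \<open>\<open>opB\<close> is not self-adjoint in X, so no spectral theorem for it yields the
  expansions. Each component is expanded separately, the first in sines and the others in cosines,
  which one derivative exchanges. Boundary terms vanish either because the sine does or because the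
  differentiated function does: the first component, or the derivative of the third. Domains are
  described by test functions, closure in a norm and the choice inside \<open>weak_deriv\<close>.
  The fundamental lemma, the representation of an H1 function as the integral of its weak
  derivative, and a trace estimate turn all this into pointwise statements on the closed interval,
  where the choice no longer matters. The equation gives the time derivative pointwise in x, whereas
  coefficients are differentiated through the norm; the two derivatives have to be identified. The
  fundamental solution of the delay equation jumps from 0 to 1 at \<open>- \<tau>\<close> and so may
  have a corner at 0, which variation of constants must step over. \<open>nondegenerate\<close>
  makes the three eigenvalues distinct, and \<open>det (matS ...)\<close> is essentially their
  Vandermonde product.\<close>

definition smooth :: "(real \<Rightarrow> real) \<Rightarrow> bool" where
  "smooth f \<longleftrightarrow> (\<forall>n x. (deriv ^^ n) f differentiable (at x))"

lemma smooth_differentiable: "smooth f \<Longrightarrow> f differentiable (at x)"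
  unfolding smooth_def by (metis funpow_0)

lemma smooth_deriv: "smooth f \<Longrightarrow> smooth (deriv f)"
  unfolding smooth_def by (metis comp_apply funpow_Suc_right)

lemma smooth_has_derivative: "smooth f \<Longrightarrow> (f has_real_derivative deriv f x) (at x)"
  by (meson DERIV_deriv_iff_real_differentiable smooth_differentiable)

lemma smooth_continuous: "smooth f \<Longrightarrow> continuous_on S f"
  by (meson DERIV_isCont continuous_at_imp_continuous_on smooth_has_derivative)

text \<open>Avoids explicit formulas for all iterates \<open>deriv ^^ n\<close>: the class
  \<open>K\<close> is mapped into itself by \<open>deriv\<close>, so every iterate stays in
  \<open>K\<close> and is differentiable.\<close>

lemma smooth_coinduct:
  assumes "f \<in> K" "\<And>g. g \<in> K \<Longrightarrow> \<exists>g'\<in>K. \<forall>x. (g has_real_derivative g' x) (at x)"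
  shows "smooth f"
proof -
  have der: "deriv g \<in> K \<and> (\<forall>x. g differentiable (at x))" if "g \<in> K" for g
  proof -
    obtain g' where g': "g' \<in> K" "\<And>x. (g has_real_derivative g' x) (at x)"
      using assms(2) \<open>g \<in> K\<close> by blast
    then have "deriv g = g'" using DERIV_imp_deriv by blast
    then show ?thesis using g' real_differentiable_def by blast
  qed
  have "(deriv ^^ n) f \<in> K" for n
    by (induction n) (use assms(1) der in auto)
  then show ?thesis using der unfolding smooth_def by blast
qed

lemma smooth_antideriv:
  assumes "\<And>x. (f has_real_derivative g x) (at x)" "smooth g"
  shows "smooth f"
proof (rule smooth_coinduct[where K = "insert f {h. smooth h}"])
  fix h assume "h \<in> insert f {h. smooth h}"
  then show "\<exists>g'\<in>insert f {h. smooth h}. \<forall>x. (h has_real_derivative g' x) (at x)"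
    using assms smooth_deriv smooth_has_derivative by blast
qed auto

lemma smooth_add: "smooth f \<Longrightarrow> smooth g \<Longrightarrow> smooth (\<lambda>x. f x + g x)"
proof (rule smooth_coinduct[where K = "{\<lambda>x. f x + g x |f g. smooth f \<and> smooth g}"])
  fix h assume "h \<in> {\<lambda>x. f x + g x |f g. smooth f \<and> smooth g}"
  then obtain f g where h: "h = (\<lambda>x. f x + g x)" "smooth f" "smooth g" by blast
  then have "\<forall>x. (h has_real_derivative deriv f x + deriv g x) (at x)"
    by (auto intro!: derivative_eq_intros smooth_has_derivative)
  then show "\<exists>g'\<in>{\<lambda>x. f x + g x |f g. smooth f \<and> smooth g}. \<forall>x. (h has_real_derivative g' x) (at x)"
    by (rule bexI[where x = "\<lambda>x. deriv f x + deriv g x"]) (use smooth_deriv h in blast)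
qed blast

lemma smooth_mult: "smooth f \<Longrightarrow> smooth g \<Longrightarrow> smooth (\<lambda>x. f x * g x)"
proof -
  \<comment> \<open>Single products are not closed under differentiation; finite sums of products
    are, by the Leibniz rule.\<close>
  define K where "K = {\<lambda>x. (\<Sum>i<(n::nat). f i x * g i x) |n f g. \<forall>i. smooth (f i) \<and> smooth (g i)}"
  show "smooth f \<Longrightarrow> smooth g \<Longrightarrow> smooth (\<lambda>x. f x * g x)"
  proof (rule smooth_coinduct[where K = K])
    assume "smooth f" "smooth g"
    then show "(\<lambda>x. f x * g x) \<in> K"
      unfolding K_def
      by (intro CollectI exI[of _ 1] exI[of _ "\<lambda>_. f"] exI[of _ "\<lambda>_. g"]) auto
  next
    fix h assume "h \<in> K"
    then obtain n f g where h: "h = (\<lambda>x. (\<Sum>i<(n::nat). f i x * g i x))"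
      and s: "\<And>i. smooth (f i)" "\<And>i. smooth (g i)"
      unfolding K_def by blast
    \<comment> \<open>The derivative has twice as many summands: in the lower half of the index
      range the first factor is differentiated, in the upper half the second.\<close>
    define F where "F i = (if i < n then deriv (f i) else f (i - n))" for i
    define G where "G i = (if i < n then g i else deriv (g (i - n)))" for i
    have FG: "smooth (F i)" "smooth (G i)" for i
      using s smooth_deriv unfolding F_def G_def by auto
    have eq: "(\<Sum>i<n+n. F i x * G i x) = (\<Sum>i<n. deriv (f i) x * g i x + f i x * deriv (g i) x)" for x
    proof -
      have "(\<Sum>i<n+n. F i x * G i x) = (\<Sum>i<n. F i x * G i x) + (\<Sum>i=n..<n+n. F i x * G i x)"
        using sum.atLeastLessThan_concat[of 0 n "n + n" "\<lambda>i. F i x * G i x"] by (simp add: atLeast0LessThan)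
      also have "(\<Sum>i=n..<n+n. F i x * G i x) = (\<Sum>i<n. F (i+n) x * G (i+n) x)"
        using sum.shift_bounds_nat_ivl[of "\<lambda>i. F i x * G i x" 0 n n] by (simp add: atLeast0LessThan)
      finally show ?thesis unfolding F_def G_def by (simp add: sum.distrib)
    qed
    have "(h has_real_derivative (\<Sum>i<n+n. F i x * G i x)) (at x)" for x
    proof -
      have "((\<lambda>x. f i x * g i x) has_real_derivative deriv (f i) x * g i x + f i x * deriv (g i) x) (at x)" for i
        using DERIV_mult[OF smooth_has_derivative[OF s(1)] smooth_has_derivative[OF s(2)]]
        by (simp add: mult.commute)
      then show ?thesis unfolding h eq by (intro DERIV_sum)
    qed
    moreover have "(\<lambda>x. \<Sum>i<n+n. F i x * G i x) \<in> K"
      unfolding K_def using FG by blast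
    ultimately show "\<exists>g'\<in>K. \<forall>x. (h has_real_derivative g' x) (at x)"
      by (intro bexI[where x = "\<lambda>x. \<Sum>i<n+n. F i x * G i x"]) auto
  qed
qed

lemma smooth_const: "smooth (\<lambda>x. c)"
proof (rule smooth_coinduct[where K = "{\<lambda>x. c |c. True}"])
  fix g assume "g \<in> {\<lambda>x::real. c::real |c. True}"
  then show "\<exists>g'\<in>{\<lambda>x. c |c. True}. \<forall>x. (g has_real_derivative g' x) (at x)"
    by (intro bexI[of _ "\<lambda>x. 0"]) auto
qed blast

section \<open>The flat function exp(-1/x), with polynomial factors in 1/x\<close>

definition flat_poly :: "real poly \<Rightarrow> real \<Rightarrow> real" where
  "flat_poly p x = (if x > 0 then poly p (1 / x) * exp (- (1 / x)) else 0)"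

lemma tendsto_poly_exp_minus: "((\<lambda>y. poly p y * exp (- y)) \<longlongrightarrow> (0::real)) at_top"
proof -
  have "((\<lambda>y. \<Sum>i\<le>degree p. coeff p i * (y ^ i / exp y)) \<longlongrightarrow> (\<Sum>i\<le>degree p. coeff p i * 0)) at_top"
    by (intro tendsto_intros tendsto_power_div_exp_0)
  moreover have "poly p y * exp (- y) = (\<Sum>i\<le>degree p. coeff p i * (y ^ i / exp y))" for y :: real
    by (simp add: poly_altdef exp_minus sum_distrib_right divide_inverse mult.assoc)
  ultimately show ?thesis by simp
qed

lemma flat_poly_tendsto_0: "(flat_poly p \<longlongrightarrow> 0) (at_right 0)"
proof -
  have "((\<lambda>x. poly p (inverse x) * exp (- inverse x)) \<longlongrightarrow> 0) (at_right (0::real))"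
    using filterlim_compose[OF tendsto_poly_exp_minus filterlim_inverse_at_top_right] by simp
  moreover have "\<forall>\<^sub>F x in at_right 0. poly p (inverse x) * exp (- inverse x) = flat_poly p x"
    unfolding flat_poly_def eventually_at_right_field by (auto simp: inverse_eq_divide intro: exI[of _ 1])
  ultimately show ?thesis using Lim_transform_eventually by blast
qed

text \<open>With u = 1/x the derivative of p(u) exp(-u) in x is u^2 (p(u) - p'(u)) exp(-u), again of
  the same form. So the family of all \<open>flat_poly p\<close> is closed under
  differentiation.\<close>

lemma flat_poly_has_derivative:
  "(flat_poly p has_real_derivative flat_poly ([:0, 0, 1:] * (p - pderiv p)) x) (at x)"
proof -
  consider "x > 0" | "x < 0" | "x = 0" by linarith
  then show ?thesis
  proof cases
    case 1
    have "((\<lambda>x. poly p (1 / x) * exp (- (1 / x))) has_real_derivative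
           flat_poly ([:0, 0, 1:] * (p - pderiv p)) x) (at x)"
      using 1 unfolding flat_poly_def
      by (auto intro!: derivative_eq_intros DERIV_chain2[OF poly_DERIV]
          simp: field_simps power2_eq_square)
    then show ?thesis
      by (rule has_field_derivative_transform_within_open[of _ _ _ "{0<..}"])
        (use 1 in \<open>auto simp: flat_poly_def\<close>)
  next
    case 2
    have "((\<lambda>x::real. 0) has_real_derivative flat_poly ([:0, 0, 1:] * (p - pderiv p)) x) (at x)"
      using 2 unfolding flat_poly_def by auto
    then show ?thesis
      by (rule has_field_derivative_transform_within_open[of _ _ _ "{..<0}"])
        (use 2 in \<open>auto simp: flat_poly_def\<close>)
  next
    case 3
    \<comment> \<open>Dividing by h > 0 multiplies the polynomial by its variable, so the right
      difference quotient at 0 is itself flat.\<close>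
    have "((\<lambda>h. flat_poly p h / h) \<longlongrightarrow> 0) (at_right 0)"
    proof (rule Lim_transform_eventually[OF flat_poly_tendsto_0[of "pCons 0 p"]])
      show "\<forall>\<^sub>F x in at_right 0. flat_poly (pCons 0 p) x = flat_poly p x / x"
        unfolding flat_poly_def eventually_at_right_field by (auto intro: exI[of _ 1])
    qed
    moreover have "((\<lambda>h. flat_poly p h / h) \<longlongrightarrow> 0) (at_left 0)"
      by (rule tendsto_eventually)
        (auto simp: eventually_at_left_field flat_poly_def intro: exI[of _ "-1"])
    ultimately have "((\<lambda>h. flat_poly p h / h) \<longlongrightarrow> 0) (at 0)"
      using filterlim_split_at by blast
    then show ?thesis unfolding 3 DERIV_def by (simp add: flat_poly_def)
  qed
qed

lemma smooth_flat_poly_affine: "smooth (\<lambda>x. flat_poly p (m * x + e))"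
proof (rule smooth_coinduct[where K = "{\<lambda>x. flat_poly p (m * x + e) |p. True}"])
  fix g assume "g \<in> {\<lambda>x. flat_poly p (m * x + e) |p. True}"
  then obtain p where g: "g = (\<lambda>x. flat_poly p (m * x + e))" by blast
  have "((\<lambda>x. flat_poly p (m * x + e)) has_real_derivative
          flat_poly (smult m ([:0, 0, 1:] * (p - pderiv p))) (m * x + e)) (at x)" for x
  proof -
    have "((\<lambda>x. flat_poly p (m * x + e)) has_real_derivative
          flat_poly ([:0, 0, 1:] * (p - pderiv p)) (m * x + e) * m) (at x)"
      by (rule DERIV_chain2[OF flat_poly_has_derivative]) (auto intro!: derivative_eq_intros)
    then show ?thesis by (simp add: flat_poly_def mult_ac split: if_splits)
  qed
  then show "\<exists>g'\<in>{\<lambda>x. flat_poly p (m * x + e) |p. True}. \<forall>x. (g has_real_derivative g' x) (at x)"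
    unfolding g
    by (intro bexI[of _ "\<lambda>x. flat_poly (smult m ([:0, 0, 1:] * (p - pderiv p))) (m * x + e)"] CollectI exI) auto
qed blast

lemma flat_poly_1: "flat_poly 1 x = (if x > 0 then exp (- (1 / x)) else 0)"
  by (simp add: flat_poly_def)

section \<open>Test functions: supports, bumps, primitives\<close>

lemma test_functionsI:
  assumes "smooth f" "0 < \<alpha>" "\<beta> < l" "\<And>x. x \<notin> {\<alpha>..\<beta>} \<Longrightarrow> f x = 0"
  shows "f \<in> test_functions l"
proof -
  have "{x. f x \<noteq> 0} \<subseteq> {\<alpha>..\<beta>}" using assms(4) by blast
  then have "closure {x. f x \<noteq> 0} \<subseteq> {\<alpha>..\<beta>}" by (simp add: closure_minimal)
  then show ?thesis
    using assms(1-3) compact_Icc[of \<alpha> \<beta>] unfolding test_functions_def smooth_def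
    by (auto simp: compact_eq_bounded_closed bounded_subset[of "{\<alpha>..\<beta>}"])
qed

lemma test_functionsE:
  assumes "f \<in> test_functions l" "0 < l"
  obtains \<alpha> \<beta> where "smooth f" "0 < \<alpha>" "\<alpha> \<le> \<beta>" "\<beta> < l" "\<And>x. x \<notin> {\<alpha>..\<beta>} \<Longrightarrow> f x = 0"
proof -
  let ?S = "closure {x. f x \<noteq> 0}"
  have S: "compact ?S" "?S \<subseteq> {0<..<l}" "smooth f"
    using assms unfolding test_functions_def smooth_def by auto
  show ?thesis
  proof (cases "?S = {}")
    case True
    then have "f x = 0" for x using closure_subset by blast
    \<comment> \<open>The function is zero and its support empty; any interval strictly inside will
      do.\<close>
    then show ?thesis using that[of "l/2" "l/2"] S assms by auto
  next
    case False
    obtain \<alpha> where \<alpha>: "\<alpha> \<in> ?S" "\<forall>y\<in>?S. \<alpha> \<le> y" using compact_attains_inf[OF S(1) False] by blast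
    obtain \<beta> where \<beta>: "\<beta> \<in> ?S" "\<forall>y\<in>?S. y \<le> \<beta>" using compact_attains_sup[OF S(1) False] by blast
    have "f x = 0" if "x \<notin> {\<alpha>..\<beta>}" for x
      using that \<alpha>(2) \<beta>(2) closure_subset[of "{x. f x \<noteq> 0}"] by auto
    moreover have "0 < \<alpha>" "\<beta> < l" "\<alpha> \<le> \<beta>" using S(2) \<alpha> \<beta>(1) by auto
    ultimately show ?thesis using that S(3) by blast
  qed
qed

text \<open>The shift by \<open>(\<beta> - \<alpha>) / 4\<close> keeps the support in the open interval, so that \<open>\<alpha> = 0\<close> and
  \<open>\<beta> = l\<close> are admissible.\<close>

definition bump :: "real \<Rightarrow> real \<Rightarrow> nat \<Rightarrow> real \<Rightarrow> real" where
  "bump \<alpha> \<beta> k x = flat_poly 1 (real (Suc k) * (x - \<alpha>) - (\<beta> - \<alpha>) / 4)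
                * flat_poly 1 (real (Suc k) * (\<beta> - x) - (\<beta> - \<alpha>) / 4)"

lemma bump_test:
  assumes "0 \<le> \<alpha>" "\<alpha> < \<beta>" "\<beta> \<le> l"
  shows "bump \<alpha> \<beta> k \<in> test_functions l"
proof (rule test_functionsI)
  have "bump \<alpha> \<beta> k = (\<lambda>x. flat_poly 1 (real (Suc k) * x + (- real (Suc k) * \<alpha> - (\<beta> - \<alpha>) / 4))
                      * flat_poly 1 ((- real (Suc k)) * x + (real (Suc k) * \<beta> - (\<beta> - \<alpha>) / 4)))"
    unfolding bump_def by (simp add: algebra_simps)
  then show "smooth (bump \<alpha> \<beta> k)"
    using smooth_mult[OF smooth_flat_poly_affine smooth_flat_poly_affine] by simp
  let ?\<delta> = "(\<beta> - \<alpha>) / 4 / real (Suc k)"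
  have "?\<delta> > 0" using assms by simp
  then show "0 < \<alpha> + ?\<delta>" "\<beta> - ?\<delta> < l" using assms by linarith+
  fix x assume "x \<notin> {\<alpha> + ?\<delta>..\<beta> - ?\<delta>}"
  then consider "x - \<alpha> < ?\<delta>" | "\<beta> - x < ?\<delta>" by fastforce
  then show "bump \<alpha> \<beta> k x = 0"
    by cases (auto simp: bump_def flat_poly_1 field_simps)
qed

lemma bump_bounds: "0 \<le> bump \<alpha> \<beta> k x" "bump \<alpha> \<beta> k x \<le> 1"
  by (auto simp: bump_def flat_poly_1 mult_le_one)

text \<open>At a point of the open interval both arguments grow linearly in \<open>k\<close>, and
  exp(-1/u) tends to 1 as u grows; elsewhere one argument is always negative. With
  \<open>bump_bounds\<close> this feeds dominated convergence.\<close>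

lemma bump_tendsto:
  assumes "\<alpha> < \<beta>"
  shows "(\<lambda>k. bump \<alpha> \<beta> k x) \<longlonglongrightarrow> indicator {\<alpha><..<\<beta>} x"
proof (cases "x \<in> {\<alpha><..<\<beta>}")
  case True
  have lim: "(\<lambda>k. flat_poly 1 (real (Suc k) * u - (\<beta> - \<alpha>) / 4)) \<longlonglongrightarrow> 1" if "u > 0" for u :: real
  proof -
    have t: "filterlim (\<lambda>k. real (Suc k) * u - (\<beta> - \<alpha>) / 4) at_top sequentially"
      using filterlim_tendsto_add_at_top[OF tendsto_const[of "- ((\<beta> - \<alpha>) / 4)"]
          filterlim_at_top_mult_tendsto_pos[OF tendsto_const that
            filterlim_compose[OF filterlim_real_sequentially filterlim_Suc]]]
      by (simp add: algebra_simps)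
    then have "\<forall>\<^sub>F k in sequentially. real (Suc k) * u - (\<beta> - \<alpha>) / 4 > 0"
      unfolding filterlim_at_top_dense by blast
    moreover have "(\<lambda>k. exp (- (1 / (real (Suc k) * u - (\<beta> - \<alpha>) / 4)))) \<longlonglongrightarrow> exp (- 0)"
      by (intro tendsto_exp tendsto_minus tendsto_divide_0[OF tendsto_const]
          filterlim_at_top_imp_at_infinity[OF t])
    moreover have "\<forall>\<^sub>F k in sequentially. exp (- (1 / (real (Suc k) * u - (\<beta> - \<alpha>) / 4)))
        = flat_poly 1 (real (Suc k) * u - (\<beta> - \<alpha>) / 4)"
      using calculation(1) by eventually_elim (simp add: flat_poly_1)
    ultimately show ?thesis
      using Lim_transform_eventually by fastforce
  qed
  have "(\<lambda>k. bump \<alpha> \<beta> k x) \<longlonglongrightarrow> 1 * 1"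
    unfolding bump_def using True by (intro tendsto_mult lim) auto
  then show ?thesis using True by simp
next
  case False
  then consider "x - \<alpha> \<le> 0" | "\<beta> - x \<le> 0" by fastforce
  then have "bump \<alpha> \<beta> k x = 0" for k
  proof cases
    case 1
    then have "real (Suc k) * (x - \<alpha>) \<le> 0" by (simp add: mult_nonneg_nonpos)
    then show ?thesis using assms by (simp add: bump_def flat_poly_1)
  next
    case 2
    then have "real (Suc k) * (\<beta> - x) \<le> 0" by (simp add: mult_nonneg_nonpos)
    then show ?thesis using assms by (simp add: bump_def flat_poly_1)
  qed
  then show ?thesis using False by simp
qed

text \<open>The primitive from 0 vanishes to the left of the support of \<phi>; the zero mean makes
  it vanish to the right as well.\<close>

lemma test_primitive:
  assumes "\<phi> \<in> test_functions l" "0 < l" "integral {0..l} \<phi> = 0"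
  obtains \<psi> where "\<psi> \<in> test_functions l" "deriv \<psi> = \<phi>"
proof -
  obtain \<alpha> \<beta> where \<phi>: "smooth \<phi>" "0 < \<alpha>" "\<alpha> \<le> \<beta>" "\<beta> < l" "\<And>x. x \<notin> {\<alpha>..\<beta>} \<Longrightarrow> \<phi> x = 0"
    using test_functionsE assms(1,2) by blast
  define \<psi> where "\<psi> x = (if x < 0 then 0 else integral {0..x} \<phi>)" for x
  have cont: "continuous_on S \<phi>" for S using \<phi>(1) smooth_continuous by blast
  have z: "\<psi> x = 0" if "x \<notin> {\<alpha>..\<beta>}" for x
  proof (cases "x < \<alpha>")
    case True
    then show ?thesis
      using \<phi>(5) integral_cong[of "{0..x}" \<phi> "\<lambda>_. 0"] by (auto simp: \<psi>_def)
  next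
    case False
    then have x: "x > \<beta>" using that by auto
    have "integral {0..\<beta>} \<phi> = integral {0..y} \<phi>" if "y > \<beta>" for y
    proof -
      have "integral {0..\<beta>} \<phi> + integral {\<beta>..y} \<phi> = integral {0..y} \<phi>"
        using that \<phi>
        by (intro Henstock_Kurzweil_Integration.integral_combine integrable_continuous_real cont) auto
      moreover have "integral {\<beta>..y} \<phi> = 0"
        by (rule integral_unique, rule has_integral_spike_finite[of "{\<beta>}" _ _ "\<lambda>_. 0"])
          (use \<phi>(5) in auto)
      ultimately show ?thesis by simp
    qed
    then show ?thesis unfolding \<psi>_def using x \<phi> assms(3) by (metis)
  qed
  have der: "(\<psi> has_real_derivative \<phi> x) (at x)" for x
  proof (cases "x < \<alpha>")
    case True
    have "((\<lambda>_. 0) has_real_derivative \<phi> x) (at x)" using \<phi>(5)[of x] True by simp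
    then show ?thesis
      by (rule has_field_derivative_transform_within_open[of _ _ _ "{..<\<alpha>}"])
        (use True z in auto)
  next
    case False
    then have x: "x \<in> {0<..<x+1}" using \<phi> by auto
    have "((\<lambda>u. integral {0..u} \<phi>) has_real_derivative \<phi> x) (at x within {0..x+1})"
      by (rule integral_has_real_derivative[OF cont]) (use x in auto)
    then have "((\<lambda>u. integral {0..u} \<phi>) has_real_derivative \<phi> x) (at x)"
      using x by (simp add: at_within_Icc_at)
    then show ?thesis
      by (rule has_field_derivative_transform_within_open[of _ _ _ "{0<..}"])
        (use x in \<open>auto simp: \<psi>_def\<close>)
  qed
  have "smooth \<psi>" using smooth_antideriv der \<phi>(1) by blast
  then have "\<psi> \<in> test_functions l" using test_functionsI \<phi>(2,4) z by blast
  moreover have "deriv \<psi> = \<phi>" using der DERIV_imp_deriv by blast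
  ultimately show ?thesis using that by blast
qed

lemma test_lincomb:
  assumes "\<phi> \<in> test_functions l" "\<psi> \<in> test_functions l" "0 < l"
  shows "(\<lambda>x. \<phi> x + c * \<psi> x) \<in> test_functions l"
proof -
  obtain \<alpha> \<beta> where \<phi>: "smooth \<phi>" "0 < \<alpha>" "\<alpha> \<le> \<beta>" "\<beta> < l" "\<And>x. x \<notin> {\<alpha>..\<beta>} \<Longrightarrow> \<phi> x = 0"
    using test_functionsE assms by blast
  obtain \<gamma> \<delta> where \<psi>: "smooth \<psi>" "0 < \<gamma>" "\<gamma> \<le> \<delta>" "\<delta> < l" "\<And>x. x \<notin> {\<gamma>..\<delta>} \<Longrightarrow> \<psi> x = 0"
    using test_functionsE assms by blast
  show ?thesis
  proof (rule test_functionsI)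
    show "smooth (\<lambda>x. \<phi> x + c * \<psi> x)"
      by (intro smooth_add smooth_mult smooth_const \<phi> \<psi>)
    show "0 < min \<alpha> \<gamma>" "max \<beta> \<delta> < l" using \<phi> \<psi> by auto
    fix x assume "x \<notin> {min \<alpha> \<gamma>..max \<beta> \<delta>}"
    then have "x \<notin> {\<alpha>..\<beta>}" "x \<notin> {\<gamma>..\<delta>}" by auto
    then show "\<phi> x + c * \<psi> x = 0" using \<phi>(5) \<psi>(5) by simp
  qed
qed

section \<open>Square integrable functions on the interval\<close>

abbreviation intv :: "real \<Rightarrow> real measure" where
  "intv l \<equiv> lebesgue_on {0<..<l}"

lemma finite_measure_intv: "finite_measure (intv l)"
  by (rule finite_measure_lebesgue_on) simp

lemma L2_measurable: "f \<in> L2 l \<Longrightarrow> f \<in> borel_measurable (intv l)"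
  by (simp add: L2_def)

lemma integrable_L2_mult:
  assumes "f \<in> L2 l" "g \<in> L2 l"
  shows "integrable (intv l) (\<lambda>x. f x * g x)"
proof (rule Bochner_Integration.integrable_bound[where f = "\<lambda>x. (f x)\<^sup>2 + (g x)\<^sup>2"])
  show "AE x in intv l. norm (f x * g x) \<le> norm ((f x)\<^sup>2 + (g x)\<^sup>2)"
  proof (rule AE_I2)
    fix x
    have "2 * \<bar>f x * g x\<bar> \<le> (f x)\<^sup>2 + (g x)\<^sup>2"
      using sum_squares_bound[of "\<bar>f x\<bar>" "\<bar>g x\<bar>"] by (simp add: abs_mult)
    then show "norm (f x * g x) \<le> norm ((f x)\<^sup>2 + (g x)\<^sup>2)" by simp
  qed
qed (use assms in \<open>auto simp: L2_def\<close>)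

lemma L2_add:
  assumes "f \<in> L2 l" "g \<in> L2 l"
  shows "(\<lambda>x. f x + c * g x) \<in> L2 l"
proof -
  have "integrable (intv l) (\<lambda>x. (f x)\<^sup>2 + 2 * c * (f x * g x) + c\<^sup>2 * (g x)\<^sup>2)"
    using assms integrable_L2_mult[OF assms] by (intro Bochner_Integration.integrable_add integrable_mult_right) (auto simp: L2_def)
  moreover have "(f x + c * g x)\<^sup>2 = (f x)\<^sup>2 + 2 * c * (f x * g x) + c\<^sup>2 * (g x)\<^sup>2" for x
    by (simp add: power2_eq_square algebra_simps)
  ultimately show ?thesis using assms by (auto simp: L2_def)
qed

lemma L2_bounded:
  assumes "f \<in> borel_measurable (intv l)" "\<And>x. x \<in> {0<..<l} \<Longrightarrow> \<bar>f x\<bar> \<le> B"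
  shows "f \<in> L2 l"
proof -
  interpret finite_measure "intv l" by (rule finite_measure_intv)
  have "integrable (intv l) (\<lambda>x. (f x)\<^sup>2)"
  proof (rule integrable_const_bound[where B = "B\<^sup>2"])
    have "(f x)\<^sup>2 \<le> B\<^sup>2" if "x \<in> {0<..<l}" for x
      using power_mono[OF assms(2)[OF that], of 2] by simp
    then show "AE x in intv l. norm ((f x)\<^sup>2) \<le> B\<^sup>2" by (intro AE_I2) simp
  qed (use assms in auto)
  then show ?thesis using assms(1) by (simp add: L2_def)
qed

lemma continuous_imp_L2:
  assumes "continuous_on {0..l} f"
  shows "f \<in> L2 l"
proof -
  have "bounded (f ` {0..l})" using assms compact_Icc compact_continuous_image compact_imp_bounded by blast
  then obtain B where "\<forall>x\<in>{0..l}. \<bar>f x\<bar> \<le> B" unfolding bounded_iff by auto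
  moreover have "f \<in> borel_measurable (intv l)"
    by (rule continuous_imp_measurable_on_sets_lebesgue, rule continuous_on_subset[OF assms]) auto
  ultimately show ?thesis using L2_bounded[of f l B] by auto
qed

lemma L2_integrable: "f \<in> L2 l \<Longrightarrow> integrable (intv l) f"
  using integrable_L2_mult[OF _ continuous_imp_L2[of l "\<lambda>_. 1"], of f] by simp

lemma L2_inner_cong_AE:
  assumes "AE x in intv l. f x = f' x" "f \<in> borel_measurable (intv l)" "f' \<in> borel_measurable (intv l)"
    "g \<in> borel_measurable (intv l)"
  shows "L2_inner l f g = L2_inner l f' g"
  unfolding L2_inner_def by (rule integral_cong_AE) (use assms in auto)

lemma L2_inner_cong:
  assumes "\<And>x. x \<in> {0<..<l} \<Longrightarrow> f x = f' x" "\<And>x. x \<in> {0<..<l} \<Longrightarrow> g x = g' x"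
  shows "L2_inner l f g = L2_inner l f' g'"
  unfolding L2_inner_def by (rule Bochner_Integration.integral_cong) (use assms in auto)

lemma L2_inner_commute: "L2_inner l f g = L2_inner l g f"
  unfolding L2_inner_def by (simp add: mult.commute)

lemma L2_inner_add:
  assumes "f \<in> L2 l" "g \<in> L2 l" "h \<in> L2 l"
  shows "L2_inner l (\<lambda>x. f x + c * g x) h = L2_inner l f h + c * L2_inner l g h"
proof -
  have "L2_inner l (\<lambda>x. f x + c * g x) h = integral\<^sup>L (intv l) (\<lambda>x. f x * h x + c * (g x * h x))"
    unfolding L2_inner_def by (simp add: algebra_simps)
  then show ?thesis
    using integrable_L2_mult[OF assms(1,3)] integrable_L2_mult[OF assms(2,3)] by (simp add: L2_inner_def)
qed

lemma L2_inner_self_nonneg: "0 \<le> L2_inner l f f"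
  unfolding L2_inner_def by simp

lemma L2_Cauchy_Schwarz:
  assumes "f \<in> L2 l" "g \<in> L2 l"
  shows "(L2_inner l f g)\<^sup>2 \<le> L2_inner l f f * L2_inner l g g"
proof -
  have q: "0 \<le> L2_inner l f f + 2 * c * L2_inner l f g + c\<^sup>2 * L2_inner l g g" for c
  proof -
    let ?h = "\<lambda>x. f x + c * g x"
    have "0 \<le> L2_inner l ?h ?h" by (rule L2_inner_self_nonneg)
    also have "\<dots> = L2_inner l f ?h + c * L2_inner l g ?h"
      using assms L2_add by (intro L2_inner_add) auto
    also have "\<dots> = L2_inner l ?h f + c * L2_inner l ?h g" by (simp add: L2_inner_commute)
    also have "\<dots> = L2_inner l f f + c * L2_inner l g f + c * (L2_inner l f g + c * L2_inner l g g)"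
      using assms by (simp add: L2_inner_add)
    finally show ?thesis by (simp add: L2_inner_commute algebra_simps power2_eq_square)
  qed
  show ?thesis
  proof (cases "L2_inner l g g = 0")
    case True
    have "L2_inner l f g = 0"
    proof (rule ccontr)
      assume n: "L2_inner l f g \<noteq> 0"
      \<comment> \<open>At this \<open>c\<close> the quadratic, which is only affine here, takes the
        value -1.\<close>
      show False
        using q[of "- (L2_inner l f f + 1) / (2 * L2_inner l f g)"] True n by (simp add: field_simps)
    qed
    then show ?thesis using True by simp
  next
    case False
    then have p: "L2_inner l g g > 0" using L2_inner_self_nonneg[of l g] by simp
    then show ?thesis using q[of "- L2_inner l f g / L2_inner l g g"]
      by (simp add: field_simps power2_eq_square)
  qed
qed

lemma integral_intv_eq:
  fixes f :: "real \<Rightarrow> real"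
  assumes "integrable (intv l) f"
  shows "integral\<^sup>L (intv l) f = integral {0..l} f"
  using lebesgue_integral_eq_integral[OF assms] integral_open_interval_real[of 0 l f] by simp

lemma integrable_on_intv:
  fixes f :: "real \<Rightarrow> real"
  assumes "integrable (intv l) f"
  shows "f integrable_on {0..l}"
  using integrable_on_lebesgue_on[OF assms] integrable_on_open_interval_real[of f 0 l] by simp

lemma sets_intv_subinterval: "0 \<le> \<alpha> \<Longrightarrow> \<beta> \<le> l \<Longrightarrow> {\<alpha><..<\<beta>} \<in> sets (intv l)"
  by (subst sets_restrict_space_iff) auto

lemma integral_intv_indicator:
  fixes f :: "real \<Rightarrow> real"
  assumes "integrable (intv l) f" "0 \<le> \<alpha>" "\<beta> \<le> l"
  shows "integral\<^sup>L (intv l) (\<lambda>x. f x * indicator {\<alpha><..<\<beta>} x) = integral {\<alpha>..\<beta>} f"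
proof -
  have i: "integrable (intv l) (\<lambda>x. f x * indicator {\<alpha><..<\<beta>} x)"
    using integrable_real_mult_indicator[OF sets_intv_subinterval[OF assms(2,3)] assms(1)] by simp
  have "integral\<^sup>L (intv l) (\<lambda>x. f x * indicator {\<alpha><..<\<beta>} x)
      = integral {0<..<l} (\<lambda>x. if x \<in> {\<alpha><..<\<beta>} then f x else 0)"
    using lebesgue_integral_eq_integral[OF i] by (auto intro!: Henstock_Kurzweil_Integration.integral_cong)
  also have "\<dots> = integral ({0<..<l} \<inter> {\<alpha><..<\<beta>}) f"
    by (simp only: Henstock_Kurzweil_Integration.integral_restrict_Int Int_commute)
  also have "{0<..<l} \<inter> {\<alpha><..<\<beta>} = {\<alpha><..<\<beta>}" using assms by auto
  finally show ?thesis by (simp add: integral_open_interval_real)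
qed

lemma L2_inner_continuous:
  assumes "continuous_on {0..l} f" "continuous_on {0..l} g"
  shows "L2_inner l f g = integral {0..l} (\<lambda>x. f x * g x)"
  unfolding L2_inner_def
  by (rule integral_intv_eq, rule integrable_L2_mult) (use assms continuous_imp_L2 in auto)

section \<open>The fundamental lemma of the calculus of variations\<close>

lemma test_smooth: "\<phi> \<in> test_functions l \<Longrightarrow> smooth \<phi>"
  by (simp add: smooth_def test_functions_def)

lemma test_imp_L2: "\<phi> \<in> test_functions l \<Longrightarrow> \<phi> \<in> L2 l"
  by (intro continuous_imp_L2 smooth_continuous test_smooth)

text \<open>Bumps converge boundedly to indicators, so the integral of \<open>g\<close> over every
  subinterval is 0. By Lebesgue differentiation \<open>g\<close> is almost everywhere the limit of
  its averages over short intervals, hence 0.\<close>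

lemma fundamental_lemma:
  assumes g: "g \<in> L2 l" and orth: "\<And>\<phi>. \<phi> \<in> test_functions l \<Longrightarrow> L2_inner l g \<phi> = 0"
  shows "AE x in intv l. g x = 0"
proof -
  have int: "integrable (intv l) g" using L2_integrable g by blast
  have zero: "integral {\<alpha>..\<beta>} g = 0" if "0 \<le> \<alpha>" "\<alpha> < \<beta>" "\<beta> \<le> l" for \<alpha> \<beta>
  proof -
    have "(\<lambda>k. integral\<^sup>L (intv l) (\<lambda>x. g x * bump \<alpha> \<beta> k x)) \<longlonglongrightarrow>
        integral\<^sup>L (intv l) (\<lambda>x. g x * indicator {\<alpha><..<\<beta>} x)"
    proof (rule integral_dominated_convergence[where w = "\<lambda>x. \<bar>g x\<bar>"])
      show "(\<lambda>x. g x * indicator {\<alpha><..<\<beta>} x) \<in> borel_measurable (intv l)"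
        using L2_measurable[OF g] that
        by (intro borel_measurable_times borel_measurable_indicator sets_intv_subinterval) auto
      show "(\<lambda>x. g x * bump \<alpha> \<beta> k x) \<in> borel_measurable (intv l)" for k
        using L2_measurable[OF g] L2_measurable[OF test_imp_L2[OF bump_test[OF that]]]
        by (intro borel_measurable_times) auto
      show "AE x in intv l. (\<lambda>k. g x * bump \<alpha> \<beta> k x) \<longlonglongrightarrow> g x * indicator {\<alpha><..<\<beta>} x"
        by (intro AE_I2 tendsto_mult tendsto_const bump_tendsto that)
      show "AE x in intv l. norm (g x * bump \<alpha> \<beta> k x) \<le> \<bar>g x\<bar>" for k
        using bump_bounds[of \<alpha> \<beta> k] by (intro AE_I2) (simp add: abs_mult mult_left_le)
    qed (use int in auto)
    moreover have "integral\<^sup>L (intv l) (\<lambda>x. g x * bump \<alpha> \<beta> k x) = 0" for k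
      using orth[OF bump_test[OF that, of k]] by (simp add: L2_inner_def)
    ultimately show ?thesis
      using integral_intv_indicator[OF int] that by (simp add: LIMSEQ_const_iff)
  qed
  \<comment> \<open>Extension by zero: the differentiation theorem asks for integrability on every
    compact interval.\<close>
  define f where "f x = (if x \<in> {0<..<l} then g x else 0)" for x
  have "f integrable_on UNIV"
    unfolding f_def using integrable_on_lebesgue_on[OF int] by (subst integrable_restrict_UNIV) auto
  then have sub: "f integrable_on cbox a b" for a b
    by (rule integrable_on_subcbox) simp
  \<comment> \<open>Outside the negligible set \<open>N\<close> the averages over [x, x + h] tend to
    \<open>f x\<close>.\<close>
  obtain N where N: "negligible N" "\<And>x e. \<lbrakk>x \<notin> N; 0 < e\<rbrakk> \<Longrightarrow>
      \<exists>d>0. \<forall>h. 0 < h \<and> h < d \<longrightarrow> norm (integral (cbox x (x + h *\<^sub>R One)) f /\<^sub>R h ^ DIM(real) - f x) < e"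
    by (rule integrable_ccontinuous_explicit[OF sub]) (blast intro: that)
  have "g x = 0" if x: "x \<in> {0<..<l}" "x \<notin> N" for x
  proof (rule ccontr)
    assume "g x \<noteq> 0"
    then obtain d where d: "d > 0"
      "\<And>h. 0 < h \<and> h < d \<Longrightarrow> norm (integral (cbox x (x + h *\<^sub>R One)) f /\<^sub>R h ^ DIM(real) - f x) < \<bar>g x\<bar>"
      using N(2)[OF x(2), of "\<bar>g x\<bar>"] by auto
    define h where "h = min (d/2) ((l - x)/2)"
    have "h \<le> d/2" "h \<le> (l - x)/2" unfolding h_def by (rule min.cobounded1, rule min.cobounded2)
    moreover have "0 < h" using d(1) x unfolding h_def by simp
    ultimately have h: "0 < h" "h < d" "x + h < l" using d(1) x by auto
    have "integral (cbox x (x + h)) f = integral {x..x+h} g"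
      using x h by (auto intro!: integral_cong simp: f_def)
    then have "integral (cbox x (x + h)) f = 0" using zero[of x "x + h"] x h by auto
    then show False using d(2)[of h] h x by (simp add: f_def)
  qed
  then have "{x \<in> space (intv l). g x \<noteq> 0} \<subseteq> N" by auto
  moreover have "N \<inter> {0<..<l} \<in> null_sets (intv l)"
    using N(1) negligible_subset[of N "N \<inter> {0<..<l}"]
    by (subst null_sets_restrict_space) (auto simp: negligible_iff_null_sets[symmetric])
  ultimately show ?thesis
    by (intro AE_I'[of "N \<inter> {0<..<l}"]) auto
qed

text \<open>The squared difference is continuous, nonnegative and has integral 0. This is how
  almost-everywhere identities become pointwise ones, end points included.\<close>

lemma AE_intv_continuous_eq:
  fixes f g :: "real \<Rightarrow> real"
  assumes "AE x in intv l. f x = g x" "continuous_on {0..l} f" "continuous_on {0..l} g" "0 < l" "x \<in> {0..l}"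
  shows "f x = g x"
proof -
  define h where "h x = f x - g x" for x
  have h: "continuous_on {0..l} h" unfolding h_def using assms by (intro continuous_intros)
  have "L2_inner l h h = L2_inner l (\<lambda>_. 0) h"
    by (rule L2_inner_cong_AE) (use assms(1) L2_measurable[OF continuous_imp_L2[OF h]] in \<open>auto simp: h_def\<close>)
  then have "integral {0..l} (\<lambda>x. h x * h x) = 0"
    using L2_inner_continuous[OF h h] by (simp add: L2_inner_def)
  moreover have "continuous_on {0..l} (\<lambda>x. h x * h x)" using h by (intro continuous_intros)
  ultimately have "h x * h x = 0"
    using integral_eq_0_iff[of 0 l "\<lambda>x. h x * h x"] assms(4,5) by auto
  then show ?thesis by (simp add: h_def)
qed

section \<open>Weak derivatives\<close>

lemma L2_cong:
  assumes "\<And>x. x \<in> {0<..<l} \<Longrightarrow> f x = g x"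
  shows "f \<in> L2 l \<longleftrightarrow> g \<in> L2 l"
proof -
  have "f \<in> borel_measurable (intv l) \<longleftrightarrow> g \<in> borel_measurable (intv l)"
    by (rule measurable_cong) (use assms in simp)
  moreover have "integrable (intv l) (\<lambda>x. (f x)\<^sup>2) \<longleftrightarrow> integrable (intv l) (\<lambda>x. (g x)\<^sup>2)"
    by (rule Bochner_Integration.integrable_cong) (use assms in auto)
  ultimately show ?thesis by (simp add: L2_def)
qed

lemma has_weak_deriv_cong:
  assumes "\<And>x. x \<in> {0<..<l} \<Longrightarrow> f x = f' x"
  shows "has_weak_deriv l f g \<longleftrightarrow> has_weak_deriv l f' g"
  unfolding has_weak_deriv_def using L2_cong[of l f f'] L2_inner_cong[of l f f'] assms by simp

text \<open>The choice sees \<open>f\<close> only through the predicate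
  \<open>has_weak_deriv l f\<close>. Equal predicates give literally the same chosen function, even
  off the interval.\<close>

lemma weak_deriv_cong:
  assumes "\<And>x. x \<in> {0<..<l} \<Longrightarrow> f x = f' x"
  shows "weak_deriv l f = weak_deriv l f'"
  unfolding weak_deriv_def using has_weak_deriv_cong[OF assms] by presburger

lemma has_weak_deriv_AE_cong:
  assumes "has_weak_deriv l f g" "AE x in intv l. g x = g' x" "g' \<in> L2 l"
  shows "has_weak_deriv l f g'"
proof -
  have "L2_inner l g \<phi> = L2_inner l g' \<phi>" if "\<phi> \<in> test_functions l" for \<phi>
    by (rule L2_inner_cong_AE)
      (use assms that test_imp_L2 L2_measurable in \<open>auto simp: has_weak_deriv_def\<close>)
  then show ?thesis using assms unfolding has_weak_deriv_def by simp
qed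

lemma test_deriv_L2: "\<phi> \<in> test_functions l \<Longrightarrow> deriv \<phi> \<in> L2 l"
  by (intro continuous_imp_L2 smooth_continuous smooth_deriv test_smooth)

lemma has_weak_deriv_lincomb:
  assumes "has_weak_deriv l f g" "has_weak_deriv l f' g'"
  shows "has_weak_deriv l (\<lambda>x. f x + c * f' x) (\<lambda>x. g x + c * g' x)"
  using assms unfolding has_weak_deriv_def
  by (auto simp: L2_add L2_inner_add test_imp_L2 test_deriv_L2 algebra_simps)

lemma has_weak_deriv_unique:
  assumes "has_weak_deriv l f g" "has_weak_deriv l f g'"
  shows "AE x in intv l. g x = g' x"
proof -
  have "AE x in intv l. g x + (-1) * g' x = 0"
  proof (rule fundamental_lemma)
    show "(\<lambda>x. g x + (-1) * g' x) \<in> L2 l"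
      using assms L2_add unfolding has_weak_deriv_def by blast
    fix \<phi> assume "\<phi> \<in> test_functions l"
    then show "L2_inner l (\<lambda>x. g x + (-1) * g' x) \<phi> = 0"
      using assms unfolding has_weak_deriv_def by (subst L2_inner_add) (auto simp: test_imp_L2)
  qed
  then show ?thesis by simp
qed

lemma weak_deriv_correct:
  assumes "has_weak_deriv l f g"
  shows "has_weak_deriv l f (weak_deriv l f)"
    and "continuous_on {0..l} g \<Longrightarrow> continuous_on {0..l} (weak_deriv l f)"
proof -
  let ?P = "\<lambda>g. has_weak_deriv l f g \<and>
     ((\<exists>h. has_weak_deriv l f h \<and> continuous_on {0..l} h) \<longrightarrow> continuous_on {0..l} g)"
  have "\<exists>g. ?P g" using assms by blast
  then have "?P (weak_deriv l f)" unfolding weak_deriv_def by (rule someI_ex)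
  then show "has_weak_deriv l f (weak_deriv l f)"
    and "continuous_on {0..l} g \<Longrightarrow> continuous_on {0..l} (weak_deriv l f)" using assms by blast+
qed

lemma weak_deriv_eq:
  assumes "has_weak_deriv l f g" "continuous_on {0..l} g" "0 < l" "x \<in> {0..l}"
  shows "weak_deriv l f x = g x"
  using AE_intv_continuous_eq[OF has_weak_deriv_unique[OF weak_deriv_correct(1)[OF assms(1)] assms(1)]
      weak_deriv_correct(2)[OF assms(1,2)] assms(2-4)] .

lemma test_zero_boundary:
  assumes "\<phi> \<in> test_functions l" "0 < l"
  shows "\<phi> 0 = 0" "\<phi> l = 0"
  using test_functionsE[OF assms] by (metis atLeastAtMost_iff leD)+

lemma integral_deriv_test:
  assumes "\<phi> \<in> test_functions l" "0 < l" "s \<in> {0..l}"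
  shows "integral {s..l} (deriv \<phi>) = - \<phi> s"
proof -
  have "(deriv \<phi> has_integral (\<phi> l - \<phi> s)) {s..l}"
    by (rule fundamental_theorem_of_calculus)
      (use assms smooth_has_derivative[OF test_smooth[OF assms(1)]] in
        \<open>auto simp: has_real_derivative_iff_has_vector_derivative[symmetric] intro: has_field_derivative_at_within\<close>)
  then show ?thesis using test_zero_boundary[OF assms(1,2)] by (simp add: integral_unique)
qed

text \<open>Fubini on the triangle s < x: for fixed s the inner integral of
  \<open>deriv \<phi>\<close> over [s, l] is \<open>- \<phi> s\<close>. No continuity of
  \<open>g\<close> is available, so the product rule cannot be used.\<close>

lemma integral_parts_test:
  assumes g: "g \<in> L2 l" and \<phi>: "\<phi> \<in> test_functions l" and l: "0 < l"
  shows "L2_inner l (\<lambda>x. integral {0..x} g) (deriv \<phi>) = - L2_inner l g \<phi>"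
proof -
  interpret finite_measure "intv l" by (rule finite_measure_intv)
  interpret P: pair_sigma_finite "intv l" "intv l" ..
  define K where "K x s = deriv \<phi> x * (if s < x then g s else 0)" for x s
  have int: "integrable (intv l) g" using L2_integrable g by blast
  have intd: "integrable (intv l) (deriv \<phi>)" using L2_integrable test_deriv_L2 \<phi> by blast
  have "continuous_on {0..l} (deriv \<phi>)" by (intro smooth_continuous smooth_deriv test_smooth[OF \<phi>])
  then have "bounded (deriv \<phi> ` {0..l})"
    using compact_Icc compact_continuous_image compact_imp_bounded by blast
  then obtain B where B: "\<And>x. x \<in> {0..l} \<Longrightarrow> \<bar>deriv \<phi> x\<bar> \<le> B"
    unfolding bounded_iff by (metis imageI real_norm_def)
  have [measurable]: "(\<lambda>x. x) \<in> borel_measurable (intv l)"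
    using id_borel_measurable_lebesgue_on[of "{0<..<l}"] by (simp add: id_def)
  have [measurable]: "g \<in> borel_measurable (intv l)" "deriv \<phi> \<in> borel_measurable (intv l)"
    using int intd by auto
  have mK: "case_prod K \<in> borel_measurable (intv l \<Otimes>\<^sub>M intv l)"
    unfolding K_def by measurable
  \<comment> \<open>Integrable majorant of the kernel, with \<open>B\<close> a bound for
    \<open>deriv \<phi>\<close>.\<close>
  have "integrable (intv l \<Otimes>\<^sub>M intv l) (\<lambda>(x, s). B * \<bar>g s\<bar>)"
    by (rule P.Fubini_integrable) (use int in auto)
  then have iK: "integrable (intv l \<Otimes>\<^sub>M intv l) (case_prod K)"
  proof (rule Bochner_Integration.integrable_bound[OF _ mK])
    have "norm (K x s) \<le> norm (B * \<bar>g s\<bar>)" if "x \<in> {0<..<l}" for x s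
    proof -
      have "\<bar>deriv \<phi> x\<bar> \<le> \<bar>B\<bar>" using B[of x] that by auto
      then show ?thesis unfolding K_def by (auto simp: abs_mult intro: mult_right_mono)
    qed
    then show "AE p in intv l \<Otimes>\<^sub>M intv l. norm (case_prod K p) \<le> norm (case p of (x, s) \<Rightarrow> B * \<bar>g s\<bar>)"
      by (intro AE_I2) (auto simp: space_pair_measure)
  qed
  have "L2_inner l (\<lambda>x. integral {0..x} g) (deriv \<phi>) = (\<integral>x. (\<integral>s. K x s \<partial>intv l) \<partial>intv l)"
    unfolding L2_inner_def
  proof (rule Bochner_Integration.integral_cong)
    fix x assume "x \<in> space (intv l)"
    then have x: "x \<in> {0<..<l}" by simp
    have "(\<integral>s. K x s \<partial>intv l) = (\<integral>s. deriv \<phi> x * (g s * indicator {0<..<x} s) \<partial>intv l)"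
      by (rule Bochner_Integration.integral_cong) (auto simp: K_def)
    also have "\<dots> = deriv \<phi> x * integral {0..x} g"
      using integral_intv_indicator[OF int, of 0 x] x by simp
    finally show "integral {0..x} g * deriv \<phi> x = (\<integral>s. K x s \<partial>intv l)" by simp
  qed simp
  also have "\<dots> = (\<integral>s. (\<integral>x. K x s \<partial>intv l) \<partial>intv l)" by (rule P.Fubini_integral[OF iK, symmetric])
  also have "\<dots> = (\<integral>s. - (g s * \<phi> s) \<partial>intv l)"
  proof (rule Bochner_Integration.integral_cong)
    fix s assume "s \<in> space (intv l)"
    then have s: "s \<in> {0<..<l}" by simp
    have "(\<integral>x. K x s \<partial>intv l) = (\<integral>x. g s * (deriv \<phi> x * indicator {s<..<l} x) \<partial>intv l)"
      by (rule Bochner_Integration.integral_cong) (auto simp: K_def)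
    also have "\<dots> = g s * integral {s..l} (deriv \<phi>)"
      using integral_intv_indicator[OF intd, of s l] s by simp
    finally show "(\<integral>x. K x s \<partial>intv l) = - (g s * \<phi> s)"
      using integral_deriv_test[OF \<phi> l, of s] s by simp
  qed simp
  finally show ?thesis by (simp add: L2_inner_def)
qed

lemma primitive_continuous:
  assumes "g \<in> L2 l"
  shows "continuous_on {0..l} (\<lambda>x. C + integral {0..x} g)"
  by (intro continuous_intros indefinite_integral_continuous_1 integrable_on_intv L2_integrable assms)

text \<open>The du Bois-Reymond argument: \<open>f\<close> minus the primitive of \<open>g\<close>
  is orthogonal to derivatives of test functions, that is, to all test functions of mean zero.
  Correcting an arbitrary test function by a multiple of one fixed bump makes its mean zero, so the
  difference acts like a constant.\<close>

lemma weak_deriv_representation: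
  assumes fg: "has_weak_deriv l f g" and l: "0 < l"
  shows "\<exists>C. AE x in intv l. f x = C + integral {0..x} g"
proof -
  define G where "G x = integral {0..x} g" for x
  define H where "H x = f x + (-1) * G x" for x
  have f: "f \<in> L2 l" and g: "g \<in> L2 l" using fg by (auto simp: has_weak_deriv_def)
  have G: "G \<in> L2 l" using primitive_continuous[OF g, of 0] unfolding G_def by (intro continuous_imp_L2) simp
  have H: "H \<in> L2 l" unfolding H_def using L2_add[OF f G] .
  have zero: "L2_inner l H (deriv \<psi>) = 0" if "\<psi> \<in> test_functions l" for \<psi>
  proof -
    have "L2_inner l H (deriv \<psi>) = L2_inner l f (deriv \<psi>) + (-1) * L2_inner l G (deriv \<psi>)"
      unfolding H_def by (rule L2_inner_add[OF f G test_deriv_L2[OF that]])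
    moreover have "L2_inner l f (deriv \<psi>) = - L2_inner l g \<psi>" using fg that by (simp add: has_weak_deriv_def)
    moreover have "L2_inner l G (deriv \<psi>) = - L2_inner l g \<psi>"
      unfolding G_def by (rule integral_parts_test[OF g that l])
    ultimately show ?thesis by simp
  qed
  define \<phi>0 where "\<phi>0 = bump 0 l 0"
  have \<phi>0: "\<phi>0 \<in> test_functions l" unfolding \<phi>0_def by (rule bump_test) (use l in auto)
  \<comment> \<open>The bump is nonnegative, continuous and positive at the midpoint.\<close>
  have "integral {0..l} \<phi>0 \<noteq> 0"
  proof
    assume "integral {0..l} \<phi>0 = 0"
    then have "\<forall>x\<in>{0..l}. \<phi>0 x = 0"
      using integral_eq_0_iff[of 0 l \<phi>0] bump_bounds[of 0 l 0] l smooth_continuous[OF test_smooth[OF \<phi>0]]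
      unfolding \<phi>0_def by auto
    then have "\<phi>0 (l/2) = 0" using l by auto
    then show False using l by (simp add: \<phi>0_def bump_def flat_poly_1)
  qed
  define C where "C = L2_inner l H \<phi>0 / integral {0..l} \<phi>0"
  have "AE x in intv l. H x + (-1) * C = 0"
  proof (rule fundamental_lemma)
    have CL: "(\<lambda>_. C) \<in> L2 l" by (intro continuous_imp_L2 continuous_intros)
    then show "(\<lambda>x. H x + (-1) * C) \<in> L2 l" using L2_add[OF H] by blast
    fix \<phi> assume \<phi>: "\<phi> \<in> test_functions l"
    \<comment> \<open>The multiple of \<open>\<phi>0\<close> that cancels the mean of
      \<phi>.\<close>
    define c where "c = - integral {0..l} \<phi> / integral {0..l} \<phi>0"
    have t: "(\<lambda>x. \<phi> x + c * \<phi>0 x) \<in> test_functions l" by (rule test_lincomb[OF \<phi> \<phi>0 l])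
    have "integral {0..l} (\<lambda>x. \<phi> x + c * \<phi>0 x) = integral {0..l} \<phi> + c * integral {0..l} \<phi>0"
      using smooth_continuous[OF test_smooth[OF \<phi>]] smooth_continuous[OF test_smooth[OF \<phi>0]]
      by (subst Henstock_Kurzweil_Integration.integral_add)
        (auto intro!: integrable_continuous_real continuous_intros)
    then have "integral {0..l} (\<lambda>x. \<phi> x + c * \<phi>0 x) = 0"
      using \<open>integral {0..l} \<phi>0 \<noteq> 0\<close> by (simp add: c_def)
    then obtain \<psi> where "\<psi> \<in> test_functions l" "deriv \<psi> = (\<lambda>x. \<phi> x + c * \<phi>0 x)"
      using test_primitive[OF t l] by blast
    then have "L2_inner l (\<lambda>x. \<phi> x + c * \<phi>0 x) H = 0" using zero L2_inner_commute by metis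
    then have "L2_inner l \<phi> H + c * L2_inner l \<phi>0 H = 0"
      by (simp add: L2_inner_add[OF test_imp_L2[OF \<phi>] test_imp_L2[OF \<phi>0] H])
    then have "L2_inner l H \<phi> = C * integral {0..l} \<phi>"
      by (simp add: c_def C_def L2_inner_commute field_simps)
    moreover have "L2_inner l (\<lambda>_. C) \<phi> = C * integral {0..l} \<phi>"
      using L2_inner_continuous[OF _ smooth_continuous[OF test_smooth[OF \<phi>]], of l "\<lambda>_. C"] by simp
    ultimately show "L2_inner l (\<lambda>x. H x + (-1) * C) \<phi> = 0"
      using L2_inner_add[OF H CL test_imp_L2[OF \<phi>], of "-1"] by simp
  qed
  then show ?thesis unfolding H_def G_def by (intro exI[of _ C]) (auto elim!: eventually_mono)
qed

lemma H1_continuous_representative: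
  assumes "f \<in> H1 l" "0 < l"
  obtains h where "continuous_on {0..l} h" "AE x in intv l. f x = h x"
proof -
  obtain g where g: "has_weak_deriv l f g" using assms(1) by (auto simp: H1_def)
  then obtain C where "AE x in intv l. f x = C + integral {0..x} g"
    using weak_deriv_representation assms(2) by blast
  then show ?thesis using that primitive_continuous g unfolding has_weak_deriv_def by blast
qed

text \<open>The chosen derivative agrees almost everywhere with a continuous function. That function
  is then a weak derivative too, and \<open>weak_deriv\<close> takes a continuous one whenever there
  is one.\<close>

lemma weak_deriv_continuous:
  assumes "f \<in> H1 l" "weak_deriv l f \<in> H1 l" "0 < l"
  shows "continuous_on {0..l} (weak_deriv l f)"
proof -
  obtain g where g: "has_weak_deriv l f g" using assms(1) by (auto simp: H1_def)
  obtain h where h: "continuous_on {0..l} h" "AE x in intv l. weak_deriv l f x = h x"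
    using H1_continuous_representative[OF assms(2,3)] .
  have "has_weak_deriv l f h"
    by (rule has_weak_deriv_AE_cong[OF weak_deriv_correct(1)[OF g] h(2) continuous_imp_L2[OF h(1)]])
  then show ?thesis using weak_deriv_correct(2) h(1) by blast
qed

lemma weak_deriv_integral:
  assumes "has_weak_deriv l f g" "continuous_on {0..l} f" "0 < l" "x \<in> {0..l}"
  shows "f x = f 0 + integral {0..x} g"
proof -
  have g: "g \<in> L2 l" using assms(1) by (simp add: has_weak_deriv_def)
  obtain C where "AE x in intv l. f x = C + integral {0..x} g"
    using weak_deriv_representation assms by blast
  then have *: "f x = C + integral {0..x} g" if "x \<in> {0..l}" for x
    using AE_intv_continuous_eq[OF _ assms(2) primitive_continuous[OF g] assms(3) that] by blast
  show ?thesis using *[of 0] *[OF assms(4)] assms(3) by simp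
qed

lemma weak_deriv_classical:
  assumes "has_weak_deriv l f g" "continuous_on {0..l} f" "continuous_on {0..l} g" "0 < l" "x \<in> {0..l}"
  shows "(f has_real_derivative g x) (at x within {0..l})"
proof -
  have "((\<lambda>x. f 0 + integral {0..x} g) has_real_derivative g x) (at x within {0..l})"
    using integral_has_real_derivative[OF assms(3,5)] by (auto intro!: derivative_eq_intros)
  then show ?thesis
    by (rule has_field_derivative_transform_within[OF _ zero_less_one assms(5)])
      (rule weak_deriv_integral[OF assms(1,2,4), symmetric])
qed

text \<open>Writes u(0) = u(x) - (integral of r over [0, x]), bounds the integral by Cauchy-Schwarz
  and averages over x. It makes end point values continuous in the H1 norm, which is needed because
  \<open>H10\<close> is defined as a closure in that norm.\<close>

lemma trace_inequality:
  assumes ur: "has_weak_deriv l u r" and u: "continuous_on {0..l} u" and l: "0 < l"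
  shows "l * (u 0)\<^sup>2 \<le> 2 * L2_inner l u u + 2 * l\<^sup>2 * L2_inner l r r"
    and "(u l)\<^sup>2 \<le> 2 * (u 0)\<^sup>2 + 2 * l * L2_inner l r r"
proof -
  have r: "r \<in> L2 l" using ur by (simp add: has_weak_deriv_def)
  have int: "(integral {0..x} r)\<^sup>2 \<le> l * L2_inner l r r" if x: "x \<in> {0..l}" for x
  proof -
    \<comment> \<open>Pairing \<open>r\<close> with this indicator gives its primitive at x; the
      squared norm of the indicator is x, at most l.\<close>
    let ?i = "indicator {0<..<x} :: real \<Rightarrow> real"
    have i: "?i \<in> L2 l"
      by (rule L2_bounded[where B = 1])
        (use sets_intv_subinterval[of 0 x l] x in \<open>auto simp: indicator_def\<close>)
    have "integral\<^sup>L (intv l) (\<lambda>x. 1 * ?i x) = x"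
      using integral_intv_indicator[OF L2_integrable[OF continuous_imp_L2[of l "\<lambda>_. 1"]], of 0 x] x by simp
    moreover have "?i y * ?i y = 1 * ?i y" for y by (simp add: indicator_def)
    ultimately have "L2_inner l ?i ?i = x" unfolding L2_inner_def by presburger
    then have "(L2_inner l r ?i)\<^sup>2 \<le> L2_inner l r r * x"
      using L2_Cauchy_Schwarz[OF r i] by simp
    moreover have "L2_inner l r ?i = integral {0..x} r"
      using integral_intv_indicator[OF L2_integrable[OF r], of 0 x] x by (simp add: L2_inner_def)
    ultimately show ?thesis
      using mult_left_mono[of x l "L2_inner l r r"] L2_inner_self_nonneg[of l r] x by (simp add: mult.commute)
  qed
  have sq: "(p + q)\<^sup>2 \<le> 2 * p\<^sup>2 + 2 * q\<^sup>2" for p q :: real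
    using sum_squares_bound[of p q] by (simp add: power2_sum)
  have u0: "(u 0)\<^sup>2 \<le> 2 * (u x * u x) + 2 * (l * L2_inner l r r)" if x: "x \<in> {0..l}" for x
  proof -
    have "(u 0)\<^sup>2 = (u x + - integral {0..x} r)\<^sup>2" using weak_deriv_integral[OF ur u l x] by simp
    also have "\<dots> \<le> 2 * (u x)\<^sup>2 + 2 * (integral {0..x} r)\<^sup>2" using sq[of "u x" "- integral {0..x} r"] by simp
    finally show ?thesis using int[OF x] by (simp add: power2_eq_square)
  qed
  have "integral {0..l} (\<lambda>x. (u 0)\<^sup>2) \<le> integral {0..l} (\<lambda>x. 2 * (u x * u x) + 2 * (l * L2_inner l r r))"
    by (rule integral_le) (use u0 u in \<open>auto intro!: integrable_continuous_real continuous_intros\<close>)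
  also have "\<dots> = 2 * L2_inner l u u + 2 * (l * L2_inner l r r) * l"
    using l u by (subst integral_add)
      (auto intro!: integrable_continuous_real continuous_intros simp: L2_inner_continuous)
  finally show "l * (u 0)\<^sup>2 \<le> 2 * L2_inner l u u + 2 * l\<^sup>2 * L2_inner l r r"
    using l by (simp add: power2_eq_square mult_ac)
  have "(u l)\<^sup>2 \<le> 2 * (u 0)\<^sup>2 + 2 * (integral {0..l} r)\<^sup>2"
    using sq[of "u 0" "integral {0..l} r"] weak_deriv_integral[OF ur u l, of l] l by simp
  then show "(u l)\<^sup>2 \<le> 2 * (u 0)\<^sup>2 + 2 * l * L2_inner l r r" using int[of l] l by simp
qed

lemma has_weak_deriv_test:
  assumes \<phi>: "\<phi> \<in> test_functions l" and l: "0 < l"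
  shows "has_weak_deriv l \<phi> (deriv \<phi>)"
proof -
  have "\<phi> x = integral {0..x} (deriv \<phi>)" if "x \<in> {0<..<l}" for x
  proof -
    have "(deriv \<phi> has_integral (\<phi> x - \<phi> 0)) {0..x}"
      by (rule fundamental_theorem_of_calculus)
        (use that smooth_has_derivative[OF test_smooth[OF \<phi>]] in
          \<open>auto simp: has_real_derivative_iff_has_vector_derivative[symmetric] intro: has_field_derivative_at_within\<close>)
    then show ?thesis using test_zero_boundary[OF \<phi> l] by (simp add: integral_unique)
  qed
  then have "L2_inner l \<phi> (deriv \<psi>) = L2_inner l (\<lambda>x. integral {0..x} (deriv \<phi>)) (deriv \<psi>)" for \<psi>
    by (intro L2_inner_cong) auto
  then show ?thesis
    using integral_parts_test[OF test_deriv_L2[OF \<phi>] _ l] test_imp_L2[OF \<phi>] test_deriv_L2[OF \<phi>]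
    unfolding has_weak_deriv_def by simp
qed

text \<open>Subtracting a test function does not change the end point values but makes the H1 norm
  as small as desired, so the trace inequality bounds these values by multiples of
  \<open>\<epsilon>\<close> squared.\<close>

lemma H10_boundary:
  assumes f: "f \<in> H10 l" "continuous_on {0..l} f" and l: "0 < l"
  shows "f 0 = 0" "f l = 0"
proof -
  obtain g where g: "has_weak_deriv l f g" using f by (auto simp: H10_def H1_def)
  have bound: "l * (f 0)\<^sup>2 \<le> (2 + 2 * l\<^sup>2) * \<epsilon>\<^sup>2 \<and> (f l)\<^sup>2 \<le> 2 * (f 0)\<^sup>2 + 2 * l * \<epsilon>\<^sup>2" if "\<epsilon> > 0" for \<epsilon>
  proof -
    obtain \<phi> where \<phi>: "\<phi> \<in> test_functions l" "H1_norm l (\<lambda>x. f x - \<phi> x) < \<epsilon>"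
      using f(1) \<open>\<epsilon> > 0\<close> by (auto simp: H10_def)
    define u where "u x = f x - \<phi> x" for x
    define r where "r = weak_deriv l u"
    have "has_weak_deriv l (\<lambda>x. f x + (-1) * \<phi> x) (\<lambda>x. g x + (-1) * deriv \<phi> x)"
      by (rule has_weak_deriv_lincomb[OF g has_weak_deriv_test[OF \<phi>(1) l]])
    then have ur: "has_weak_deriv l u r"
      unfolding r_def u_def by (intro weak_deriv_correct) simp
    have uc: "continuous_on {0..l} u"
      unfolding u_def by (intro continuous_intros f smooth_continuous[OF test_smooth[OF \<phi>(1)]])
    have "sqrt (L2_inner l u u + L2_inner l r r) < \<epsilon>"
      using \<phi>(2) unfolding H1_norm_def r_def u_def .
    then have "L2_inner l u u + L2_inner l r r \<le> \<epsilon>\<^sup>2"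
      using \<open>\<epsilon> > 0\<close> by (simp add: real_less_lsqrt less_imp_le real_le_lsqrt sqrt_le_D)
    then have b: "L2_inner l u u \<le> \<epsilon>\<^sup>2" "L2_inner l r r \<le> \<epsilon>\<^sup>2"
      using L2_inner_self_nonneg[of l u] L2_inner_self_nonneg[of l r] by linarith+
    have eq: "u 0 = f 0" "u l = f l" using test_zero_boundary[OF \<phi>(1) l] by (auto simp: u_def)
    have "2 * l\<^sup>2 * L2_inner l r r \<le> 2 * l\<^sup>2 * \<epsilon>\<^sup>2" using b(2) by (intro mult_left_mono) auto
    then have 1: "l * (f 0)\<^sup>2 \<le> (2 + 2 * l\<^sup>2) * \<epsilon>\<^sup>2"
      using trace_inequality(1)[OF ur uc l] b(1) eq by (simp add: algebra_simps)
    have "2 * l * L2_inner l r r \<le> 2 * l * \<epsilon>\<^sup>2" using b(2) l by (intro mult_left_mono) auto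
    then have 2: "(f l)\<^sup>2 \<le> 2 * (f 0)\<^sup>2 + 2 * l * \<epsilon>\<^sup>2"
      using trace_inequality(2)[OF ur uc l] eq by simp
    show ?thesis using 1 2 by blast
  qed
  have lim: "((\<lambda>\<epsilon>. A + B * \<epsilon>\<^sup>2) \<longlongrightarrow> A) (at_right (0::real))" for A B :: real
  proof -
    have "((\<lambda>\<epsilon>. A + B * \<epsilon>\<^sup>2) \<longlongrightarrow> A + B * 0\<^sup>2) (at_right (0::real))" by (intro tendsto_intros)
    then show ?thesis by simp
  qed
  have "l * (f 0)\<^sup>2 \<le> 0"
    by (rule tendsto_lowerbound[OF lim[of 0 "2 + 2 * l\<^sup>2"]])
      (use bound in \<open>auto simp: eventually_at_right_field intro!: exI[of _ 1]\<close>)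
  then show f0: "f 0 = 0" using l by (simp add: mult_le_0_iff)
  have "(f l)\<^sup>2 \<le> 0"
    by (rule tendsto_lowerbound[OF lim[of 0 "2 * l"]])
      (use bound f0 in \<open>auto simp: eventually_at_right_field intro!: exI[of _ 1]\<close>)
  then show "f l = 0" by simp
qed

lemma zero_trace_boundary:
  assumes "zero_trace l f" "continuous_on {0..l} f" "0 < l"
  shows "f 0 = 0" "f l = 0"
  using assms AE_intv_continuous_eq[OF _ assms(2) _ assms(3)] unfolding zero_trace_def
  by (metis atLeastAtMost_iff less_imp_le order_refl)+

section \<open>Smooth vectors of the operator\<close>

lemma H1_lincomb: "f \<in> H1 l \<Longrightarrow> g \<in> H1 l \<Longrightarrow> (\<lambda>x. f x + k * g x) \<in> H1 l"
  unfolding H1_def using has_weak_deriv_lincomb by blast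

lemma H1_scale: "f \<in> H1 l \<Longrightarrow> (\<lambda>x. k * f x) \<in> H1 l"
  using H1_lincomb[of f l f "k - 1"] by (simp add: algebra_simps)

lemma H10_imp_H1: "f \<in> H10 l \<Longrightarrow> f \<in> H1 l"
  by (simp add: H10_def)

lemma H1_has_weak_deriv: "f \<in> H1 l \<Longrightarrow> has_weak_deriv l f (weak_deriv l f)"
  unfolding H1_def using weak_deriv_correct(1) by blast

lemma opB_nth:
  "opB l a b c d V x $ 1 = - a * weak_deriv l (comp 2 V) x + b * weak_deriv l (comp 3 V) x"
  "opB l a b c d V x $ 2 = - weak_deriv l (comp 1 V) x"
  "opB l a b c d V x $ 3 = d * weak_deriv l (comp 1 V) x - c * weak_deriv l (weak_deriv l (comp 3 V)) x"
  by (simp_all add: opB_def)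

lemma continuous_on_vec3:
  fixes V :: "'a::topological_space \<Rightarrow> real^3"
  shows "continuous_on S V \<longleftrightarrow> (\<forall>k. continuous_on S (\<lambda>x. V x $ k))"
  using continuous_on_vec_lambda[of S "\<lambda>k x. V x $ k"] by (auto intro: continuous_on_component)

locale wave_heat_system =
  fixes l a b c d :: real
  assumes l: "0 < l" and a: "0 < a" and c: "0 < c" and bd: "0 < b / d"
begin

abbreviation B where "B \<equiv> opB l a b c d"

text \<open>Isolates the regularity and boundary conditions behind the Fourier expansion in a form
  that passes from \<open>V\<close> to \<open>B V\<close>, so that relations between their
  coefficients can be iterated.\<close>

definition smooth_vec :: "(real \<Rightarrow> real^3) \<Rightarrow> bool" where
  "smooth_vec V \<longleftrightarrow> continuous_on {0..l} V \<and> (\<forall>k. (B ^^ k) V \<in> dom_B l)"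

lemma Xinf_imp_smooth_vec: "V \<in> Xinf l a b c d \<Longrightarrow> smooth_vec V"
  unfolding Xinf_def smooth_vec_def dom_B_power_def by blast

lemma smooth_vec_comp: "smooth_vec V \<Longrightarrow> continuous_on {0..l} (comp k V)"
  unfolding smooth_vec_def continuous_on_vec3 by blast

lemma smooth_vec_dom:
  assumes "smooth_vec V"
  shows "V \<in> dom_B l" "B V \<in> dom_B l"
proof -
  have "(B ^^ 0) V \<in> dom_B l" "(B ^^ 1) V \<in> dom_B l" using assms unfolding smooth_vec_def by blast+
  then show "V \<in> dom_B l" "B V \<in> dom_B l" by simp_all
qed

text \<open>\<open>B V\<close> in the domain puts its three components in H1. Solving the component
  formulas of \<open>B\<close>, with a and c nonzero, shows that the first derivatives and the
  second derivative of the third component are in H1 too, hence continuous.\<close>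

lemma smooth_vec_derivs:
  assumes V: "smooth_vec V"
  shows "continuous_on {0..l} (weak_deriv l (comp k V))"
    and "continuous_on {0..l} (weak_deriv l (weak_deriv l (comp 3 V)))"
    and "has_weak_deriv l (comp k V) (weak_deriv l (comp k V))"
    and "has_weak_deriv l (weak_deriv l (comp 3 V)) (weak_deriv l (weak_deriv l (comp 3 V)))"
proof -
  have V1: "comp 1 V \<in> H1 l" and V2: "comp 2 V \<in> H1 l" and V3: "comp 3 V \<in> H1 l"
    and V3': "weak_deriv l (comp 3 V) \<in> H1 l"
    using smooth_vec_dom(1)[OF V] H10_imp_H1 by (auto simp: dom_B_def H2_def)
  have W1: "comp 1 (B V) \<in> H1 l" and W2: "comp 2 (B V) \<in> H1 l" and W3: "comp 3 (B V) \<in> H1 l"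
    using smooth_vec_dom(2)[OF V] H10_imp_H1 by (auto simp: dom_B_def H2_def)
  have V1': "weak_deriv l (comp 1 V) \<in> H1 l"
    using H1_scale[OF W2, of "-1"] by (simp add: opB_nth)
  have "(\<lambda>x. - (1 / a) * comp 1 (B V) x + b / a * weak_deriv l (comp 3 V) x) \<in> H1 l"
    by (rule H1_lincomb[OF H1_scale[OF W1] V3'])
  moreover have "- (1 / a) * comp 1 (B V) x + b / a * weak_deriv l (comp 3 V) x = weak_deriv l (comp 2 V) x" for x
    using a by (simp add: opB_nth field_simps)
  ultimately have V2': "weak_deriv l (comp 2 V) \<in> H1 l" by simp
  have "(\<lambda>x. - (1 / c) * comp 3 (B V) x + d / c * weak_deriv l (comp 1 V) x) \<in> H1 l"
    by (rule H1_lincomb[OF H1_scale[OF W3] V1'])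
  moreover have "- (1 / c) * comp 3 (B V) x + d / c * weak_deriv l (comp 1 V) x
      = weak_deriv l (weak_deriv l (comp 3 V)) x" for x
    using c by (simp add: opB_nth field_simps)
  ultimately have V3'': "weak_deriv l (weak_deriv l (comp 3 V)) \<in> H1 l" by simp
  show "continuous_on {0..l} (weak_deriv l (comp k V))"
    using weak_deriv_continuous[OF V1 V1' l] weak_deriv_continuous[OF V2 V2' l]
      weak_deriv_continuous[OF V3 V3' l] exhaust_3[of k] by auto
  show "continuous_on {0..l} (weak_deriv l (weak_deriv l (comp 3 V)))"
    by (rule weak_deriv_continuous[OF V3' V3'' l])
  show "has_weak_deriv l (comp k V) (weak_deriv l (comp k V))"
    using H1_has_weak_deriv V1 V2 V3 exhaust_3[of k] by auto
  show "has_weak_deriv l (weak_deriv l (comp 3 V)) (weak_deriv l (weak_deriv l (comp 3 V)))"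
    by (rule H1_has_weak_deriv[OF V3'])
qed

lemma smooth_vec_B:
  assumes V: "smooth_vec V"
  shows "smooth_vec (B V)"
proof -
  have "continuous_on {0..l} (comp k (B V))" for k
    using exhaust_3[of k]
    by (elim disjE; simp only: opB_nth; intro continuous_intros smooth_vec_derivs[OF V])
  then have "continuous_on {0..l} (B V)" by (simp add: continuous_on_vec3)
  moreover have "(B ^^ k) (B V) = (B ^^ Suc k) V" for k by (simp add: funpow_swap1)
  ultimately show ?thesis using V unfolding smooth_vec_def by metis
qed

lemma smooth_vec_B_power: "smooth_vec V \<Longrightarrow> smooth_vec ((B ^^ k) V)"
  by (induction k) (auto simp: smooth_vec_B)

lemma smooth_vec_boundary:
  assumes V: "smooth_vec V" and x: "x \<in> {0, l}"
  shows "comp 1 V x = 0" "weak_deriv l (comp 2 V) x = 0" "weak_deriv l (comp 3 V) x = 0"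
proof -
  have *: "comp 1 U x = 0" if "smooth_vec U" for U
    using H10_boundary[of "comp 1 U" l] smooth_vec_dom(1)[OF that] smooth_vec_comp[OF that] l x
    by (auto simp: dom_B_def)
  show "comp 1 V x = 0" by (rule *[OF V])
  show 3: "weak_deriv l (comp 3 V) x = 0"
    using zero_trace_boundary[of l "weak_deriv l (comp 3 V)"] smooth_vec_dom(1)[OF V]
      smooth_vec_derivs(1)[OF V] l x by (auto simp: dom_B_def)
  \<comment> \<open>The first component of \<open>B V\<close> vanishes at the ends, so a times this
    derivative equals b times the vanishing derivative of the third component.\<close>
  show "weak_deriv l (comp 2 V) x = 0"
    using *[OF smooth_vec_B[OF V]] 3 a by (simp add: opB_nth)
qed

subsection \<open>Fourier coefficients\<close>

abbreviation \<nu> where "\<nu> n \<equiv> freq l n"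

definition \<kappa> :: "nat \<Rightarrow> real" where
  "\<kappa> n = (if n = 0 then sqrt (1 / l) else sqrt (2 / l))"

text \<open>The index 0 fits the general formula because its frequency is 0: the sine gives 0 and
  the cosine 1.\<close>

lemma Phi_nth:
  "Phi l n x $ 1 = \<kappa> n * sin (\<nu> n * x)"
  "Phi l n x $ 2 = \<kappa> n * cos (\<nu> n * x)"
  "Phi l n x $ 3 = \<kappa> n * cos (\<nu> n * x)"
  by (simp_all add: Phi_def \<kappa>_def freq_def)

lemma sin_freq: "sin (\<nu> n * l) = 0"
  using l sin_npi2[of n] by (simp add: freq_def)

lemma weak_deriv_parts:
  assumes fg: "has_weak_deriv l f g" "continuous_on {0..l} f" "continuous_on {0..l} g"
    and \<psi>: "\<And>x. (\<psi> has_real_derivative \<psi>' x) (at x)" "continuous_on {0..l} \<psi>'"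
  shows "L2_inner l g \<psi> = f l * \<psi> l - f 0 * \<psi> 0 - L2_inner l f \<psi>'"
proof -
  have \<psi>c: "continuous_on {0..l} \<psi>"
    using \<psi>(1) by (meson DERIV_isCont continuous_at_imp_continuous_on)
  have "((\<lambda>x. g x * \<psi> x + f x * \<psi>' x) has_integral (f l * \<psi> l - f 0 * \<psi> 0)) {0..l}"
  proof (rule fundamental_theorem_of_calculus)
    fix x assume x: "x \<in> {0..l}"
    have "((\<lambda>x. f x * \<psi> x) has_real_derivative (g x * \<psi> x + \<psi>' x * f x)) (at x within {0..l})"
      by (rule DERIV_mult[OF weak_deriv_classical[OF fg l x] has_field_derivative_at_within[OF \<psi>(1)]])
    then show "((\<lambda>x. f x * \<psi> x) has_vector_derivative g x * \<psi> x + f x * \<psi>' x) (at x within {0..l})"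
      by (simp add: has_real_derivative_iff_has_vector_derivative mult.commute)
  qed (use l in simp)
  then have "integral {0..l} (\<lambda>x. g x * \<psi> x + f x * \<psi>' x) = f l * \<psi> l - f 0 * \<psi> 0"
    by (rule integral_unique)
  moreover have "integral {0..l} (\<lambda>x. g x * \<psi> x + f x * \<psi>' x) = L2_inner l g \<psi> + L2_inner l f \<psi>'"
    unfolding L2_inner_continuous[OF fg(3) \<psi>c] L2_inner_continuous[OF fg(2) \<psi>(2)]
    by (rule Henstock_Kurzweil_Integration.integral_add)
      (auto intro!: integrable_continuous_real continuous_intros fg \<psi>c \<psi>(2))
  ultimately show ?thesis by simp
qed

lemma L2_inner_scale_right: "L2_inner l f (\<lambda>x. k * g x) = k * L2_inner l f g"
proof -
  have "L2_inner l f (\<lambda>x. k * g x) = integral\<^sup>L (intv l) (\<lambda>x. k * (f x * g x))"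
    unfolding L2_inner_def by (simp add: mult_ac)
  then show ?thesis by (simp add: L2_inner_def)
qed

text \<open>Boundary terms vanish through \<open>f\<close>, so the frequency may be
  arbitrary.\<close>

lemma weak_deriv_cos_coeff:
  assumes fg: "has_weak_deriv l f g" "continuous_on {0..l} f" "continuous_on {0..l} g"
    and "f 0 = 0" "f l = 0"
  shows "L2_inner l g (\<lambda>x. k * cos (\<omega> * x)) = \<omega> * L2_inner l f (\<lambda>x. k * sin (\<omega> * x))"
proof -
  have "((\<lambda>x. k * cos (\<omega> * x)) has_real_derivative - \<omega> * (k * sin (\<omega> * x))) (at x)" for x
    by (auto intro!: derivative_eq_intros)
  from weak_deriv_parts[OF fg this] show ?thesis
    using assms(4,5) L2_inner_scale_right[of f "- \<omega>" "\<lambda>x. k * sin (\<omega> * x)"]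
    by (simp add: continuous_intros)
qed

text \<open>Boundary terms vanish through the sine, so \<open>f\<close> may have any end point
  values, but the frequency must be one of the \<open>\<nu> n\<close>.\<close>

lemma weak_deriv_sin_coeff:
  assumes fg: "has_weak_deriv l f g" "continuous_on {0..l} f" "continuous_on {0..l} g"
  shows "L2_inner l g (\<lambda>x. k * sin (\<nu> n * x)) = - \<nu> n * L2_inner l f (\<lambda>x. k * cos (\<nu> n * x))"
proof -
  have "((\<lambda>x. k * sin (\<nu> n * x)) has_real_derivative \<nu> n * (k * cos (\<nu> n * x))) (at x)" for x
    by (auto intro!: derivative_eq_intros)
  from weak_deriv_parts[OF fg this] show ?thesis
    using sin_freq L2_inner_scale_right[of f "\<nu> n" "\<lambda>x. k * cos (\<nu> n * x)"]
    by (simp add: continuous_intros)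
qed

abbreviation coeff3 where "coeff3 n V \<equiv> fourier_coeff l n V"

lemma coeff_nth:
  "coeff3 n V $ 1 = L2_inner l (comp 1 V) (\<lambda>x. \<kappa> n * sin (\<nu> n * x))"
  "coeff3 n V $ 2 = L2_inner l (comp 2 V) (\<lambda>x. \<kappa> n * cos (\<nu> n * x))"
  "coeff3 n V $ 3 = L2_inner l (comp 3 V) (\<lambda>x. \<kappa> n * cos (\<nu> n * x))"
  by (simp_all add: fourier_coeff_def Phi_nth)

lemma continuous_Phi_comp: "continuous_on S (\<lambda>x. \<kappa> n * sin (\<nu> n * x))" "continuous_on S (\<lambda>x. \<kappa> n * cos (\<nu> n * x))"
  by (intro continuous_intros)+

text \<open>Row by row this is \<open>matB\<close> acting on the coefficient vector. The second
  derivative in the third row is integrated by parts twice: once using that the first derivative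
  vanishes at the ends, once using that the sine does.\<close>

lemma coeff_B:
  assumes V: "smooth_vec V"
  shows "coeff3 n (B V) $ 1 = a * \<nu> n * coeff3 n V $ 2 - b * \<nu> n * coeff3 n V $ 3"
    and "coeff3 n (B V) $ 2 = - \<nu> n * coeff3 n V $ 1"
    and "coeff3 n (B V) $ 3 = d * \<nu> n * coeff3 n V $ 1 + c * (\<nu> n)\<^sup>2 * coeff3 n V $ 3"
proof -
  let ?D = "\<lambda>k. weak_deriv l (comp k V)"
  let ?D3 = "weak_deriv l (?D 3)"
  let ?s = "\<lambda>x. \<kappa> n * sin (\<nu> n * x)" and ?c = "\<lambda>x. \<kappa> n * cos (\<nu> n * x)"
  note W = smooth_vec_derivs[OF V] and C = smooth_vec_comp[OF V] and bc = smooth_vec_boundary[OF V]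
  have L: "?s \<in> L2 l" "?c \<in> L2 l" "?D k \<in> L2 l" "?D3 \<in> L2 l" for k
    by (intro continuous_imp_L2 continuous_Phi_comp W(1,2))+
  have Ls: "(\<lambda>x. m * ?D k x) \<in> L2 l" for m k
    by (intro continuous_imp_L2 continuous_intros W(1))
  have scale: "L2_inner l (\<lambda>x. k * f x) h = k * L2_inner l f h" for k f h
    using L2_inner_scale_right[of h k f] by (simp add: L2_inner_commute)
  have s: "L2_inner l (?D k) ?s = - \<nu> n * L2_inner l (comp k V) ?c" for k
    by (rule weak_deriv_sin_coeff[OF W(3) C W(1)])
  have c1: "L2_inner l (?D 1) ?c = \<nu> n * L2_inner l (comp 1 V) ?s"
    by (rule weak_deriv_cos_coeff[OF W(3) C W(1)]) (use bc in auto)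
  have c3: "L2_inner l ?D3 ?c = \<nu> n * L2_inner l (?D 3) ?s"
    by (rule weak_deriv_cos_coeff[OF W(4,1,2)]) (use bc in auto)
  have "L2_inner l (\<lambda>x. - a * ?D 2 x + b * ?D 3 x) ?s = - a * L2_inner l (?D 2) ?s + b * L2_inner l (?D 3) ?s"
    by (simp only: L2_inner_add[OF Ls L(3) L(1)] scale)
  then show "coeff3 n (B V) $ 1 = a * \<nu> n * coeff3 n V $ 2 - b * \<nu> n * coeff3 n V $ 3"
    by (simp add: coeff_nth opB_nth s)
  show "coeff3 n (B V) $ 2 = - \<nu> n * coeff3 n V $ 1"
    using scale[of "-1" "?D 1" ?c] by (simp add: coeff_nth opB_nth c1)
  have "L2_inner l (\<lambda>x. d * ?D 1 x + (- c) * ?D3 x) ?c = d * L2_inner l (?D 1) ?c + (- c) * L2_inner l ?D3 ?c"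
    by (simp only: L2_inner_add[OF Ls L(4) L(2)] scale)
  then show "coeff3 n (B V) $ 3 = d * \<nu> n * coeff3 n V $ 1 + c * (\<nu> n)\<^sup>2 * coeff3 n V $ 3"
    by (simp add: coeff_nth opB_nth s c1 c3 power2_eq_square)
qed

section \<open>Size and decay of the Fourier coefficients\<close>

lemma \<kappa>_bound: "(\<kappa> n)\<^sup>2 \<le> 2 / l"
  using l by (simp add: \<kappa>_def divide_right_mono)

lemma Phi_bound: "(Phi l n x $ k)\<^sup>2 \<le> 2 / l"
proof -
  have "(\<kappa> n * t)\<^sup>2 \<le> 2 / l" if "t\<^sup>2 \<le> 1" for t
    using mult_mono[OF \<kappa>_bound[of n] that] l by (simp add: power_mult_distrib)
  moreover have "(sin (\<nu> n * x))\<^sup>2 \<le> 1" "(cos (\<nu> n * x))\<^sup>2 \<le> 1"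
    by (simp_all add: abs_square_le_1)
  ultimately show ?thesis using exhaust_3[of k] by (auto simp: Phi_nth)
qed

lemma continuous_Phi: "continuous_on S (comp k (Phi l n))"
  using exhaust_3[of k] by (elim disjE; simp only: Phi_nth; intro continuous_intros)

text \<open>Cauchy-Schwarz with a crude bound 2 for the squared norm of a component of
  \<open>Phi\<close>; what matters is that the bound does not depend on \<open>n\<close>.\<close>

lemma coeff_bound:
  assumes "comp k V \<in> L2 l"
  shows "(coeff3 n V $ k)\<^sup>2 \<le> 2 * L2_inner l (comp k V) (comp k V)"
proof -
  let ?\<phi> = "comp k (Phi l n)"
  have "L2_inner l ?\<phi> ?\<phi> = integral {0..l} (\<lambda>x. ?\<phi> x * ?\<phi> x)"
    by (rule L2_inner_continuous) (rule continuous_Phi)+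
  also have "\<dots> \<le> integral {0..l} (\<lambda>x. 2 / l)"
    using Phi_bound
    by (intro integral_le) (auto intro!: integrable_continuous_real continuous_intros continuous_Phi simp: power2_eq_square)
  also have "\<dots> = 2" using l by simp
  finally have le: "L2_inner l (comp k V) (comp k V) * L2_inner l ?\<phi> ?\<phi> \<le> L2_inner l (comp k V) (comp k V) * 2"
    by (intro mult_left_mono L2_inner_self_nonneg)
  show ?thesis
    using order_trans[OF L2_Cauchy_Schwarz[OF assms continuous_imp_L2[OF continuous_Phi]] le]
    by (simp add: fourier_coeff_def mult.commute)
qed

lemma freq_pos: "n \<ge> 1 \<Longrightarrow> 0 < \<nu> n"
  using l by (simp add: freq_def)

lemma freq_ge: "n \<ge> 1 \<Longrightarrow> pi / l \<le> \<nu> n"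
  using l by (simp add: freq_def divide_right_mono)

text \<open>The relations between the coefficients of \<open>V\<close> and \<open>B V\<close> are solved for those of \<open>V\<close>, which gains
  one power of the frequency.\<close>

lemma coeff_decay_step:
  assumes V: "smooth_vec V"
    and K: "\<And>n k. n \<ge> 1 \<Longrightarrow> \<bar>coeff3 n (B V) $ k\<bar> \<le> K / \<nu> n ^ p"
  shows "\<exists>K'. \<forall>n\<ge>1. \<forall>k. \<bar>coeff3 n V $ k\<bar> \<le> K' / \<nu> n ^ Suc p"
proof -
  define \<delta> where "\<delta> = pi / l"
  have \<delta>: "\<delta> > 0" using l by (simp add: \<delta>_def)
  \<comment> \<open>\<open>\<delta>\<close> bounds all positive frequencies from below.
    \<open>K3\<close> and \<open>K2\<close> are the constants obtained by solving for the third and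
    then the second coefficient.\<close>
  define K3 where "K3 = (1 + \<bar>d\<bar>) * K / (c * \<delta>)"
  define K2 where "K2 = (K + \<bar>b\<bar> * K3) / a"
  have Kn: "K \<ge> 0"
    using K[of 1 1] freq_pos[of 1] abs_ge_zero order_trans
    by (metis (no_types, opaque_lifting) le_refl zero_le_divide_iff zero_less_power not_less order.strict_implies_order)
  have K3n: "K3 \<ge> 0" unfolding K3_def using Kn c \<delta> by simp
  have K2n: "K2 \<ge> 0" unfolding K2_def using Kn K3n a by simp
  have "\<bar>coeff3 n V $ k\<bar> \<le> (K + K2 + K3) / \<nu> n ^ Suc p" if n: "n \<ge> 1" for n k
  proof -
    define \<omega> where "\<omega> = \<nu> n"
    have \<omega>: "\<omega> > 0" "\<omega> \<ge> \<delta>" using freq_pos[OF n] freq_ge[OF n] by (auto simp: \<omega>_def \<delta>_def)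
    define v where "v k = coeff3 n V $ k" for k
    define w where "w k = coeff3 n (B V) $ k" for k
    define e where "e = 1 / \<omega> ^ p"
    have e: "e > 0" using \<omega> by (simp add: e_def)
    have w: "\<bar>w k\<bar> \<le> K * e" for k using K[OF n, of k] by (simp add: w_def e_def \<omega>_def)
    have r: "w 1 = a * \<omega> * v 2 - b * \<omega> * v 3" "w 2 = - \<omega> * v 1" "w 3 = d * \<omega> * v 1 + c * \<omega>\<^sup>2 * v 3"
      unfolding w_def v_def \<omega>_def by (rule coeff_B[OF V])+
    have v1: "\<omega> * \<bar>v 1\<bar> \<le> K * e"
      using w[of 2] \<omega>(1) by (simp add: r(2) abs_mult)
    \<comment> \<open>Adding d times the second relation to the third eliminates the first
      coefficient.\<close>
    have "c * \<omega> * (\<omega> * \<bar>v 3\<bar>) = \<bar>w 3 + d * w 2\<bar>"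
      using r c \<omega> by (simp add: abs_mult power2_eq_square)
    also have "\<dots> \<le> \<bar>w 3\<bar> + \<bar>d\<bar> * \<bar>w 2\<bar>" by (metis abs_mult abs_triangle_ineq)
    also have "\<dots> \<le> (1 + \<bar>d\<bar>) * (K * e)"
      using w[of 3] mult_left_mono[OF w[of 2], of "\<bar>d\<bar>"] by (simp add: algebra_simps)
    finally have "c * \<omega> * (\<omega> * \<bar>v 3\<bar>) \<le> (1 + \<bar>d\<bar>) * (K * e)" .
    \<comment> \<open>The third coefficient would gain two powers of the frequency; one is given up
      so that all three components have the same rate.\<close>
    moreover have "c * \<delta> * (\<omega> * \<bar>v 3\<bar>) \<le> c * \<omega> * (\<omega> * \<bar>v 3\<bar>)"
      using \<omega> c by (intro mult_right_mono) auto
    ultimately have v3: "\<omega> * \<bar>v 3\<bar> \<le> K3 * e"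
      using c \<delta> by (simp add: K3_def field_simps)
    have "a * (\<omega> * \<bar>v 2\<bar>) = \<bar>w 1 + b * (\<omega> * v 3)\<bar>"
      using r a \<omega> by (simp add: abs_mult)
    also have "\<dots> \<le> \<bar>w 1\<bar> + \<bar>b\<bar> * (\<omega> * \<bar>v 3\<bar>)"
      using abs_triangle_ineq[of "w 1" "b * (\<omega> * v 3)"] \<omega> by (simp add: abs_mult)
    also have "\<dots> \<le> K * e + \<bar>b\<bar> * (K3 * e)"
      using w[of 1] mult_left_mono[OF v3, of "\<bar>b\<bar>"] by simp
    finally have v2: "\<omega> * \<bar>v 2\<bar> \<le> K2 * e"
      using a by (simp add: K2_def field_simps)
    have "\<omega> * \<bar>v k\<bar> \<le> (K + K2 + K3) * e"
    proof -
      have "K * e \<ge> 0" "K2 * e \<ge> 0" "K3 * e \<ge> 0" using Kn K2n K3n e by auto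
      then show ?thesis using v1 v2 v3 exhaust_3[of k] unfolding distrib_right by auto
    qed
    then show ?thesis using \<omega> by (simp add: v_def e_def \<omega>_def field_simps)
  qed
  then show ?thesis by blast
qed

lemma coeff_decay:
  assumes V: "smooth_vec V"
  shows "\<exists>K. \<forall>n\<ge>1. \<forall>k. \<bar>coeff3 n V $ k\<bar> \<le> K / (\<nu> n)\<^sup>2"
proof -
  \<comment> \<open>Mere boundedness, for every smooth vector: it is used at \<open>B (B V)\<close>,
    after which one power is gained at \<open>B V\<close> and another at \<open>V\<close>.\<close>
  have 0: "\<exists>K. \<forall>n\<ge>1. \<forall>k. \<bar>coeff3 n U $ k\<bar> \<le> K / \<nu> n ^ 0" if U: "smooth_vec U" for U
  proof -
    define K where "K = sqrt (2 * (\<Sum>k\<in>UNIV. L2_inner l (comp k U) (comp k U)))"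
    have "\<bar>coeff3 n U $ k\<bar> \<le> K" for n k
    proof -
      have "(coeff3 n U $ k)\<^sup>2 \<le> 2 * L2_inner l (comp k U) (comp k U)"
        by (rule coeff_bound[OF continuous_imp_L2[OF smooth_vec_comp[OF U]]])
      also have "\<dots> \<le> 2 * (\<Sum>k\<in>UNIV. L2_inner l (comp k U) (comp k U))"
        using member_le_sum[of k UNIV "\<lambda>k. L2_inner l (comp k U) (comp k U)"] L2_inner_self_nonneg by auto
      finally show ?thesis unfolding K_def by (metis real_le_rsqrt power2_abs)
    qed
    then show ?thesis by auto
  qed
  have 1: "\<exists>K. \<forall>n\<ge>1. \<forall>k. \<bar>coeff3 n U $ k\<bar> \<le> K / \<nu> n ^ Suc 0" if U: "smooth_vec U" for U
    using 0[OF smooth_vec_B[OF U]] coeff_decay_step[OF U, of _ 0] by metis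
  show ?thesis
    using 1[OF smooth_vec_B[OF V]] coeff_decay_step[OF V, of _ "Suc 0"] by (metis numeral_2_eq_2)
qed

end

section \<open>Uniformly convergent Fourier expansions\<close>

lemma integral_cos_multiple:
  fixes k :: int
  assumes "0 < l"
  shows "integral {0..l} (\<lambda>x. cos (of_int k * (pi / l) * x)) = (if k = 0 then l else 0)"
proof (cases "k = 0")
  case False
  let ?\<omega> = "of_int k * (pi / l)"
  have "((\<lambda>x. cos (?\<omega> * x)) has_integral (sin (?\<omega> * l) / ?\<omega> - sin (?\<omega> * 0) / ?\<omega>)) {0..l}"
    by (rule fundamental_theorem_of_calculus)
      (use False assms in \<open>auto intro!: derivative_eq_intros
        simp: has_real_derivative_iff_has_vector_derivative[symmetric]\<close>)
  moreover have "sin (?\<omega> * l) = 0" using assms sin_npi_int[of k] by (simp add: mult.commute)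
  ultimately show ?thesis using False by (simp add: integral_unique)
qed (use assms in simp)

lemma cos_freq_diff: "cos (freq l n * x - freq l m * x) = cos (of_int (int n - int m) * (pi / l) * x)"
  and cos_freq_add: "cos (freq l n * x + freq l m * x) = cos (of_int (int n + int m) * (pi / l) * x)"
proof -
  have "freq l n * x - freq l m * x = of_int (int n - int m) * (pi / l) * x"
    "freq l n * x + freq l m * x = of_int (int n + int m) * (pi / l) * x"
    by (simp_all add: freq_def algebra_simps diff_divide_distrib add_divide_distrib)
  then show "cos (freq l n * x - freq l m * x) = cos (of_int (int n - int m) * (pi / l) * x)"
    "cos (freq l n * x + freq l m * x) = cos (of_int (int n + int m) * (pi / l) * x)" by presburger+
qed

lemma integral_cos_cos:
  assumes "0 < l"
  shows "integral {0..l} (\<lambda>x. cos (freq l n * x) * cos (freq l m * x))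
    = (if n = m then if n = 0 then l else l / 2 else 0)"
proof -
  let ?J = "\<lambda>k x. cos (of_int k * (pi / l) * x)"
  have "cos (freq l n * x) * cos (freq l m * x) = (1/2) * ?J (int n - int m) x + (1/2) * ?J (int n + int m) x" for x
    by (simp only: cos_times_cos cos_freq_diff cos_freq_add) simp
  then have "integral {0..l} (\<lambda>x. cos (freq l n * x) * cos (freq l m * x))
     = (1/2) * integral {0..l} (?J (int n - int m)) + (1/2) * integral {0..l} (?J (int n + int m))"
    by (simp only:, subst Henstock_Kurzweil_Integration.integral_add)
      (use assms in \<open>auto intro!: integrable_continuous_real continuous_intros\<close>)
  then show ?thesis unfolding integral_cos_multiple[OF assms] by auto
qed

lemma integral_sin_sin:
  assumes "0 < l"
  shows "integral {0..l} (\<lambda>x. sin (freq l n * x) * sin (freq l m * x))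
    = (if n = m \<and> n \<noteq> 0 then l / 2 else 0)"
proof -
  let ?J = "\<lambda>k x. cos (of_int k * (pi / l) * x)"
  have "sin (freq l n * x) * sin (freq l m * x) = (1/2) * ?J (int n - int m) x + (-1/2) * ?J (int n + int m) x" for x
    by (simp only: sin_times_sin cos_freq_diff cos_freq_add) simp
  then have "integral {0..l} (\<lambda>x. sin (freq l n * x) * sin (freq l m * x))
     = (1/2) * integral {0..l} (?J (int n - int m)) + (-1/2) * integral {0..l} (?J (int n + int m))"
    by (simp only:, subst Henstock_Kurzweil_Integration.integral_add)
      (use assms in \<open>auto intro!: integrable_continuous_real continuous_intros\<close>)
  then show ?thesis unfolding integral_cos_multiple[OF assms] by auto
qed

section \<open>Completeness of the cosine and sine systems\<close>

lemma freq_shift: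
  "freq l (n + 1) * x = pi / l * x + freq l n * x"
  "n \<noteq> 0 \<Longrightarrow> freq l (n - 1) * x = freq l n * x - pi / l * x"
  by (cases n; simp add: freq_def algebra_simps add_divide_distrib)+

text \<open>Multiplying by the first cosine moves to the neighbouring frequencies. At n = 0 the
  lower neighbour would be -1, which evenness of the cosine reflects to 1.\<close>

lemma cos_cos_pi_freq:
  "cos (pi / l * x) * cos (freq l n * x) =
    (1/2) * cos (freq l (n + 1) * x) + (1/2) * cos (freq l (if n = 0 then 1 else n - 1) * x)"
proof (cases "n = 0")
  case False
  have "cos (pi / l * x - freq l n * x) = cos (freq l n * x - pi / l * x)"
    using cos_minus[of "freq l n * x - pi / l * x"] by simp
  then show ?thesis using False by (simp add: cos_times_cos freq_shift[simplified])
qed (simp add: freq_def)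

text \<open>Here reflecting the frequency -1 to 1 changes the sign, as the sine is odd; hence the
  case distinction in the coefficient.\<close>

lemma sin_cos_pi_freq:
  "sin (pi / l * x) * cos (freq l n * x) =
    (1/2) * sin (freq l (n + 1) * x) + (if n = 0 then 1/2 else -1/2) * sin (freq l (if n = 0 then 1 else n - 1) * x)"
proof (cases "n = 0")
  case False
  have "sin (pi / l * x - freq l n * x) = - sin (freq l n * x - pi / l * x)"
    using sin_minus[of "freq l n * x - pi / l * x"] by simp
  then show ?thesis using False by (simp add: sin_times_cos freq_shift[simplified])
qed (simp add: freq_def)

text \<open>The product formula turns orthogonality to all cosines into orthogonality to all
  polynomials in cos(pi x / l). This function is injective on [0, l], so by Stone-Weierstrass these
  polynomials are uniformly dense, and \<open>f\<close> is orthogonal to itself.\<close>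

lemma cosine_complete:
  assumes l: "0 < l" and f: "continuous_on {0..l} f"
    and orth: "\<And>n. integral {0..l} (\<lambda>x. f x * cos (freq l n * x)) = 0"
    and x: "x \<in> {0..l}"
  shows "f x = 0"
proof -
  let ?C = "\<lambda>x. cos (pi / l * x)"
  have pow: "integral {0..l} (\<lambda>x. f x * (?C x ^ k * cos (freq l n * x))) = 0" for k n
  proof (induction k arbitrary: n)
    case 0
    then show ?case using orth by simp
  next
    case (Suc k)
    let ?g = "\<lambda>n x. f x * (?C x ^ k * cos (freq l n * x))"
    let ?m = "if n = 0 then 1 else n - 1"
    have alg: "u * (p * ((1/2) * v + (1/2) * w)) = (1/2) * (u * (p * v)) + (1/2) * (u * (p * w))"
      for u p v w :: real by (simp add: algebra_simps)
    have "f x * (?C x ^ Suc k * cos (freq l n * x)) = f x * (?C x ^ k * (?C x * cos (freq l n * x)))" for x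
      by simp
    then have "f x * (?C x ^ Suc k * cos (freq l n * x)) = (1/2) * ?g (n + 1) x + (1/2) * ?g ?m x" for x
      by (simp only: cos_cos_pi_freq alg)
    then have "integral {0..l} (\<lambda>x. f x * (?C x ^ Suc k * cos (freq l n * x)))
      = (1/2) * integral {0..l} (?g (n + 1)) + (1/2) * integral {0..l} (?g ?m)"
      by (simp only:, subst Henstock_Kurzweil_Integration.integral_add)
        (use l in \<open>auto intro!: integrable_continuous_real continuous_intros f\<close>)
    then show ?case by (simp only: Suc)
  qed
  have poly: "integral {0..l} (\<lambda>x. f x * poly p (?C x)) = 0" for p
  proof -
    have "f x * poly p (?C x) = (\<Sum>i\<le>degree p. coeff p i * (f x * (?C x ^ i * cos (freq l 0 * x))))" for x
      by (simp add: poly_altdef sum_distrib_left freq_def mult_ac)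
    then have "integral {0..l} (\<lambda>x. f x * poly p (?C x))
       = (\<Sum>i\<le>degree p. integral {0..l} (\<lambda>x. coeff p i * (f x * (?C x ^ i * cos (freq l 0 * x)))))"
      by (simp only:, subst Henstock_Kurzweil_Integration.integral_sum)
        (use l in \<open>auto intro!: integrable_continuous_real continuous_intros f\<close>)
    then show ?thesis by (simp only: Henstock_Kurzweil_Integration.integral_mult_right pow) simp
  qed
  interpret function_ring_on "range (\<lambda>p x. poly p (?C x))" "{0..l}"
  proof
    fix g h assume "g \<in> range (\<lambda>p x. poly p (?C x))" "h \<in> range (\<lambda>p x. poly p (?C x))"
    then obtain p q where pq: "g = (\<lambda>x. poly p (?C x))" "h = (\<lambda>x. poly q (?C x))" by blast
    show "(\<lambda>x. g x + h x) \<in> range (\<lambda>p x. poly p (?C x))"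
      by (rule range_eqI[of _ _ "p + q"]) (simp add: pq)
    show "(\<lambda>x. g x * h x) \<in> range (\<lambda>p x. poly p (?C x))"
      by (rule range_eqI[of _ _ "p * q"]) (simp add: pq)
  next
    show "(\<lambda>_. k) \<in> range (\<lambda>p x. poly p (?C x))" for k
      by (rule range_eqI[of _ _ "[:k:]"]) simp
  next
    fix x y assume xy: "x \<in> {0..l}" "y \<in> {0..l}" "x \<noteq> y"
    have "?C x \<noteq> ?C y"
    proof
      assume "?C x = ?C y"
      moreover have "0 \<le> pi / l * u \<and> pi / l * u \<le> pi" if "u \<in> {0..l}" for u
        using that l mult_left_mono[of u l "pi / l"] by simp
      ultimately have "pi / l * x = pi / l * y"
        using cos_inj_pi[of "pi / l * x" "pi / l * y"] xy by blast
      then show False using xy l by simp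
    qed
    then show "\<exists>f\<in>range (\<lambda>p x. poly p (?C x)). f x \<noteq> f y"
      by (intro bexI[of _ "\<lambda>x. poly [:0, 1:] (?C x)"] range_eqI[of _ _ "[:0, 1:]"]) auto
  qed (use l in \<open>auto intro!: continuous_intros\<close>)
  define I where "I = integral {0..l} (\<lambda>x. f x * f x)"
  define A where "A = integral {0..l} (\<lambda>x. \<bar>f x\<bar>)"
  have A: "A \<ge> 0" unfolding A_def
    by (rule Henstock_Kurzweil_Integration.integral_nonneg)
      (auto intro!: integrable_continuous_real continuous_intros f)
  have "I \<le> 0"
  proof (rule ccontr)
    assume I: "\<not> I \<le> 0"
    \<comment> \<open>An approximation error \<open>e\<close> gives I \<le> A * e, which is at most
      I / 2; the summand 1 avoids division by zero when A = 0.\<close>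
    define e where "e = I / (2 * (A + 1))"
    have e: "e > 0" using I A by (simp add: e_def)
    obtain p where p: "\<And>x. x \<in> {0..l} \<Longrightarrow> \<bar>f x - poly p (?C x)\<bar> < e"
      using Stone_Weierstrass_basic[OF f e] by blast
    have "I = integral {0..l} (\<lambda>x. f x * f x) - integral {0..l} (\<lambda>x. f x * poly p (?C x))"
      unfolding I_def poly by simp
    also have "\<dots> = integral {0..l} (\<lambda>x. f x * f x - f x * poly p (?C x))"
      by (rule Henstock_Kurzweil_Integration.integral_diff[symmetric])
        (use l in \<open>auto intro!: integrable_continuous_real continuous_intros f\<close>)
    also have "\<dots> \<le> integral {0..l} (\<lambda>x. \<bar>f x\<bar> * e)"
    proof (rule integral_le)
      fix x assume x: "x \<in> {0..l}"
      have "f x * f x - f x * poly p (?C x) = f x * (f x - poly p (?C x))" by (simp add: algebra_simps)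
      also have "\<dots> \<le> \<bar>f x\<bar> * \<bar>f x - poly p (?C x)\<bar>" by (metis abs_ge_self abs_mult)
      also have "\<dots> \<le> \<bar>f x\<bar> * e" using p[OF x] by (intro mult_left_mono) auto
      finally show "f x * f x - f x * poly p (?C x) \<le> \<bar>f x\<bar> * e" .
    qed (use l in \<open>auto intro!: integrable_continuous_real continuous_intros f\<close>)
    also have "\<dots> = A * e" by (simp add: A_def)
    finally have "I \<le> A * e" .
    have "A * e \<le> (A + 1) * e" using e by simp
    have "(2 * (A + 1)) * (I / (2 * (A + 1))) = I" using A
      by (metis add_nonneg_pos linorder_not_less mult_pos_pos nonzero_mult_div_cancel_left order_refl
          times_divide_eq_right zero_less_numeral zero_less_one)
    then have "2 * ((A + 1) * e) = I" by (simp only: e_def mult.assoc)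
    with \<open>I \<le> A * e\<close> \<open>A * e \<le> (A + 1) * e\<close> have "2 * I \<le> I" by linarith
    then show False using I by simp
  qed
  moreover have "I \<ge> 0" unfolding I_def
    by (rule Henstock_Kurzweil_Integration.integral_nonneg)
      (auto intro!: integrable_continuous_real continuous_intros f)
  ultimately have "integral {0..l} (\<lambda>x. f x * f x) = 0" by (simp add: I_def)
  moreover have "continuous_on {0..l} (\<lambda>x. f x * f x)" by (intro continuous_intros f)
  ultimately have "f x * f x = 0" using integral_eq_0_iff[of 0 l "\<lambda>x. f x * f x"] l x by simp
  then show ?thesis by simp
qed

text \<open>Reduced to the cosines: \<open>f\<close> times sin(pi x / l) is orthogonal to all of
  them, hence zero. The factor is positive inside the interval, and continuity of \<open>f\<close>
  settles the end points.\<close>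

lemma sine_complete:
  assumes l: "0 < l" and f: "continuous_on {0..l} f"
    and orth: "\<And>n. integral {0..l} (\<lambda>x. f x * sin (freq l n * x)) = 0"
    and x: "x \<in> {0..l}"
  shows "f x = 0"
proof -
  have "integral {0..l} (\<lambda>x. (f x * sin (pi / l * x)) * cos (freq l n * x)) = 0" for n
  proof -
    let ?m = "if n = 0 then 1 else n - 1" and ?s = "if n = 0 then 1/2 else -1/2 :: real"
    have alg: "u * ((1/2) * v + p * w) = (1/2) * (u * v) + p * (u * w)"
      for u p v w :: real by (simp add: algebra_simps)
    have "(f x * sin (pi / l * x)) * cos (freq l n * x) = f x * (sin (pi / l * x) * cos (freq l n * x))" for x
      by simp
    then have "(f x * sin (pi / l * x)) * cos (freq l n * x)
        = (1/2) * (f x * sin (freq l (n + 1) * x)) + ?s * (f x * sin (freq l ?m * x))" for x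
      by (simp only: sin_cos_pi_freq alg)
    then have "integral {0..l} (\<lambda>x. (f x * sin (pi / l * x)) * cos (freq l n * x))
      = (1/2) * integral {0..l} (\<lambda>x. f x * sin (freq l (n + 1) * x))
        + ?s * integral {0..l} (\<lambda>x. f x * sin (freq l ?m * x))"
      by (simp only:, subst Henstock_Kurzweil_Integration.integral_add)
        (use l in \<open>auto intro!: integrable_continuous_real continuous_intros f\<close>)
    then show ?thesis by (simp only: orth)
  qed
  moreover have "continuous_on {0..l} (\<lambda>x. f x * sin (pi / l * x))"
    by (intro continuous_intros f) (use l in auto)
  ultimately have z: "f x * sin (pi / l * x) = 0" if "x \<in> {0..l}" for x
    using cosine_complete[OF l _ _ that] by blast
  have "f x = 0" if "x \<in> {0<..<l}" for x
  proof -
    have "pi / l * x < pi / l * l" using that l by (intro mult_strict_left_mono) auto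
    then have "sin (pi / l * x) > 0" using that l by (intro sin_gt_zero) simp_all
    then show ?thesis using z[of x] that by simp
  qed
  then show ?thesis
    using continuous_constant_on_closure[of "{0<..<l}" f 0 x] f x l by (simp add: closure_greaterThanLessThan)
qed

text \<open>The series converges uniformly to a continuous sum, which has the same coefficients as
  \<open>f\<close> by termwise integration and so equals \<open>f\<close> by completeness. The
  normalisation is multiplied by \<open>r n\<close> because the sine system contains the zero
  function at n = 0, where the coefficient is 0.\<close>

lemma orthogonal_expansion:
  fixes f :: "real \<Rightarrow> real"
  assumes f: "continuous_on {0..l} f" and \<phi>: "\<And>n. continuous_on {0..l} (\<phi> n)"
    and M: "\<And>n x. x \<in> {0..l} \<Longrightarrow> \<bar>\<phi> n x\<bar> \<le> M"
    and s: "summable (\<lambda>n. \<bar>r n\<bar>)"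
    and r: "\<And>n. integral {0..l} (\<lambda>x. f x * \<phi> n x) = r n"
    and orth: "\<And>n m. n \<noteq> m \<Longrightarrow> integral {0..l} (\<lambda>x. \<phi> n x * \<phi> m x) = 0"
    and norm: "\<And>n. r n * integral {0..l} (\<lambda>x. \<phi> n x * \<phi> n x) = r n"
    and complete: "\<And>h x. continuous_on {0..l} h \<Longrightarrow> (\<And>n. integral {0..l} (\<lambda>x. h x * \<phi> n x) = 0) \<Longrightarrow>
      x \<in> {0..l} \<Longrightarrow> h x = 0"
  shows "uniform_limit {0..l} (\<lambda>N x. \<Sum>n<N. r n * \<phi> n x) f sequentially"
proof -
  define S where "S x = (\<Sum>n. r n * \<phi> n x)" for x
  have S: "uniform_limit {0..l} (\<lambda>N x. \<Sum>n<N. r n * \<phi> n x) S sequentially"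
    unfolding S_def
  proof (rule Weierstrass_m_test)
    show "norm (r n * \<phi> n x) \<le> \<bar>r n\<bar> * M" if "x \<in> {0..l}" for n x
      using mult_left_mono[OF M[OF that, of n], of "\<bar>r n\<bar>"] by (simp add: abs_mult)
    show "summable (\<lambda>n. \<bar>r n\<bar> * M)" using s by (rule summable_mult2)
  qed
  have Sc: "continuous_on {0..l} S"
    by (rule uniform_limit_theorem[OF _ S]) (auto intro!: always_eventually continuous_intros \<phi>)
  have Sm: "integral {0..l} (\<lambda>x. S x * \<phi> m x) = r m" for m
  proof -
    have "bounded (\<phi> m ` {0..l})" unfolding bounded_iff using M by (intro exI[of _ M]) auto
    moreover have "bounded (S ` {0..l})" using Sc compact_Icc compact_continuous_image compact_imp_bounded by blast
    ultimately have u: "uniform_limit {0..l} (\<lambda>N x. (\<Sum>n<N. r n * \<phi> n x) * \<phi> m x) (\<lambda>x. S x * \<phi> m x) sequentially"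
      by (intro uniform_lim_mult S uniform_limit_const)
    have int: "integral {0..l} (\<lambda>x. (\<Sum>n<N. r n * \<phi> n x) * \<phi> m x) = (if m < N then r m else 0)" for N
    proof -
      have "integral {0..l} (\<lambda>x. (\<Sum>n<N. r n * \<phi> n x) * \<phi> m x)
          = integral {0..l} (\<lambda>x. \<Sum>n<N. r n * (\<phi> n x * \<phi> m x))"
        by (simp add: sum_distrib_right mult.assoc)
      also have "\<dots> = (\<Sum>n<N. r n * integral {0..l} (\<lambda>x. \<phi> n x * \<phi> m x))"
        by (subst Henstock_Kurzweil_Integration.integral_sum)
          (auto intro!: integrable_continuous_real continuous_intros \<phi>)
      also have "\<dots> = (\<Sum>n<N. if n = m then r m else 0)"
        by (rule sum.cong) (use orth norm in auto)
      finally show ?thesis by simp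
    qed
    obtain I J where IJ: "\<And>N. ((\<lambda>x. (\<Sum>n<N. r n * \<phi> n x) * \<phi> m x) has_integral I N) {0..l}"
      "((\<lambda>x. S x * \<phi> m x) has_integral J) {0..l}" "I \<longlonglongrightarrow> J"
      by (rule uniform_limit_integral[OF u]) (auto intro!: continuous_intros \<phi>)
    have I: "I N = (if m < N then r m else 0)" for N using int IJ(1) integral_unique by metis
    have "\<forall>\<^sub>F N in sequentially. I N = r m"
      using eventually_gt_at_top[of m] by eventually_elim (simp add: I)
    then have "I \<longlonglongrightarrow> r m" by (rule tendsto_eventually)
    then have "J = r m" using IJ(3) LIMSEQ_unique by blast
    then show ?thesis using IJ(2) integral_unique by blast
  qed
  have "f x + (-1) * S x = 0" if x: "x \<in> {0..l}" for x
  proof (rule complete[OF _ _ x])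
    show "continuous_on {0..l} (\<lambda>x. f x + (-1) * S x)" by (intro continuous_intros f Sc)
    fix n
    have "integral {0..l} (\<lambda>x. (f x + (-1) * S x) * \<phi> n x)
        = integral {0..l} (\<lambda>x. f x * \<phi> n x - S x * \<phi> n x)" by (simp add: algebra_simps)
    also have "\<dots> = r n - r n"
      unfolding r[symmetric] by (subst Henstock_Kurzweil_Integration.integral_diff)
        (auto intro!: integrable_continuous_real continuous_intros f Sc \<phi> simp: Sm r)
    finally show "integral {0..l} (\<lambda>x. (f x + (-1) * S x) * \<phi> n x) = 0" by simp
  qed
  then show ?thesis using S by (subst uniform_limit_cong'[where g = "\<lambda>N x. \<Sum>n<N. r n * \<phi> n x" and i = S]) auto
qed

lemma uniform_limit_components:
  fixes f :: "'i \<Rightarrow> 'a \<Rightarrow> real^'n"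
  assumes "\<And>k. uniform_limit X (\<lambda>i x. f i x $ k) (\<lambda>x. g x $ k) F"
  shows "uniform_limit X f g F"
proof (rule uniform_limitI)
  fix e :: real assume e: "e > 0"
  \<comment> \<open>The componentwise errors add up to e / 2; the factor 2 keeps the final
    inequality strict.\<close>
  define e' where "e' = e / (2 * CARD('n))"
  have e': "e' > 0" using e by (simp add: e'_def)
  have "\<forall>\<^sub>F i in F. \<forall>k. \<forall>x\<in>X. dist (f i x $ k) (g x $ k) < e'"
    using uniform_limitD[OF assms e'] by (simp add: eventually_all_finite)
  then show "\<forall>\<^sub>F i in F. \<forall>x\<in>X. dist (f i x) (g x) < e"
  proof eventually_elim
    case (elim i)
    show ?case
    proof
      fix x assume x: "x \<in> X"
      have "dist (f i x) (g x) \<le> (\<Sum>k\<in>UNIV. \<bar>(f i x - g x) $ k\<bar>)"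
        unfolding dist_norm by (rule norm_le_l1_cart)
      also have "\<dots> \<le> (\<Sum>k\<in>(UNIV::'n set). e')"
        using elim x by (intro sum_mono) (auto simp: dist_norm less_imp_le)
      also have "\<dots> < e" using e by (simp add: e'_def)
      finally show "dist (f i x) (g x) < e" .
    qed
  qed
qed

context wave_heat_system begin

lemma summable_coeff:
  assumes V: "smooth_vec V"
  shows "summable (\<lambda>n. \<bar>coeff3 n V $ k\<bar>)"
proof -
  obtain K where K: "\<And>n. n \<ge> 1 \<Longrightarrow> \<bar>coeff3 n V $ k\<bar> \<le> K / (\<nu> n)\<^sup>2"
    using coeff_decay[OF V] by blast
  have "summable (\<lambda>n. K * (l / pi)\<^sup>2 * (1 / real n ^ 2))"
    using inverse_power_summable[of 2] by (intro summable_mult) (simp add: divide_inverse)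
  moreover have "\<bar>coeff3 n V $ k\<bar> \<le> K * (l / pi)\<^sup>2 * (1 / real n ^ 2)" if "n \<ge> 1" for n
    using K[OF that] l by (simp add: freq_def field_simps)
  ultimately show ?thesis
    using summable_comparison_test'[of "\<lambda>n. K * (l / pi)\<^sup>2 * (1 / real n ^ 2)" 1 "\<lambda>n. \<bar>coeff3 n V $ k\<bar>"]
    by (simp only: real_norm_def abs_abs)
qed

theorem smooth_vec_expansion:
  assumes V: "smooth_vec V"
  shows "unif_fourier_expansion l (\<lambda>n. coeff3 n V) V"
  unfolding unif_fourier_expansion_def
proof (rule uniform_limit_components)
  fix k :: 3
  let ?\<phi> = "\<lambda>n. comp k (Phi l n)"
  have \<kappa>: "\<kappa> n \<noteq> 0" "\<kappa> n * \<kappa> n = (if n = 0 then 1 / l else 2 / l)" for n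
    using l by (auto simp: \<kappa>_def)
  have orthk: "integral {0..l} (\<lambda>x. ?\<phi> n x * ?\<phi> m x) =
     (if n = m then if n = 0 \<and> k = 1 then 0 else 1 else 0)" for n m
  proof -
    have s: "integral {0..l} (\<lambda>x. \<kappa> n * g (\<nu> n * x) * (\<kappa> m * g (\<nu> m * x)))
        = \<kappa> n * \<kappa> m * integral {0..l} (\<lambda>x. g (\<nu> n * x) * g (\<nu> m * x))" for g :: "real \<Rightarrow> real"
    proof -
      have "\<kappa> n * g (\<nu> n * x) * (\<kappa> m * g (\<nu> m * x)) = (\<kappa> n * \<kappa> m) * (g (\<nu> n * x) * g (\<nu> m * x))" for x
        by simp
      then show ?thesis by (simp only: Henstock_Kurzweil_Integration.integral_mult_right)
    qed
    show ?thesis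
      using exhaust_3[of k] l
      by (elim disjE) (simp_all only: Phi_nth s integral_cos_cos[OF l] integral_sin_sin[OF l], auto simp: \<kappa>)
  qed
  have "uniform_limit {0..l} (\<lambda>N x. \<Sum>n<N. coeff3 n V $ k * ?\<phi> n x) (comp k V) sequentially"
  proof (rule orthogonal_expansion)
    show "continuous_on {0..l} (comp k V)" by (rule smooth_vec_comp[OF V])
    show "continuous_on {0..l} (?\<phi> n)" for n by (rule continuous_Phi)
    show "\<bar>?\<phi> n x\<bar> \<le> sqrt (2 / l)" for n x using Phi_bound[of n x k] real_le_rsqrt[of "\<bar>?\<phi> n x\<bar>"] by simp
    show "summable (\<lambda>n. \<bar>coeff3 n V $ k\<bar>)" by (rule summable_coeff[OF V])
    show r: "integral {0..l} (\<lambda>x. V x $ k * ?\<phi> n x) = coeff3 n V $ k" for n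
      using L2_inner_continuous[OF smooth_vec_comp[OF V] continuous_Phi[where k = k and n = n]] by (simp add: fourier_coeff_def)
    show "integral {0..l} (\<lambda>x. ?\<phi> n x * ?\<phi> m x) = 0" if "n \<noteq> m" for n m using orthk that by simp
    \<comment> \<open>The only index at which the basis function has norm 0 instead of 1.\<close>
    have "coeff3 0 V $ 1 = 0" by (simp add: coeff_nth freq_def L2_inner_def)
    then show "coeff3 n V $ k * integral {0..l} (\<lambda>x. ?\<phi> n x * ?\<phi> n x) = coeff3 n V $ k" for n
      unfolding orthk by auto
    fix h x assume h: "continuous_on {0..l} h" "\<And>n. integral {0..l} (\<lambda>x. h x * ?\<phi> n x) = 0" "x \<in> {0..l}"
    have s: "integral {0..l} (\<lambda>x. h x * (\<kappa> n * g x)) = \<kappa> n * integral {0..l} (\<lambda>x. h x * g x)" for n g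
    proof -
      have "h x * (\<kappa> n * g x) = \<kappa> n * (h x * g x)" for x by simp
      then show ?thesis by (simp only: Henstock_Kurzweil_Integration.integral_mult_right)
    qed
    consider "k = 1" | "k = 2 \<or> k = 3" using exhaust_3[of k] by blast
    then show "h x = 0"
    proof cases
      case 1
      have "integral {0..l} (\<lambda>x. h x * sin (\<nu> n * x)) = 0" for n
        using h(2)[of n] \<kappa>(1)[of n] unfolding 1 Phi_nth s by simp
      then show ?thesis using sine_complete[OF l h(1) _ h(3)] by blast
    next
      case 2
      have "integral {0..l} (\<lambda>x. h x * cos (\<nu> n * x)) = 0" for n
        using h(2)[of n] \<kappa>(1)[of n] 2 by (elim disjE) (simp_all only: Phi_nth s, simp_all)
      then show ?thesis using cosine_complete[OF l h(1) _ h(3)] by blast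
    qed
  qed
  then show "uniform_limit {0..l} (\<lambda>N x. (\<Sum>n<N. \<chi> k. coeff3 n V $ k * Phi l n x $ k) $ k) (\<lambda>x. V x $ k) sequentially"
    by (simp add: sum_component)
qed

end

section \<open>Convergence in the norm of smooth vectors\<close>

context wave_heat_system begin

text \<open>The space of smooth vectors is not visibly closed under linear combinations, since its
  membership involves the choice of representatives made by \<open>weak_deriv\<close>. The following conditions
  are, and they suffice to compare the norms.\<close>

definition regular :: "(real \<Rightarrow> real^3) \<Rightarrow> bool" where
  "regular V \<longleftrightarrow> (\<forall>k. continuous_on {0..l} (comp k V) \<and>
      has_weak_deriv l (comp k V) (weak_deriv l (comp k V)) \<and> continuous_on {0..l} (weak_deriv l (comp k V))) \<and>
    has_weak_deriv l (weak_deriv l (comp 3 V)) (weak_deriv l (weak_deriv l (comp 3 V))) \<and>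
    continuous_on {0..l} (weak_deriv l (weak_deriv l (comp 3 V)))"

lemma smooth_vec_regular: "smooth_vec V \<Longrightarrow> regular V"
  unfolding regular_def using smooth_vec_comp smooth_vec_derivs by blast

text \<open>Continuous candidates \<open>g\<close>, \<open>h\<close> for the derivatives determine
  the chosen ones on the closed interval, so regularity can be checked without knowing what
  \<open>weak_deriv\<close> picks.\<close>

lemma regularI:
  assumes "\<And>k. continuous_on {0..l} (comp k V)"
    "\<And>k. has_weak_deriv l (comp k V) (g k)" "\<And>k. continuous_on {0..l} (g k)"
    "has_weak_deriv l (g 3) h" "continuous_on {0..l} h"
  shows "regular V"
    and "x \<in> {0..l} \<Longrightarrow> weak_deriv l (comp k V) x = g k x"
    and "x \<in> {0..l} \<Longrightarrow> weak_deriv l (weak_deriv l (comp 3 V)) x = h x"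
proof -
  have eq: "weak_deriv l (comp k V) x = g k x" if "x \<in> {0..l}" for k x
    by (rule weak_deriv_eq[OF assms(2,3) l that])
  \<comment> \<open>The two functions may differ off the interval, but a weak derivative depends
    only on values inside.\<close>
  have same: "has_weak_deriv l (weak_deriv l (comp 3 V)) = has_weak_deriv l (g 3)"
    by (rule ext, rule has_weak_deriv_cong) (simp add: eq)
  then have h: "has_weak_deriv l (weak_deriv l (comp 3 V)) h" using assms(4) by simp
  note W = weak_deriv_correct[OF h]
  show "regular V"
    unfolding regular_def
    using assms(1) weak_deriv_correct[OF assms(2)] assms(3) W assms(5) by blast
  show "x \<in> {0..l} \<Longrightarrow> weak_deriv l (comp k V) x = g k x" by (rule eq)
  show "x \<in> {0..l} \<Longrightarrow> weak_deriv l (weak_deriv l (comp 3 V)) x = h x"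
    by (rule weak_deriv_eq[OF h assms(5) l])
qed

lemma continuous_on_lincomb:
  fixes f g :: "real \<Rightarrow> real"
  shows "continuous_on S f \<Longrightarrow> continuous_on S g \<Longrightarrow> continuous_on S (\<lambda>x. f x + r * g x)"
  by (intro continuous_intros)

text \<open>The choice in \<open>weak_deriv\<close> need not be linear. For continuous derivatives
  it is forced on [0, l], and there \<open>B\<close> acts linearly.\<close>

lemma regular_lincomb:
  assumes V: "regular V" and W: "regular W"
  shows "regular (\<lambda>x. V x + r *\<^sub>R W x)"
    and "x \<in> {0..l} \<Longrightarrow> B (\<lambda>x. V x + r *\<^sub>R W x) x = B V x + r *\<^sub>R B W x"
proof -
  let ?U = "\<lambda>x. V x + r *\<^sub>R W x"
  let ?g = "\<lambda>k x. weak_deriv l (comp k V) x + r * weak_deriv l (comp k W) x"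
  let ?h = "\<lambda>x. weak_deriv l (weak_deriv l (comp 3 V)) x + r * weak_deriv l (weak_deriv l (comp 3 W)) x"
  have 1: "continuous_on {0..l} (comp k ?U)" for k
    using V W continuous_on_lincomb[of "{0..l}" "comp k V" "comp k W" r] by (simp add: regular_def)
  have 2: "has_weak_deriv l (comp k ?U) (?g k)" for k
    using has_weak_deriv_lincomb[of l "comp k V" _ "comp k W" _ r] V W by (simp add: regular_def)
  have 3: "continuous_on {0..l} (?g k)" for k
    using V W by (intro continuous_on_lincomb) (auto simp: regular_def)
  have 4: "has_weak_deriv l (?g 3) ?h"
    using V W by (intro has_weak_deriv_lincomb) (auto simp: regular_def)
  have 5: "continuous_on {0..l} ?h"
    using V W by (intro continuous_on_lincomb) (auto simp: regular_def)
  note R = regularI[of ?U ?g ?h, OF 1 2 3 4 5]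
  show "regular ?U" by (rule R(1))
  show "B ?U x = B V x + r *\<^sub>R B W x" if x: "x \<in> {0..l}"
    unfolding vec_eq_iff forall_3
    by (simp only: opB_nth R(2,3)[OF x])
      (simp only: vector_add_component vector_scaleR_component opB_nth, simp add: algebra_simps)
qed

lemma regular_cong:
  assumes "\<And>x. x \<in> {0..l} \<Longrightarrow> V x = W x"
  shows "regular V \<longleftrightarrow> regular W" and "B V = B W"
proof -
  have w: "weak_deriv l (comp k V) = weak_deriv l (comp k W)" for k
    by (rule weak_deriv_cong) (use assms in auto)
  have h: "has_weak_deriv l (comp k V) g = has_weak_deriv l (comp k W) g" for k g
    by (rule has_weak_deriv_cong) (use assms in auto)
  have c: "continuous_on {0..l} (comp k V) = continuous_on {0..l} (comp k W)" for k
    by (rule continuous_on_cong) (use assms in auto)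
  show "regular V \<longleftrightarrow> regular W" unfolding regular_def w h c ..
  show "B V = B W" unfolding opB_def w ..
qed

section \<open>Vectors of finite norm and their linear combinations\<close>

definition finite_norm :: "(real \<Rightarrow> real^3) \<Rightarrow> bool" where
  "finite_norm V \<longleftrightarrow> (\<forall>k. regular ((B ^^ k) V)) \<and>
    summable (\<lambda>k. X_inner l a b d ((B ^^ k) V) ((B ^^ k) V) / fact k)"

lemma Xinf_finite_norm:
  assumes "V \<in> Xinf l a b c d"
  shows "finite_norm V"
  using assms smooth_vec_regular[OF smooth_vec_B_power[OF Xinf_imp_smooth_vec[OF assms]]]
  unfolding finite_norm_def Xinf_def by auto

lemma regular_L2: "regular V \<Longrightarrow> comp k V \<in> L2 l"
  unfolding regular_def by (blast intro: continuous_imp_L2)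

lemma X_inner_nonneg: "0 \<le> X_inner l a b d V V"
  unfolding X_inner_def using L2_inner_self_nonneg a bd by (intro add_nonneg_nonneg mult_nonneg_nonneg) auto

text \<open>Nonnegativity of the squared norm of f - r g bounds the mixed term by the two
  squares.\<close>

lemma L2_lincomb_bound:
  assumes "f \<in> L2 l" "g \<in> L2 l"
  shows "L2_inner l (\<lambda>x. f x + r * g x) (\<lambda>x. f x + r * g x) \<le> 2 * L2_inner l f f + 2 * r\<^sup>2 * L2_inner l g g"
proof -
  have e: "L2_inner l (\<lambda>x. f x + r * g x) (\<lambda>x. f x + r * g x)
      = L2_inner l f f + 2 * r * L2_inner l f g + r\<^sup>2 * L2_inner l g g" for r
  proof -
    let ?h = "\<lambda>x. f x + r * g x"
    have h: "?h \<in> L2 l" by (rule L2_add[OF assms])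
    have "L2_inner l ?h ?h = L2_inner l ?h f + r * L2_inner l ?h g"
      using L2_inner_add[OF assms h, of r] by (simp add: L2_inner_commute)
    also have "\<dots> = L2_inner l f f + r * L2_inner l g f + r * (L2_inner l f g + r * L2_inner l g g)"
      by (simp add: L2_inner_add[OF assms assms(1)] L2_inner_add[OF assms assms(2)])
    finally show ?thesis by (simp add: L2_inner_commute[of l g f] algebra_simps power2_eq_square)
  qed
  have "0 \<le> L2_inner l (\<lambda>x. f x + (- r) * g x) (\<lambda>x. f x + (- r) * g x)" by (rule L2_inner_self_nonneg)
  then have "0 \<le> L2_inner l f f - 2 * r * L2_inner l f g + r\<^sup>2 * L2_inner l g g" unfolding e by simp
  then show ?thesis unfolding e by linarith
qed

lemma X_inner_lincomb_bound:
  assumes V: "\<And>k. comp k V \<in> L2 l" and W: "\<And>k. comp k W \<in> L2 l"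
    and U: "\<And>x. x \<in> {0..l} \<Longrightarrow> U x = V x + r *\<^sub>R W x"
  shows "X_inner l a b d U U \<le> 2 * X_inner l a b d V V + 2 * r\<^sup>2 * X_inner l a b d W W"
proof -
  have k: "L2_inner l (comp k U) (comp k U)
      \<le> 2 * L2_inner l (comp k V) (comp k V) + 2 * r\<^sup>2 * L2_inner l (comp k W) (comp k W)" for k
  proof -
    have "L2_inner l (comp k U) (comp k U)
        = L2_inner l (\<lambda>x. V x $ k + r * W x $ k) (\<lambda>x. V x $ k + r * W x $ k)"
      by (rule L2_inner_cong) (use U in auto)
    then show ?thesis using L2_lincomb_bound[OF V[of k] W[of k], of r] by simp
  qed
  have "x1 + p * x2 + q * x3 \<le> 2 * (v1 + p * v2 + q * v3) + 2 * s * (w1 + p * w2 + q * w3)"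
    if "x1 \<le> 2 * v1 + 2 * s * w1" "x2 \<le> 2 * v2 + 2 * s * w2" "x3 \<le> 2 * v3 + 2 * s * w3" "0 < p" "0 < q"
    for x1 x2 x3 v1 v2 v3 w1 w2 w3 p q s :: real
  proof -
    have "2 * (v1 + p * v2 + q * v3) + 2 * s * (w1 + p * w2 + q * w3)
        = (2 * v1 + 2 * s * w1) + p * (2 * v2 + 2 * s * w2) + q * (2 * v3 + 2 * s * w3)"
      by (simp add: algebra_simps)
    moreover have "p * x2 \<le> p * (2 * v2 + 2 * s * w2)" "q * x3 \<le> q * (2 * v3 + 2 * s * w3)"
      using that by (intro mult_left_mono; simp)+
    ultimately show ?thesis using that(1) by linarith
  qed
  from this[OF k k k a bd] show ?thesis unfolding X_inner_def .
qed

lemma finite_norm_lincomb: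
  assumes V: "finite_norm V" and W: "finite_norm W"
  shows "finite_norm (\<lambda>x. V x + r *\<^sub>R W x)"
proof -
  let ?U = "\<lambda>x. V x + r *\<^sub>R W x"
  have RV: "regular ((B ^^ k) V)" and RW: "regular ((B ^^ k) W)" for k
    using V W by (auto simp: finite_norm_def)
  \<comment> \<open>Linearity of the iterates holds only on the closed interval;
    \<open>regular_cong\<close> carries regularity and the next application of \<open>B\<close>
    across this equality.\<close>
  have P: "regular ((B ^^ k) ?U) \<and> (\<forall>x\<in>{0..l}. (B ^^ k) ?U x = (B ^^ k) V x + r *\<^sub>R (B ^^ k) W x)" for k
  proof (induction k)
    case 0
    then show ?case using regular_lincomb(1)[OF RV[of 0] RW[of 0]] by simp
  next
    case (Suc k)
    let ?Z = "\<lambda>x. (B ^^ k) V x + r *\<^sub>R (B ^^ k) W x"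
    have "B ((B ^^ k) ?U) = B ?Z" by (rule regular_cong(2)) (use Suc in auto)
    then have e: "(B ^^ Suc k) ?U x = (B ^^ Suc k) V x + r *\<^sub>R (B ^^ Suc k) W x" if "x \<in> {0..l}" for x
      using regular_lincomb(2)[OF RV RW that] by simp
    have "regular (\<lambda>x. (B ^^ Suc k) V x + r *\<^sub>R (B ^^ Suc k) W x)" by (rule regular_lincomb(1)[OF RV RW])
    then have "regular ((B ^^ Suc k) ?U)"
      using regular_cong(1)[of "(B ^^ Suc k) ?U" "\<lambda>x. (B ^^ Suc k) V x + r *\<^sub>R (B ^^ Suc k) W x", OF e] by blast
    then show ?case using e by blast
  qed
  let ?X = "\<lambda>V k. X_inner l a b d ((B ^^ k) V) ((B ^^ k) V) / fact k"
  have "summable (\<lambda>k. 2 * ?X V k + 2 * r\<^sup>2 * ?X W k)"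
    using V W by (intro summable_add summable_mult) (auto simp: finite_norm_def)
  moreover have "norm (?X ?U k) \<le> 2 * ?X V k + 2 * r\<^sup>2 * ?X W k" for k
  proof -
    have "X_inner l a b d ((B ^^ k) ?U) ((B ^^ k) ?U)
        \<le> 2 * X_inner l a b d ((B ^^ k) V) ((B ^^ k) V) + 2 * r\<^sup>2 * X_inner l a b d ((B ^^ k) W) ((B ^^ k) W)"
      by (rule X_inner_lincomb_bound) (use P RV RW regular_L2 in auto)
    then have "?X ?U k \<le> (2 * X_inner l a b d ((B ^^ k) V) ((B ^^ k) V)
        + 2 * r\<^sup>2 * X_inner l a b d ((B ^^ k) W) ((B ^^ k) W)) / fact k"
      by (rule divide_right_mono) simp
    then show ?thesis using X_inner_nonneg[of "(B ^^ k) ?U"] by (simp add: add_divide_distrib)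
  qed
  ultimately have "summable (?X ?U)" by (rule summable_comparison_test'[where N = 0])
  then show ?thesis using P unfolding finite_norm_def by blast
qed

text \<open>The left side is the summand k = 0 of a series of nonnegative terms.\<close>

lemma X_inner_le_Xinf_norm:
  assumes "finite_norm V"
  shows "X_inner l a b d V V \<le> (Xinf_norm l a b c d V)\<^sup>2"
proof -
  let ?X = "\<lambda>k. X_inner l a b d ((B ^^ k) V) ((B ^^ k) V) / fact k"
  have s: "summable ?X" using assms by (simp add: finite_norm_def)
  have "sum ?X {..<1} \<le> suminf ?X"
    by (rule sum_le_suminf[OF s]) (auto intro: divide_nonneg_pos X_inner_nonneg)
  then have "X_inner l a b d V V \<le> Xinf_inner l a b c d V V" by (simp add: Xinf_inner_def)
  then show ?thesis using X_inner_nonneg[of V] by (simp add: Xinf_norm_def)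
qed

lemma L2_le_Xinf_norm:
  "\<exists>M\<ge>0. \<forall>V k. finite_norm V \<longrightarrow> L2_inner l (comp k V) (comp k V) \<le> M * (Xinf_norm l a b c d V)\<^sup>2"
proof (intro exI conjI allI impI)
  \<comment> \<open>Sum of the reciprocals of the weights 1, a and b / d, so that one constant
    serves all three components.\<close>
  let ?M = "1 + 1 / a + 1 / (b / d)"
  show "?M \<ge> 0" using a bd by (intro add_nonneg_nonneg divide_nonneg_pos) auto
  fix V k assume V: "finite_norm V"
  let ?q = "\<lambda>k. L2_inner l (comp k V) (comp k V)"
  let ?X = "X_inner l a b d V V"
  have q: "?q j \<ge> 0" for j by (rule L2_inner_self_nonneg)
  have X: "?X = ?q 1 + a * ?q 2 + b / d * ?q 3" by (simp add: X_inner_def)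
  have p: "a * ?q 2 \<ge> 0" "b / d * ?q 3 \<ge> 0" using q[of 2] q[of 3] a bd by (simp_all only: mult_nonneg_nonneg less_imp_le)
  have X0: "?X \<ge> 0" by (rule X_inner_nonneg)
  have "?q 1 \<le> ?X" using X p by linarith
  moreover have "?q 2 \<le> 1 / a * ?X"
  proof -
    have "a * ?q 2 \<le> ?X" using X p q[of 1] by linarith
    then show ?thesis using a by (simp add: field_simps)
  qed
  moreover have "?q 3 \<le> 1 / (b / d) * ?X"
  proof -
    have "b / d * ?q 3 \<le> ?X" using X p q[of 1] by linarith
    then have "?q 3 \<le> ?X / (b / d)" using bd by (simp only: pos_le_divide_eq mult.commute)
    then show ?thesis by (simp only: times_divide_eq_left mult_1)
  qed
  moreover have "1 / a * ?X \<ge> 0" "1 / (b / d) * ?X \<ge> 0"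
    using X0 a bd by (simp_all only: mult_nonneg_nonneg divide_nonneg_pos zero_le_one)
  ultimately have bounds: "?q 1 \<le> ?X" "?q 2 \<le> 1 / a * ?X" "?q 3 \<le> 1 / (b / d) * ?X"
    "1 / a * ?X \<ge> 0" "1 / (b / d) * ?X \<ge> 0" by blast+
  have sum: "u \<le> x + y + z" if "u \<le> x \<or> u \<le> y \<or> u \<le> z" "0 \<le> x" "0 \<le> y" "0 \<le> z" for u x y z :: real
    using that by linarith
  have "?q k \<le> ?X \<or> ?q k \<le> 1 / a * ?X \<or> ?q k \<le> 1 / (b / d) * ?X"
    using bounds(1-3) exhaust_3[of k] by (elim disjE; hypsubst; blast)
  from sum[OF this X0 bounds(4,5)] have "?q k \<le> ?M * ?X" by (simp only: distrib_right mult_1)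
  also have "\<dots> \<le> ?M * (Xinf_norm l a b c d V)\<^sup>2"
    by (rule mult_left_mono[OF X_inner_le_Xinf_norm[OF V] \<open>?M \<ge> 0\<close>])
  finally show "?q k \<le> ?M * (Xinf_norm l a b c d V)\<^sup>2" .
qed

lemma finite_norm_L2:
  assumes "finite_norm V"
  shows "comp k V \<in> L2 l"
proof -
  have "regular ((B ^^ 0) V)" using assms unfolding finite_norm_def by blast
  then show ?thesis using regular_L2 by simp
qed

lemma coeff_le_Xinf_norm:
  "\<exists>M. \<forall>V n k. finite_norm V \<longrightarrow> \<bar>coeff3 n V $ k\<bar> \<le> M * \<bar>Xinf_norm l a b c d V\<bar>"
proof -
  obtain M where M: "M \<ge> 0"
    "\<And>V k. finite_norm V \<Longrightarrow> L2_inner l (comp k V) (comp k V) \<le> M * (Xinf_norm l a b c d V)\<^sup>2"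
    using L2_le_Xinf_norm by blast
  have "\<bar>coeff3 n V $ k\<bar> \<le> sqrt (2 * M) * \<bar>Xinf_norm l a b c d V\<bar>" if V: "finite_norm V" for V n k
  proof -
    have "(coeff3 n V $ k)\<^sup>2 \<le> 2 * L2_inner l (comp k V) (comp k V)"
      by (rule coeff_bound[OF finite_norm_L2[OF V]])
    also have "\<dots> \<le> 2 * M * (Xinf_norm l a b c d V)\<^sup>2" using M(2)[OF V, of k] by simp
    finally have "sqrt ((coeff3 n V $ k)\<^sup>2) \<le> sqrt (2 * M * (Xinf_norm l a b c d V)\<^sup>2)" by (rule real_sqrt_le_mono)
    then show ?thesis by (simp add: real_sqrt_mult)
  qed
  then show ?thesis by blast
qed

section \<open>Coefficients of time-dependent vectors\<close>

lemma coeff_lincomb: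
  assumes "\<And>k. comp k V \<in> L2 l" "\<And>k. comp k W \<in> L2 l"
  shows "coeff3 n (\<lambda>x. V x + r *\<^sub>R W x) $ k = coeff3 n V $ k + r * coeff3 n W $ k"
  using L2_inner_add[OF assms(1)[of k] assms(2)[of k] continuous_imp_L2[OF continuous_Phi[where k = k and n = n]], of r]
  by (simp add: fourier_coeff_def)

lemma finite_norm_diff: "finite_norm V \<Longrightarrow> finite_norm W \<Longrightarrow> finite_norm (\<lambda>x. V x - W x)"
  using finite_norm_lincomb[of V W "-1"] by simp

lemma coeff_diff:
  "finite_norm V \<Longrightarrow> finite_norm W \<Longrightarrow> coeff3 n (\<lambda>x. V x - W x) $ k = coeff3 n V $ k - coeff3 n W $ k"
  using coeff_lincomb[of V W n "-1" k] finite_norm_L2 by simp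

lemma eventually_within:
  fixes t :: real
  shows "\<forall>\<^sub>F s in at t within T. s \<in> T \<and> s \<noteq> t"
  unfolding eventually_at by (auto intro: exI[of _ 1])

lemma coeff_continuous:
  assumes V: "V \<in> C0_Xinf l a b c d T"
  shows "continuous_on T (\<lambda>t. coeff3 n (V t) $ k)"
  unfolding continuous_on_def
proof
  fix t assume t: "t \<in> T"
  have fin: "finite_norm (V s)" if "s \<in> T" for s
    using V that Xinf_finite_norm by (auto simp: C0_Xinf_def)
  obtain M where M: "\<And>V n k. finite_norm V \<Longrightarrow> \<bar>coeff3 n V $ k\<bar> \<le> M * \<bar>Xinf_norm l a b c d V\<bar>"
    using coeff_le_Xinf_norm by blast
  have "((\<lambda>s. Xinf_norm l a b c d (\<lambda>x. V s x - V t x)) \<longlongrightarrow> 0) (at t within T)"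
    using V t by (auto simp: C0_Xinf_def)
  then have "((\<lambda>s. M * \<bar>Xinf_norm l a b c d (\<lambda>x. V s x - V t x)\<bar>) \<longlongrightarrow> M * \<bar>0\<bar>) (at t within T)"
    by (intro tendsto_intros)
  then have "((\<lambda>s. M * \<bar>Xinf_norm l a b c d (\<lambda>x. V s x - V t x)\<bar>) \<longlongrightarrow> 0) (at t within T)" by simp
  then have "((\<lambda>s. coeff3 n (V s) $ k - coeff3 n (V t) $ k) \<longlongrightarrow> 0) (at t within T)"
  proof (rule Lim_null_comparison[rotated])
    show "\<forall>\<^sub>F s in at t within T. norm (coeff3 n (V s) $ k - coeff3 n (V t) $ k)
        \<le> M * \<bar>Xinf_norm l a b c d (\<lambda>x. V s x - V t x)\<bar>"
      using eventually_within
    proof eventually_elim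
      case (elim s)
      then show ?case
        using M[OF finite_norm_diff[OF fin[of s] fin[OF t]], of n k] coeff_diff[OF fin[of s] fin[OF t]] by simp
    qed
  qed
  then show "((\<lambda>t. coeff3 n (V t) $ k) \<longlongrightarrow> coeff3 n (V t) $ k) (at t within T)"
    by (simp add: LIM_zero_iff)
qed

text \<open>The derivative in the norm and the pointwise derivative agree: along a subsequence of
  difference quotients the convergence in \<open>L2\<close> is pointwise almost everywhere.\<close>

lemma norm_derivative_eq_pointwise:
  assumes V: "V \<in> C1_Xinf l a b c d {0..}" and t: "0 < t"
    and G: "\<And>k. continuous_on {0..l} (comp k G)"
    and pt: "\<And>x. x \<in> {0<..<l} \<Longrightarrow> ((\<lambda>s. V s x) has_vector_derivative G x) (at t)"
  shows "((\<lambda>s. coeff3 n (V s) $ k) has_real_derivative coeff3 n G $ k) (at t)"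
proof -
  obtain U where U: "U \<in> C0_Xinf l a b c d {0..}"
    and lim: "\<forall>t\<in>{0..}. ((\<lambda>s. Xinf_norm l a b c d (\<lambda>x. (V s x - V t x) /\<^sub>R (s - t) - U t x)) \<longlongrightarrow> 0) (at t within {0..})"
    using V unfolding C1_Xinf_def by blast
  have finV: "finite_norm (V s)" if "s \<ge> 0" for s
    using V that Xinf_finite_norm by (auto simp: C1_Xinf_def C0_Xinf_def)
  have Ut: "U t \<in> Xinf l a b c d" using U t by (auto simp: C0_Xinf_def)
  note finU = Xinf_finite_norm[OF Ut]
  have at: "at t within {0..} = at t"
    by (rule at_within_open_subset[of t "{0<..}"]) (use t in auto)
  have lim: "((\<lambda>s. Xinf_norm l a b c d (\<lambda>x. (V s x - V t x) /\<^sub>R (s - t) - U t x)) \<longlongrightarrow> 0) (at t)"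
    using bspec[OF lim, of t] t unfolding at by simp
  define Q where "Q s x = (V s x - V t x) /\<^sub>R (s - t)" for s x
  have finQ: "finite_norm (Q s)" if s: "s \<ge> 0" "s \<noteq> t" for s
  proof -
    have "finite_norm (\<lambda>x. V s x - V t x)" by (rule finite_norm_diff[OF finV finV]) (use s t in auto)
    \<comment> \<open>The scalar multiple is written as D + (r - 1) D to fit the closure lemma,
      which has no pure scaling.\<close>
    from finite_norm_lincomb[OF this this, of "inverse (s - t) - 1"]
    have "finite_norm (\<lambda>x. (V s x - V t x) + (inverse (s - t) - 1) *\<^sub>R (V s x - V t x))" .
    moreover have "(V s x - V t x) + (inverse (s - t) - 1) *\<^sub>R (V s x - V t x) = Q s x" for x
      by (simp add: Q_def scaleR_left_diff_distrib)
    ultimately show ?thesis by (simp only:)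
  qed
  have finD: "finite_norm (\<lambda>x. Q s x - U t x)" if "s \<ge> 0" "s \<noteq> t" for s
    by (rule finite_norm_diff[OF finQ[OF that] finU])
  have coeffQ: "coeff3 n (Q s) $ k = (coeff3 n (V s) $ k - coeff3 n (V t) $ k) / (s - t)"
    if s: "s \<ge> 0" "s \<noteq> t" for s
  proof -
    have D: "finite_norm (\<lambda>x. V s x - V t x)" by (rule finite_norm_diff[OF finV finV]) (use s t in auto)
    have "Q s = (\<lambda>x. (V s x - V t x) + (inverse (s - t) - 1) *\<^sub>R (V s x - V t x))"
      by (simp add: Q_def[abs_def] scaleR_left_diff_distrib)
    then have "coeff3 n (Q s) $ k = inverse (s - t) * coeff3 n (\<lambda>x. V s x - V t x) $ k"
      using coeff_lincomb[of "\<lambda>x. V s x - V t x" "\<lambda>x. V s x - V t x" n "inverse (s - t) - 1" k]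
        finite_norm_L2[OF D] by (simp add: algebra_simps)
    moreover have "coeff3 n (\<lambda>x. V s x - V t x) $ k = coeff3 n (V s) $ k - coeff3 n (V t) $ k"
      by (rule coeff_diff[OF finV finV]) (use s t in auto)
    ultimately show ?thesis by (simp add: divide_inverse mult.commute)
  qed
  have ev: "\<forall>\<^sub>F s in at t. s \<ge> 0 \<and> s \<noteq> t" using eventually_within[where t = t and T = "{0..}"] unfolding at by simp

  \<comment> \<open>A sequence of times, since an almost everywhere convergent subsequence is to be
    extracted; it approaches from the right and so stays in the half-line.\<close>
  define \<sigma> where "\<sigma> j = t + 1 / real (Suc j)" for j
  have \<sigma>: "\<sigma> j \<ge> 0" "\<sigma> j \<noteq> t" for j using t by (auto simp: \<sigma>_def)
  have \<sigma>lim: "filterlim \<sigma> (at t) sequentially"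
  proof -
    have "(\<lambda>j. t + 1 / real (Suc j)) \<longlonglongrightarrow> t + 0"
      by (intro tendsto_add tendsto_const lim_1_over_n[THEN LIMSEQ_Suc])
    then show ?thesis using \<sigma>(2) unfolding filterlim_at \<sigma>_def by simp
  qed
  have UG: "U t x $ m = G x $ m" if x: "x \<in> {0..l}" for x m
  proof -
    obtain M where M: "M \<ge> 0"
      "\<And>V k. finite_norm V \<Longrightarrow> L2_inner l (comp k V) (comp k V) \<le> M * (Xinf_norm l a b c d V)\<^sup>2"
      using L2_le_Xinf_norm by blast
    \<comment> \<open>Norm convergence of \<open>Q\<close> to \<open>U t\<close> makes these squares
      tend to 0 in L1.\<close>
    define u where "u j x = (Q (\<sigma> j) x $ m - U t x $ m)\<^sup>2" for j x
    have D: "finite_norm (\<lambda>x. Q (\<sigma> j) x - U t x)" for j by (rule finD[OF \<sigma>])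
    have iu: "integrable (intv l) (u j)" for j
      using finite_norm_L2[OF D[of j], of m] by (simp add: L2_def u_def[abs_def])
    have "(\<lambda>j. \<integral>x. norm (u j x) \<partial>intv l) \<longlonglongrightarrow> 0"
    proof (rule Lim_null_comparison)
      have "(\<integral>x. norm (u j x) \<partial>intv l) = L2_inner l (comp m (\<lambda>x. Q (\<sigma> j) x - U t x)) (comp m (\<lambda>x. Q (\<sigma> j) x - U t x))" for j
        by (simp add: L2_inner_def u_def power2_eq_square)
      then show "\<forall>\<^sub>F j in sequentially. norm (\<integral>x. norm (u j x) \<partial>intv l)
          \<le> M * (Xinf_norm l a b c d (\<lambda>x. Q (\<sigma> j) x - U t x))\<^sup>2"
        using M(2)[OF D, where k = m] L2_inner_self_nonneg by simp
      have "(\<lambda>j. Xinf_norm l a b c d (\<lambda>x. Q (\<sigma> j) x - U t x)) \<longlonglongrightarrow> 0"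
        using filterlim_compose[OF lim \<sigma>lim] unfolding Q_def .
      then have "(\<lambda>j. M * (Xinf_norm l a b c d (\<lambda>x. Q (\<sigma> j) x - U t x))\<^sup>2) \<longlonglongrightarrow> M * 0\<^sup>2"
        by (intro tendsto_intros)
      then show "(\<lambda>j. M * (Xinf_norm l a b c d (\<lambda>x. Q (\<sigma> j) x - U t x))\<^sup>2) \<longlonglongrightarrow> 0" by simp
    qed
    from tendsto_L1_AE_subseq[OF iu this]
    obtain r :: "nat \<Rightarrow> nat" where r: "strict_mono r" "AE x in intv l. (\<lambda>j. u (r j) x) \<longlonglongrightarrow> 0" by blast
    have "AE x in intv l. U t x $ m = G x $ m"
      using r(2) AE_space
    proof eventually_elim
      case (elim x)
      then have x: "x \<in> {0<..<l}" by simp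
      have "((\<lambda>s. V s x $ m) has_real_derivative G x $ m) (at t)"
        using bounded_linear.has_vector_derivative[OF bounded_linear_vec_nth pt[OF x]]
        by (simp add: has_real_derivative_iff_has_vector_derivative)
      then have "((\<lambda>s. (V s x $ m - V t x $ m) / (s - t)) \<longlongrightarrow> G x $ m) (at t)"
        by (simp add: has_field_derivative_iff)
      then have "(\<lambda>j. (V (\<sigma> j) x $ m - V t x $ m) / (\<sigma> j - t)) \<longlonglongrightarrow> G x $ m"
        by (rule filterlim_compose[OF _ \<sigma>lim])
      then have "(\<lambda>j. Q (\<sigma> j) x $ m) \<longlonglongrightarrow> G x $ m" by (simp add: Q_def divide_inverse mult.commute)
      \<comment> \<open>Pointwise differentiability identifies the limit of the squares, which along
        the subsequence is also 0.\<close>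
      then have "(\<lambda>j. u j x) \<longlonglongrightarrow> (G x $ m - U t x $ m)\<^sup>2"
        unfolding u_def by (intro tendsto_power tendsto_diff tendsto_const)
      then have "(\<lambda>j. u (r j) x) \<longlonglongrightarrow> (G x $ m - U t x $ m)\<^sup>2"
        using LIMSEQ_subseq_LIMSEQ[OF _ r(1)] by (simp add: o_def)
      then have "(G x $ m - U t x $ m)\<^sup>2 = 0" using elim(1) LIMSEQ_unique by blast
      then show ?case by simp
    qed
    then show ?thesis
      by (rule AE_intv_continuous_eq[OF _ smooth_vec_comp[OF Xinf_imp_smooth_vec[OF Ut]] G l x])
  qed
  have UGc: "coeff3 n (U t) $ k = coeff3 n G $ k"
    unfolding fourier_coeff_def by (simp, rule L2_inner_cong) (use UG in auto)

  obtain M where M: "\<And>V n k. finite_norm V \<Longrightarrow> \<bar>coeff3 n V $ k\<bar> \<le> M * \<bar>Xinf_norm l a b c d V\<bar>"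
    using coeff_le_Xinf_norm by blast
  have "((\<lambda>s. M * \<bar>Xinf_norm l a b c d (\<lambda>x. Q s x - U t x)\<bar>) \<longlongrightarrow> M * \<bar>0\<bar>) (at t)"
    using lim unfolding Q_def by (intro tendsto_intros)
  then have "((\<lambda>s. M * \<bar>Xinf_norm l a b c d (\<lambda>x. Q s x - U t x)\<bar>) \<longlongrightarrow> 0) (at t)" by simp
  then have "((\<lambda>s. (coeff3 n (V s) $ k - coeff3 n (V t) $ k) / (s - t) - coeff3 n (U t) $ k) \<longlongrightarrow> 0) (at t)"
  proof (rule Lim_null_comparison[rotated])
    show "\<forall>\<^sub>F s in at t. norm ((coeff3 n (V s) $ k - coeff3 n (V t) $ k) / (s - t) - coeff3 n (U t) $ k)
        \<le> M * \<bar>Xinf_norm l a b c d (\<lambda>x. Q s x - U t x)\<bar>"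
      using ev
    proof eventually_elim
      case (elim s)
      then have s: "s \<ge> 0" "s \<noteq> t" by auto
      show ?case using M[OF finD[OF s], of n k] coeff_diff[OF finQ[OF s] finU, of n k] coeffQ[OF s] by simp
    qed
  qed
  then show ?thesis unfolding has_field_derivative_iff UGc by (simp add: LIM_zero_iff)
qed

end

section \<open>Diagonalisation of the symbol\<close>

lemma matrix_matrix_mult_3:
  fixes A B :: "complex^3^3"
  shows "(A ** B) $ i $ j = A $ i $ 1 * B $ 1 $ j + A $ i $ 2 * B $ 2 $ j + A $ i $ 3 * B $ 3 $ j"
  by (simp add: matrix_matrix_mult_def sum_3)

lemma freq_gt_0: "0 < l \<Longrightarrow> n \<noteq> 0 \<Longrightarrow> 0 < freq l n"
  by (simp add: freq_def)

lemma matS_nth: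
  "matS l a b c d n $ i $ 1 = eigvec l a b c d n 0 $ i"
  "matS l a b c d n $ i $ 2 = eigvec l a b c d n 1 $ i"
  "matS l a b c d n $ i $ 3 = eigvec l a b c d n 2 $ i"
  by (simp_all add: matS_def transpose_def)

lemma matD_nth:
  "matD l a b c d n $ i $ j = (if i = j then
    (if i = 1 then eigval l a b c d n 0 else if i = 2 then eigval l a b c d n 1 else eigval l a b c d n 2) else 0)"
  using exhaust_3[of i] exhaust_3[of j] by (auto simp: matD_def)

lemma eigvec_0:
  "eigvec l a b c d 0 0 = axis 1 1" "eigvec l a b c d 0 1 = axis 2 1" "eigvec l a b c d 0 2 = axis 3 1"
  by (simp_all add: eigvec_def)

lemma eigvec_nth:
  assumes "n \<noteq> 0"
  shows "eigvec l a b c d n k $ 1 = - of_real b * of_real (freq l n) * eigval l a b c d n k"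
    "eigvec l a b c d n k $ 2 = of_real b * (of_real (freq l n))\<^sup>2"
    "eigvec l a b c d n k $ 3 = of_real a * (of_real (freq l n))\<^sup>2 + (eigval l a b c d n k)\<^sup>2"
  using assms by (simp_all add: eigvec_def Let_def)

text \<open>Cubing u + v = B - 3 \<mu> leaves only the product uv and the sum of cubes, both
  prescribed by the coefficients; the result is 27 times the cubic, up to sign.\<close>

lemma cardano_root:
  fixes B P Q u v \<mu> :: complex
  assumes "u * v = B\<^sup>2 - 3 * P" "u ^ 3 + v ^ 3 = - 2 * B ^ 3 + 9 * B * P - 27 * Q" "3 * \<mu> = B - u - v"
  shows "\<mu> ^ 3 - B * \<mu>\<^sup>2 + P * \<mu> - Q = 0"
proof -
  have uv: "u + v = B - 3 * \<mu>" using assms(3) by (simp add: algebra_simps)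
  have "(u + v) ^ 3 = (u ^ 3 + v ^ 3) + 3 * (u * v) * (u + v)" by (simp add: power3_eq_cube algebra_simps)
  then have "(B - 3 * \<mu>) ^ 3 = (- 2 * B ^ 3 + 9 * B * P - 27 * Q) + 3 * (B\<^sup>2 - 3 * P) * (B - 3 * \<mu>)"
    unfolding uv assms(1,2) .
  then have "27 * (\<mu> ^ 3 - B * \<mu>\<^sup>2 + P * \<mu> - Q) = 0"
    by (simp add: power3_eq_cube power2_eq_square algebra_simps)
  then show ?thesis unfolding mult_eq_0_iff by simp
qed

lemma exp_third_cubed: "exp (2 * \<i> * of_nat k * of_real pi / 3) ^ 3 = 1"
proof -
  have "exp (2 * \<i> * of_nat k * of_real pi / 3) ^ 3 = exp (3 * (2 * \<i> * of_nat k * of_real pi / 3))"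
    by (metis exp_of_nat_mult of_nat_numeral)
  also have "\<dots> = 1" unfolding exp_eq_1 by (auto intro!: exI[of _ "int k"])
  finally show ?thesis .
qed

lemma cardano_C_cubed:
  assumes "cardano_C l a b c d n \<noteq> 0"
  shows "cardano_C l a b c d n ^ 3 = (of_real (Delta1 l a b c d n)
        + csqrt (of_real ((Delta1 l a b c d n)\<^sup>2 - 4 * (Delta0 l a b c d n)^3))) / 2"
proof -
  define w where "w = (of_real (Delta1 l a b c d n)
        + csqrt (of_real ((Delta1 l a b c d n)\<^sup>2 - 4 * (Delta0 l a b c d n)^3))) / 2"
  have C: "cardano_C l a b c d n = w powr (1 / 3)" by (simp add: cardano_C_def w_def)
  have "w \<noteq> 0" using assms by (auto simp: C)
  then have "(w powr (1 / 3)) ^ 3 = w"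
    using exp_of_nat_mult[of 3 "Ln w / 3"] by (simp add: powr_def)
  then show ?thesis by (simp add: C w_def)
qed

text \<open>The second exponential is the inverse of the first, so with u = C times a cube root of
  unity the last two terms are u and Delta0 / u: Cardano's pair, with product Delta0.\<close>

lemma eigval_eq:
  assumes "n \<noteq> 0"
  shows "3 * eigval l a b c d n k = of_real (c * (freq l n)\<^sup>2)
    - cardano_C l a b c d n * exp (2 * \<i> * of_nat k * of_real pi / 3)
    - of_real (Delta0 l a b c d n) / (cardano_C l a b c d n * exp (2 * \<i> * of_nat k * of_real pi / 3))"
proof -
  have "exp (- 2 * \<i> * of_nat k * of_real pi / 3) = inverse (exp (2 * \<i> * of_nat k * of_real pi / 3))"
    by (simp add: exp_minus[symmetric])
  moreover have "inverse e * (z / w) = z / (w * e)" for e z w :: complex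
    by (simp add: divide_inverse)
  ultimately show ?thesis using assms unfolding eigval_def by simp
qed

text \<open>The cube of \<open>cardano_C\<close> solves the resolvent quadratic z^2 - Delta1 z +
  Delta0^3 = 0. In this form the square root no longer appears.\<close>

lemma cardano_C_power6:
  assumes "cardano_C l a b c d n \<noteq> 0"
  shows "(cardano_C l a b c d n ^ 3)\<^sup>2 =
    of_real (Delta1 l a b c d n) * cardano_C l a b c d n ^ 3 - of_real (Delta0 l a b c d n) ^ 3"
proof -
  define s where "s = csqrt (of_real ((Delta1 l a b c d n)\<^sup>2 - 4 * (Delta0 l a b c d n)^3))"
  have s: "s\<^sup>2 = (of_real (Delta1 l a b c d n))\<^sup>2 - 4 * of_real (Delta0 l a b c d n) ^ 3"
    by (simp only: s_def power2_csqrt of_real_diff of_real_mult of_real_power of_real_numeral)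
  have "cardano_C l a b c d n ^ 3 = (of_real (Delta1 l a b c d n) + s) / 2"
    unfolding s_def by (rule cardano_C_cubed[OF assms])
  then have "2 * cardano_C l a b c d n ^ 3 = of_real (Delta1 l a b c d n) + s"
    by (simp add: mult.commute)
  moreover have "2 * z = p + s \<Longrightarrow> s\<^sup>2 = p\<^sup>2 - 4 * q \<Longrightarrow> z\<^sup>2 = p * z - q" for z p q :: complex
    by algebra
  ultimately show ?thesis using s by blast
qed

text \<open>The cubic is the characteristic polynomial of \<open>matB\<close>.\<close>

lemma eigval_root:
  fixes l a b c d :: real and n k :: nat
  assumes n: "n \<noteq> 0" and C: "cardano_C l a b c d n \<noteq> 0"
  defines "\<nu> \<equiv> complex_of_real (freq l n)" and "\<mu> \<equiv> eigval l a b c d n k"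
  shows "\<mu> ^ 3 - of_real c * \<nu>\<^sup>2 * \<mu>\<^sup>2 + of_real (a + b * d) * \<nu>\<^sup>2 * \<mu> - of_real (a * c) * \<nu> ^ 4 = 0"
proof -
  define u where "u = cardano_C l a b c d n * exp (2 * \<i> * of_nat k * of_real pi / 3)"
  define v where "v = of_real (Delta0 l a b c d n) / u"
  have u0: "u \<noteq> 0" using C by (simp add: u_def)
  have u3: "u ^ 3 = cardano_C l a b c d n ^ 3" by (simp add: u_def power_mult_distrib exp_third_cubed)
  have "(u ^ 3)\<^sup>2 = of_real (Delta1 l a b c d n) * u ^ 3 - of_real (Delta0 l a b c d n) ^ 3"
    unfolding u3 by (rule cardano_C_power6[OF C])
  \<comment> \<open>Dividing the resolvent quadratic by u^3: its other root is v^3, and the roots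
    add up to Delta1.\<close>
  then have uv3: "u ^ 3 + v ^ 3 = of_real (Delta1 l a b c d n)"
    using u0 by (simp add: v_def field_simps power2_eq_square)
  have uv: "u * v = of_real (Delta0 l a b c d n)" using u0 by (simp add: v_def)
  have "3 * \<mu> = of_real c * \<nu>\<^sup>2 - u - v"
    using eigval_eq[OF n, of l a b c d k] by (simp add: \<mu>_def \<nu>_def u_def v_def)
  then show ?thesis
    by (intro cardano_root[of u v])
      (simp_all add: uv uv3 \<nu>_def Delta0_def Delta1_def power_mult_distrib flip: power_mult)
qed

lemma exp_third_distinct:
  assumes "j < 3" "k < 3" "j \<noteq> k"
  shows "exp (2 * \<i> * of_nat j * of_real pi / 3) \<noteq> exp (2 * \<i> * of_nat k * of_real pi / 3)"
proof
  assume "exp (2 * \<i> * of_nat j * of_real pi / 3) = exp (2 * \<i> * of_nat k * of_real pi / 3)"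
  then obtain m :: int where "2 * \<i> * of_nat j * of_real pi / 3 = 2 * \<i> * of_nat k * of_real pi / 3 + (of_int (2 * m) * pi) * \<i>"
    using exp_eq by metis
  then have "Im (2 * \<i> * of_nat j * of_real pi / 3) = Im (2 * \<i> * of_nat k * of_real pi / 3 + (of_int (2 * m) * pi) * \<i>)"
    by presburger
  then have "pi * (real j * 2) = pi * (real k * 2 + of_int m * 6)" by (simp add: algebra_simps)
  then have "real j = real k + 3 * of_int m" by simp
  then have "int j = int k + 3 * m" by linarith
  then show False using assms by presburger
qed

text \<open>If two eigenvalues agree, then x + D0 / x = y + D0 / y with x \<noteq> y, so x y = D0.
  Cubing shows that the resolvent quadratic has a double root, and its discriminant Delta1^2 - 4
  Delta0^3 vanishes.\<close>

lemma eigval_distinct: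
  assumes n: "n \<noteq> 0" and nd: "nondegenerate l a b c d n" and jk: "j < 3" "k < 3" "j \<noteq> k"
  shows "eigval l a b c d n j \<noteq> eigval l a b c d n k"
proof
  assume eq: "eigval l a b c d n j = eigval l a b c d n k"
  have C: "cardano_C l a b c d n \<noteq> 0" and disc: "(Delta1 l a b c d n)\<^sup>2 - 4 * (Delta0 l a b c d n)^3 \<noteq> 0"
    using nd n by (auto simp: nondegenerate_def)
  define x where "x = cardano_C l a b c d n * exp (2 * \<i> * of_nat j * of_real pi / 3)"
  define y where "y = cardano_C l a b c d n * exp (2 * \<i> * of_nat k * of_real pi / 3)"
  define D0 where "D0 = complex_of_real (Delta0 l a b c d n)"
  define D1 where "D1 = complex_of_real (Delta1 l a b c d n)"
  have xy: "x \<noteq> 0" "y \<noteq> 0" "x \<noteq> y" using C exp_third_distinct[OF jk] by (auto simp: x_def y_def)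
  have cube: "x ^ 3 = cardano_C l a b c d n ^ 3" "y ^ 3 = cardano_C l a b c d n ^ 3"
    by (simp_all add: x_def y_def power_mult_distrib exp_third_cubed)
  have "t = p - u - q \<Longrightarrow> u + q = p - t" for t p u q :: complex by simp
  note move = this[OF eigval_eq[OF n]]
  have "x + D0 / x = y + D0 / y"
    unfolding x_def y_def D0_def move eq ..
  then have "(x - y) * (x * y - D0) = 0" using xy by (simp add: field_simps)
  then have "x * y = D0" using xy by simp
  then have "D0 ^ 3 = (cardano_C l a b c d n ^ 3)\<^sup>2"
    using cube by (metis power_mult_distrib power2_eq_square)
  define z where "z = cardano_C l a b c d n ^ 3"
  have z0: "z \<noteq> 0" using C by (simp add: z_def)
  have D: "D0 ^ 3 = z\<^sup>2" "z\<^sup>2 = D1 * z - D0 ^ 3"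
    using \<open>D0 ^ 3 = _\<close> cardano_C_power6[OF C] by (auto simp: z_def D0_def D1_def)
  then have "z * (D1 - 2 * z) = 0" by algebra
  then have "D1 = 2 * z" using z0 by simp
  then have "D1\<^sup>2 - 4 * D0 ^ 3 = 0" using D by (simp add: power_mult_distrib)
  then have "complex_of_real ((Delta1 l a b c d n)\<^sup>2 - 4 * (Delta0 l a b c d n)^3) = 0"
    by (simp add: D0_def D1_def)
  then show False using disc of_real_eq_0_iff by blast
qed

text \<open>Up to row operations and scaling of rows the columns are (\<mu>, 1, \<mu>^2), so this is
  a Vandermonde determinant.\<close>

lemma det_matS:
  fixes l a b c d :: real
  assumes n: "n \<noteq> 0"
  defines "\<mu> \<equiv> eigval l a b c d n"
  shows "det (matS l a b c d n) = of_real (b\<^sup>2 * freq l n ^ 3) *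
    ((\<mu> 1 - \<mu> 0) * (\<mu> 2 - \<mu> 0) * (\<mu> 2 - \<mu> 1))"
  unfolding det_3 matS_nth eigvec_nth[OF n] \<mu>_def[symmetric]
  by (simp add: power2_eq_square power3_eq_cube algebra_simps)

lemma det_matS_nonzero:
  assumes "0 < l" "b \<noteq> 0" "nondegenerate l a b c d n"
  shows "det (matS l a b c d n) \<noteq> 0"
proof (cases "n = 0")
  case True
  have "det (matS l a b c d n) = 1"
    unfolding det_3 matS_nth True eigvec_0 by (simp add: axis_def)
  then show ?thesis by simp
next
  case False
  have "eigval l a b c d n 1 \<noteq> eigval l a b c d n 0" "eigval l a b c d n 2 \<noteq> eigval l a b c d n 0"
    "eigval l a b c d n 2 \<noteq> eigval l a b c d n 1"
    by (rule eigval_distinct[OF False assms(3)]; simp)+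
  then show ?thesis
    unfolding det_matS[OF False] using assms freq_gt_0[OF assms(1) False] by simp
qed

lemma matB_matS:
  assumes "nondegenerate l a b c d n"
  shows "matB l a b c d n ** matS l a b c d n = matS l a b c d n ** matD l a b c d n"
proof (cases "n = 0")
  case True
  then show ?thesis
    by (simp add: vec_eq_iff forall_3 matrix_matrix_mult_3 matD_nth matB_def freq_def eigval_def)
next
  case False
  have C: "cardano_C l a b c d n \<noteq> 0" using assms False by (auto simp: nondegenerate_def)
  define \<nu> where "\<nu> = complex_of_real (freq l n)"
  have root: "\<mu> ^ 3 - of_real c * \<nu>\<^sup>2 * \<mu>\<^sup>2 + of_real (a + b * d) * \<nu>\<^sup>2 * \<mu> - of_real (a * c) * \<nu> ^ 4 = 0"
    if "\<mu> = eigval l a b c d n k" for k \<mu>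
    unfolding that \<nu>_def by (rule eigval_root[OF False C])
  \<comment> \<open>The first two rows of the eigenvector equation hold for every \<mu>; the third
    is the characteristic equation.\<close>
  have third: "of_real d * \<nu> * (- of_real b * \<nu> * \<mu>) + of_real c * \<nu>\<^sup>2 * (of_real a * \<nu>\<^sup>2 + \<mu>\<^sup>2)
      = (of_real a * \<nu>\<^sup>2 + \<mu>\<^sup>2) * \<mu>" if "\<mu> = eigval l a b c d n k" for k \<mu>
    using root[OF that] by (simp add: power2_eq_square power3_eq_cube power4_eq_xxxx algebra_simps)
  show ?thesis
    using third[OF refl]
    by (simp add: vec_eq_iff forall_3 matrix_matrix_mult_3 matD_nth matB_def matS_nth eigvec_nth[OF False]
      Let_def \<nu>_def[symmetric] power2_eq_square algebra_simps)
qed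

section \<open>Inverses of 3 by 3 matrices and independence of eigenvectors\<close>

lemma matrix_inv_inverse:
  fixes A :: "complex^'n^'n"
  assumes "invertible A"
  shows "A ** matrix_inv A = mat 1" "matrix_inv A ** A = mat 1"
  using someI_ex[OF assms[unfolded invertible_def]] unfolding matrix_inv_def by auto

lemma matrix_inv_unique:
  fixes A :: "complex^'n^'n"
  assumes "A ** A' = mat 1"
  shows "matrix_inv A = A'"
proof -
  have "invertible A" using assms invertible_right_inverse by blast
  then have "matrix_inv A ** A = mat 1" by (rule matrix_inv_inverse)
  then have "matrix_inv A ** (A ** A') = A'" by (simp add: matrix_mul_assoc)
  then show ?thesis by (simp add: assms)
qed

lemma matrix_inv_3:
  fixes S :: "complex^3^3"
  assumes "det S \<noteq> 0"
  shows "matrix_inv S = mat (1 / det S) ** vector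
            [vector [S$2$2 * S$3$3 - S$2$3 * S$3$2, - S$1$2 * S$3$3 + S$1$3 * S$3$2,
                     S$1$2 * S$2$3 - S$1$3 * S$2$2],
             vector [- S$2$1 * S$3$3 + S$2$3 * S$3$1, S$1$1 * S$3$3 - S$1$3 * S$3$1,
                     - S$1$1 * S$2$3 + S$1$3 * S$2$1],
             vector [S$2$1 * S$3$2 - S$2$2 * S$3$1, - S$1$1 * S$3$2 + S$1$2 * S$3$1,
                     S$1$1 * S$2$2 - S$1$2 * S$2$1]]" (is "_ = mat _ ** ?A")
proof (rule matrix_inv_unique)
  have SA: "S ** ?A = mat (det S)"
    by (simp add: vec_eq_iff forall_3 matrix_matrix_mult_3 mat_def det_3 algebra_simps)
  have "S ** (mat r ** T) = mat r ** (S ** T)" for r and T :: "complex^3^3"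
    by (simp add: vec_eq_iff forall_3 matrix_matrix_mult_3 mat_def algebra_simps)
  then have "S ** (mat (1 / det S) ** ?A) = mat (1 / det S) ** (S ** ?A)" .
  also have "\<dots> = mat 1"
    unfolding SA using assms by (simp add: vec_eq_iff forall_3 matrix_matrix_mult_3 mat_def)
  finally show "S ** (mat (1 / det S) ** ?A) = mat 1" .
qed

text \<open>Distinctness is stated separately because independence of a set does not notice
  coinciding vectors.\<close>

lemma independent_columns_3:
  fixes v0 v1 v2 :: "complex^3"
  assumes "det (transpose (vector [v0, v1, v2])) \<noteq> 0"
  shows "v0 \<noteq> v1" "v0 \<noteq> v2" "v1 \<noteq> v2" "vec.independent {v0, v1, v2}"
proof -
  let ?S = "vector [v0, v1, v2] :: complex^3^3"
  have S: "det ?S \<noteq> 0" using assms by (simp add: det_transpose)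
  have r: "row 1 ?S = v0" "row 2 ?S = v1" "row 3 ?S = v2" by (simp_all add: row_def)
  have "row i ?S \<noteq> row j ?S" if "i \<noteq> j" for i j using det_identical_rows[OF that] S by blast
  from this[of 1 2] this[of 1 3] this[of 2 3] show "v0 \<noteq> v1" "v0 \<noteq> v2" "v1 \<noteq> v2" by (simp_all add: r)
  have "rows ?S = (\<lambda>i. row i ?S) ` UNIV" by (auto simp: rows_def)
  then have "rows ?S = {v0, v1, v2}" by (simp add: UNIV_3 r)
  then show "vec.independent {v0, v1, v2}" using det_dependent_rows[of ?S] S by auto
qed

lemma matS_diagonalises:
  assumes "0 < l" "b \<noteq> 0" "nondegenerate l a b c d n"
  shows "inj_on (eigvec l a b c d n) {0, 1, 2}"
    "vec.independent (eigvec l a b c d n ` {0, 1, 2})"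
    "invertible (matS l a b c d n)"
    "matB l a b c d n = matS l a b c d n ** matD l a b c d n ** matrix_inv (matS l a b c d n)"
proof -
  note det = det_matS_nonzero[OF assms]
  show inv: "invertible (matS l a b c d n)" using det by (simp add: invertible_det_nz)
  show "inj_on (eigvec l a b c d n) {0, 1, 2}" "vec.independent (eigvec l a b c d n ` {0, 1, 2})"
    using independent_columns_3[OF det[unfolded matS_def]] by (auto simp: inj_on_def)
  have "matB l a b c d n = matB l a b c d n ** (matS l a b c d n ** matrix_inv (matS l a b c d n))"
    by (simp add: matrix_inv_inverse[OF inv])
  also have "\<dots> = matS l a b c d n ** matD l a b c d n ** matrix_inv (matS l a b c d n)"
    by (simp add: matrix_mul_assoc matB_matS[OF assms(3)])
  finally show "matB l a b c d n = matS l a b c d n ** matD l a b c d n ** matrix_inv (matS l a b c d n)" .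
qed

subsection \<open>The eigenvectors are not orthonormal\<close>

text \<open>Here x stands for the squared frequency and q for a + b d. The terms of degree 6 cancel,
  and what remains is x^3 times a quadratic with leading coefficient 108 a c^4 > 0.\<close>

lemma discriminant_eventually_pos:
  fixes a q c :: real
  assumes "0 < a" "0 < c"
  shows "\<forall>\<^sub>F x in at_top. 0 < (- 2 * c^3 * x^3 + 9 * c * q * x^2 - 27 * a * c * x^2)\<^sup>2 - 4 * (c^2 * x^2 - 3 * q * x) ^ 3"
proof -
  define A where "A = 108 * a * c ^ 4"
  define P where "P = (9 * c * q - 27 * a * c)\<^sup>2 - 108 * c\<^sup>2 * q\<^sup>2"
  have A: "A > 0" using assms by (simp add: A_def)
  have id: "(- 2 * c^3 * x^3 + 9 * c * q * x^2 - 27 * a * c * x^2)\<^sup>2 - 4 * (c^2 * x^2 - 3 * q * x) ^ 3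
      = x ^ 3 * (A * x\<^sup>2 + P * x + 108 * q ^ 3)" for x
    unfolding A_def P_def by (simp add: power2_eq_square power3_eq_cube power4_eq_xxxx algebra_simps)
  have *: "0 < x ^ 3 * (A * x\<^sup>2 + P * x + 108 * q ^ 3)" if x: "x > 1 + (\<bar>P\<bar> + \<bar>108 * q ^ 3\<bar>) / A" for x
  proof -
    have x1: "x > 1" using x A by (smt (verit) divide_nonneg_pos abs_ge_zero)
    have "\<bar>P\<bar> + \<bar>108 * q ^ 3\<bar> < A * x"
      using x A by (simp add: field_simps)
    then have "(\<bar>P\<bar> + \<bar>108 * q ^ 3\<bar>) * x < A * x * x" using x1 by (intro mult_strict_right_mono) auto
    moreover have "\<bar>P * x\<bar> = \<bar>P\<bar> * x" using x1 by (simp add: abs_mult)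
    moreover have "\<bar>108 * q ^ 3\<bar> \<le> \<bar>108 * q ^ 3\<bar> * x" using x1 by (simp add: mult_le_cancel_left1)
    ultimately have "0 < A * x\<^sup>2 + P * x + 108 * q ^ 3"
      by (simp add: power2_eq_square algebra_simps)
    then show ?thesis using x1 by simp
  qed
  have "\<forall>\<^sub>F x in at_top. 1 + (\<bar>P\<bar> + \<bar>108 * q ^ 3\<bar>) / A < x" by (rule eventually_gt_at_top)
  then show ?thesis unfolding id by eventually_elim (rule *)
qed

lemma freq_squared_at_top: "0 < l \<Longrightarrow> filterlim (\<lambda>n. (freq l n)\<^sup>2) at_top sequentially"
proof -
  assume "0 < l"
  then have "filterlim (\<lambda>n. pi / l * real n) at_top sequentially"
    by (intro filterlim_tendsto_pos_mult_at_top[OF tendsto_const _ filterlim_real_sequentially]) simp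
  then have "filterlim (freq l) at_top sequentially" by (simp add: freq_def[abs_def])
  then show ?thesis by (intro filterlim_pow_at_top) auto
qed

text \<open>A large frequency does everything: positive discriminant and positive Delta0 keep
  \<open>cardano_C\<close> from vanishing, and the entry b \<nu>^2 of the first eigenvector exceeds
  1 in modulus. Orthonormality thus fails through the normalisation.\<close>

lemma exists_nonorthonormal:
  assumes l: "0 < l" and a: "0 < a" and c: "0 < c" and b: "b \<noteq> 0"
  shows "\<exists>n. nondegenerate l a b c d n \<and> \<not> orthonormal_family (eigvec l a b c d n) {0, 1, 2}"
proof -
  define q where "q = a + b * d"
  have "\<forall>\<^sub>F x in at_top. 0 < (- 2 * c^3 * x^3 + 9 * c * q * x^2 - 27 * a * c * x^2)\<^sup>2 - 4 * (c^2 * x^2 - 3 * q * x) ^ 3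
      \<and> 3 * q / c\<^sup>2 < x \<and> 1 / \<bar>b\<bar> < x \<and> 0 < x"
    by (intro eventually_conj discriminant_eventually_pos a c eventually_gt_at_top)
  then have "\<forall>\<^sub>F n in sequentially. (\<lambda>x. 0 < (- 2 * c^3 * x^3 + 9 * c * q * x^2 - 27 * a * c * x^2)\<^sup>2 - 4 * (c^2 * x^2 - 3 * q * x) ^ 3
      \<and> 3 * q / c\<^sup>2 < x \<and> 1 / \<bar>b\<bar> < x \<and> 0 < x) ((freq l n)\<^sup>2)"
    using freq_squared_at_top[OF l] unfolding filterlim_iff by blast
  then obtain n where n: "0 < (- 2 * c^3 * ((freq l n)\<^sup>2)^3 + 9 * c * q * ((freq l n)\<^sup>2)^2 - 27 * a * c * ((freq l n)\<^sup>2)^2)\<^sup>2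
      - 4 * (c^2 * ((freq l n)\<^sup>2)^2 - 3 * q * (freq l n)\<^sup>2) ^ 3"
    "3 * q / c\<^sup>2 < (freq l n)\<^sup>2" "1 / \<bar>b\<bar> < (freq l n)\<^sup>2" "0 < (freq l n)\<^sup>2"
    unfolding eventually_sequentially by blast
  have n0: "n \<noteq> 0" using n(4) by (auto simp: freq_def)
  have disc: "(Delta1 l a b c d n)\<^sup>2 - 4 * (Delta0 l a b c d n)^3 > 0"
    using n(1) by (simp add: Delta1_def Delta0_def q_def flip: power_mult)
  have "c\<^sup>2 * (freq l n)\<^sup>2 - 3 * q > 0" using n(2) c by (simp add: field_simps)
  then have "(freq l n)\<^sup>2 * (c\<^sup>2 * (freq l n)\<^sup>2 - 3 * q) > 0" using n(4) by simp
  then have D0: "Delta0 l a b c d n > 0"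
    by (simp add: Delta0_def q_def algebra_simps power2_eq_square power4_eq_xxxx)
  define s where "s = sqrt ((Delta1 l a b c d n)\<^sup>2 - 4 * (Delta0 l a b c d n)^3)"
  have cs: "csqrt (of_real ((Delta1 l a b c d n)\<^sup>2 - 4 * (Delta0 l a b c d n)^3)) = of_real s"
    unfolding s_def using disc by (intro csqrt_of_real) simp
  have "Delta1 l a b c d n + s \<noteq> 0"
  proof
    assume "Delta1 l a b c d n + s = 0"
    then have "(Delta1 l a b c d n)\<^sup>2 = s\<^sup>2" by (metis add_eq_0_iff power2_minus)
    also have "s\<^sup>2 = (Delta1 l a b c d n)\<^sup>2 - 4 * (Delta0 l a b c d n)^3"
      unfolding s_def using disc by simp
    finally show False using D0 by simp
  qed
  then have "complex_of_real (Delta1 l a b c d n + s) \<noteq> 0" using of_real_eq_0_iff by blast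
  then have C: "cardano_C l a b c d n \<noteq> 0" unfolding cardano_C_def cs by simp
  have nd: "nondegenerate l a b c d n" using C disc by (simp add: nondegenerate_def)
  have "\<not> orthonormal_family (eigvec l a b c d n) {0, 1, 2}"
  proof
    let ?v = "eigvec l a b c d n 0"
    assume "orthonormal_family (eigvec l a b c d n) {0, 1, 2}"
    then have "(\<Sum>i\<in>UNIV. ?v $ i * cnj (?v $ i)) = 1" by (simp add: orthonormal_family_def)
    then have "complex_of_real (\<Sum>i\<in>UNIV. (cmod (?v $ i))\<^sup>2) = complex_of_real 1"
      by (simp add: complex_norm_square[symmetric])
    then have "(\<Sum>i\<in>UNIV. (cmod (?v $ i))\<^sup>2) = 1" using of_real_eq_iff by blast
    moreover have "(cmod (?v $ 2))\<^sup>2 \<le> (\<Sum>i\<in>UNIV. (cmod (?v $ i))\<^sup>2)"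
      by (rule member_le_sum) auto
    moreover have "cmod (?v $ 2) = \<bar>b\<bar> * (freq l n)\<^sup>2"
      by (simp add: eigvec_nth[OF n0] norm_mult norm_power)
    moreover have "\<bar>b\<bar> * (freq l n)\<^sup>2 > 1" using n(3) b by (simp add: field_simps)
    then have "(\<bar>b\<bar> * (freq l n)\<^sup>2)\<^sup>2 > 1" using one_less_power by fastforce
    ultimately show False by simp
  qed
  then show ?thesis using nd by blast
qed

section \<open>The scalar delay equation\<close>

text \<open>The scalar case: the diagonal entries of \<open>delayed_exp\<close> of a diagonal
  matrix.\<close>

definition dexp :: "real \<Rightarrow> complex \<Rightarrow> real \<Rightarrow> complex" where
  "dexp \<tau> z t = (if t < - \<tau> then 0 else
     1 + (\<Sum>k = 1..nat (\<lfloor>t / \<tau>\<rfloor> + 1). of_real ((t - (real k - 1) * \<tau>) ^ k / fact k) * z ^ k))"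

text \<open>For \<open>t \<ge> -\<tau>\<close> the summation bound may be enlarged if the summands are cut off to the
  half-line where they are active; this makes continuity and differentiability visible.\<close>

definition dterm :: "real \<Rightarrow> complex \<Rightarrow> nat \<Rightarrow> real \<Rightarrow> complex" where
  "dterm \<tau> z k t = of_real (max 0 (t - (real k - 1) * \<tau>) ^ k / fact k) * z ^ k"

lemma active_iff:
  assumes "0 < \<tau>" "- \<tau> \<le> t" "1 \<le> k"
  shows "k \<le> nat (\<lfloor>t / \<tau>\<rfloor> + 1) \<longleftrightarrow> (real k - 1) * \<tau> \<le> t"
proof -
  have "k \<le> nat (\<lfloor>t / \<tau>\<rfloor> + 1) \<longleftrightarrow> int k \<le> \<lfloor>t / \<tau>\<rfloor> + 1" using assms(3) by linarith
  also have "\<dots> \<longleftrightarrow> int k - 1 \<le> \<lfloor>t / \<tau>\<rfloor>" by linarith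
  also have "\<dots> \<longleftrightarrow> real_of_int (int k - 1) \<le> t / \<tau>" by (rule le_floor_iff)
  also have "\<dots> \<longleftrightarrow> (real k - 1) * \<tau> \<le> t" using assms(1) by (simp add: pos_le_divide_eq)
  finally show ?thesis .
qed

text \<open>Summand k becomes active at t = (k - 1) \<tau>, exactly where its base changes sign.
  Beyond the floor bound the base is negative and the cutoff gives 0.\<close>

lemma dexp_eq:
  assumes \<tau>: "0 < \<tau>" and t: "- \<tau> \<le> t" "t < real N * \<tau>"
  shows "dexp \<tau> z t = 1 + (\<Sum>k = 1..N. dterm \<tau> z k t)"
proof -
  have N: "nat (\<lfloor>t / \<tau>\<rfloor> + 1) \<le> N"
  proof (rule ccontr)
    assume "\<not> nat (\<lfloor>t / \<tau>\<rfloor> + 1) \<le> N"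
    then have "Suc N \<le> nat (\<lfloor>t / \<tau>\<rfloor> + 1)" by simp
    then have "(real (Suc N) - 1) * \<tau> \<le> t" using active_iff[OF \<tau> t(1), of "Suc N"] by simp
    then show False using t(2) by simp
  qed
  have "(\<Sum>k = 1..N. dterm \<tau> z k t) = (\<Sum>k = 1..nat (\<lfloor>t / \<tau>\<rfloor> + 1). dterm \<tau> z k t)"
  proof (rule sum.mono_neutral_right)
    show "\<forall>k\<in>{1..N} - {1..nat (\<lfloor>t / \<tau>\<rfloor> + 1)}. dterm \<tau> z k t = 0"
    proof
      fix k assume k: "k \<in> {1..N} - {1..nat (\<lfloor>t / \<tau>\<rfloor> + 1)}"
      then have "1 \<le> k" "\<not> (real k - 1) * \<tau> \<le> t" using active_iff[OF \<tau> t(1), of k] by auto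
      then show "dterm \<tau> z k t = 0" by (simp add: dterm_def max_def zero_power)
    qed
  qed (use N in auto)
  also have "\<dots> = (\<Sum>k = 1..nat (\<lfloor>t / \<tau>\<rfloor> + 1). of_real ((t - (real k - 1) * \<tau>) ^ k / fact k) * z ^ k)"
  proof (rule sum.cong)
    fix k assume "k \<in> {1..nat (\<lfloor>t / \<tau>\<rfloor> + 1)}"
    then have "(real k - 1) * \<tau> \<le> t" using active_iff[OF \<tau> t(1), of k] by auto
    then show "dterm \<tau> z k t = of_real ((t - (real k - 1) * \<tau>) ^ k / fact k) * z ^ k"
      by (simp add: dterm_def max_def)
  qed simp
  finally show ?thesis using t(1) by (simp add: dexp_def)
qed

text \<open>Differentiation lowers the index by one and delays by \<tau>. The hypothesis excludes
  only the corner of the linear summand at t = 0; higher powers of the positive part are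
  differentiable at their knots.\<close>

lemma dterm_Suc_has_derivative:
  assumes "t \<noteq> real k * \<tau> \<or> k \<ge> 1"
  shows "(dterm \<tau> z (Suc k) has_vector_derivative
    (if k = 0 then if t > 0 then z else 0 else z * dterm \<tau> z k (t - \<tau>))) (at t)"
proof -
  define s where "s = real k * \<tau>"
  define p where "p t = max 0 (t - s) ^ Suc k / fact (Suc k)" for t :: real
  have eq: "dterm \<tau> z (Suc k) = (\<lambda>t. of_real (p t) * z ^ Suc k)"
    unfolding dterm_def p_def s_def by simp
  have "(p has_real_derivative (if t > s then (t - s) ^ k / fact k else 0)) (at t)"
  proof -
    consider "t > s" | "t < s" | "t = s" "k \<ge> 1" using assms unfolding s_def by linarith
    then show ?thesis
    proof cases
      case 1
      have "((\<lambda>t. (t - s) ^ Suc k / fact (Suc k)) has_real_derivative (real (Suc k) * (t - s) ^ k) / fact (Suc k)) (at t)"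
        using DERIV_cdivide[OF DERIV_power_Suc[of "\<lambda>t. t - s" 1 t UNIV k], of "fact (Suc k)"]
        by (simp add: DERIV_diff[OF DERIV_ident DERIV_const, simplified] del: fact_Suc)
      moreover have "(real (Suc k) * (t - s) ^ k) / fact (Suc k) = (t - s) ^ k / fact k"
        by (simp add: field_simps del: of_nat_Suc)
      ultimately have "((\<lambda>t. (t - s) ^ Suc k / fact (Suc k)) has_real_derivative (t - s) ^ k / fact k) (at t)"
        by simp
      then have "(p has_real_derivative (t - s) ^ k / fact k) (at t)"
        by (rule has_field_derivative_transform_within_open[of _ _ _ "{s<..}"])
          (use 1 in \<open>auto simp: p_def max_def\<close>)
      then show ?thesis using 1 by simp
    next
      case 2
      have "((\<lambda>t. 0) has_real_derivative 0) (at t)" by simp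
      then have "(p has_real_derivative 0) (at t)"
        by (rule has_field_derivative_transform_within_open[of _ _ _ "{..<s}"])
          (use 2 in \<open>auto simp: p_def max_def\<close>)
      then show ?thesis using 2 by simp
    next
      case 3
      \<comment> \<open>At the knot the difference quotient is of order |h|^k, which tends to 0
        since k \<ge> 1.\<close>
      have "((\<lambda>h. (p (s + h) - p s) / h) \<longlongrightarrow> 0) (at 0)"
      proof (rule Lim_null_comparison)
        show "\<forall>\<^sub>F h in at 0. norm ((p (s + h) - p s) / h) \<le> \<bar>h\<bar> ^ k / fact (Suc k)"
        proof (rule eventually_at_topological[THEN iffD2], intro exI[of _ UNIV] conjI ballI impI)
          fix h :: real assume "h \<noteq> 0"
          have "max 0 h ^ Suc k \<le> \<bar>h\<bar> ^ Suc k" by (rule power_mono) auto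
          then have "max 0 h ^ Suc k / \<bar>h\<bar> \<le> \<bar>h\<bar> ^ k" using \<open>h \<noteq> 0\<close> by (simp add: field_simps)
          then have "max 0 h ^ Suc k / \<bar>h\<bar> / fact (Suc k) \<le> \<bar>h\<bar> ^ k / fact (Suc k)"
            by (rule divide_right_mono) simp
          then show "norm ((p (s + h) - p s) / h) \<le> \<bar>h\<bar> ^ k / fact (Suc k)"
            by (simp add: p_def abs_mult power_abs mult_ac)
        qed auto
        have "((\<lambda>h. \<bar>h\<bar> ^ k / fact (Suc k)) \<longlongrightarrow> \<bar>0\<bar> ^ k / fact (Suc k)) (at (0::real))"
          by (intro tendsto_intros) simp
        then show "((\<lambda>h. \<bar>h\<bar> ^ k / fact (Suc k)) \<longlongrightarrow> 0) (at (0::real))" using 3 by (auto simp: zero_power)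
      qed
      then show ?thesis using 3 unfolding DERIV_def by simp
    qed
  qed
  then have "(dterm \<tau> z (Suc k) has_vector_derivative
      of_real (if t > s then (t - s) ^ k / fact k else 0) * z ^ Suc k) (at t)"
    unfolding eq
    by (intro has_vector_derivative_mult_left has_vector_derivative_of_real)
      (simp add: has_real_derivative_iff_has_vector_derivative)
  moreover have "of_real (if t > s then (t - s) ^ k / fact k else 0) * z ^ Suc k
      = (if k = 0 then if t > 0 then z else 0 else z * dterm \<tau> z k (t - \<tau>))"
    unfolding dterm_def s_def by (auto simp: max_def algebra_simps zero_power)
  ultimately show ?thesis by simp
qed

lemma dexp_continuous_on:
  assumes \<tau>: "0 < \<tau>"
  shows "continuous_on {- \<tau>..} (dexp \<tau> z)"
  unfolding continuous_on_eq_continuous_within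
proof
  fix t assume t: "t \<in> {- \<tau>..}"
  obtain N :: nat where N: "t + 1 < real N * \<tau>"
    using reals_Archimedean3[OF \<tau>] by blast
  have "continuous (at t within {- \<tau>..}) (\<lambda>t. 1 + (\<Sum>k = 1..N. dterm \<tau> z k t))"
    unfolding dterm_def by (intro continuous_intros) auto
  then show "continuous (at t within {- \<tau>..}) (dexp \<tau> z)"
  proof (rule continuous_transform_within[OF _ zero_less_one t])
    fix u assume "u \<in> {- \<tau>..}" "dist u t < 1"
    then have "- \<tau> \<le> u" "u < real N * \<tau>" using N by (auto simp: dist_real_def)
    then show "1 + (\<Sum>k = 1..N. dterm \<tau> z k u) = dexp \<tau> z u" by (rule dexp_eq[OF \<tau>, symmetric])
  qed
qed

text \<open>The fundamental solution of y'(t) = z y(t - \<tau>). At t = 0 the delayed argument meets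
  the jump at -\<tau>, so the one-sided derivatives are 0 and z.\<close>

lemma dexp_has_derivative:
  assumes \<tau>: "0 < \<tau>" and t: "- \<tau> < t" "t \<noteq> 0"
  shows "(dexp \<tau> z has_vector_derivative z * dexp \<tau> z (t - \<tau>)) (at t)"
proof -
  obtain N :: nat where N: "t + 1 < real N * \<tau>" using reals_Archimedean3[OF \<tau>] by blast
  define d where "d k = (if k = 0 then if t > 0 then z else 0 else z * dterm \<tau> z k (t - \<tau>))" for k
  have "((\<lambda>t. \<Sum>k = 1..Suc N. dterm \<tau> z k t) has_vector_derivative (\<Sum>k = 1..Suc N. d (k - 1))) (at t)"
  proof (rule has_vector_derivative_sum)
    fix k assume "k \<in> {1..Suc N}"
    then obtain j where "k = Suc j" by (cases k) auto
    then show "(dterm \<tau> z k has_vector_derivative d (k - 1)) (at t)"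
      using dterm_Suc_has_derivative[of t j \<tau> z] t(2) unfolding d_def by (cases j) auto
  qed
  then have "((\<lambda>t. 1 + (\<Sum>k = 1..Suc N. dterm \<tau> z k t)) has_vector_derivative (\<Sum>k = 1..Suc N. d (k - 1))) (at t)"
    using has_vector_derivative_add[OF has_vector_derivative_const] by fastforce
  moreover have "(\<Sum>k = 1..Suc N. d (k - 1)) = z * dexp \<tau> z (t - \<tau>)"
  proof -
    have s: "(\<Sum>k = 1..Suc N. d (k - 1)) = d 0 + (\<Sum>k = 1..N. d k)"
      using sum.shift_bounds_cl_Suc_ivl[of "\<lambda>k. d (k - 1)" 0 N] by (simp add: sum.atLeast_Suc_atMost)
    show ?thesis
    proof (cases "t > 0")
      case True
      have "dexp \<tau> z (t - \<tau>) = 1 + (\<Sum>k = 1..N. dterm \<tau> z k (t - \<tau>))"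
        by (rule dexp_eq[OF \<tau>]) (use True N \<tau> in auto)
      then show ?thesis unfolding s using True by (simp add: d_def sum_distrib_left distrib_left)
    next
      case False
      have "d k = 0" if "k \<ge> 1" for k
      proof -
        have "(real k - 1) * \<tau> \<ge> 0" using that \<tau> by simp
        then have "t - \<tau> - (real k - 1) * \<tau> < 0" using False \<tau> by linarith
        then show ?thesis using that by (simp add: d_def dterm_def max_def zero_power)
      qed
      then have "(\<Sum>k = 1..N. d k) = 0" by (intro sum.neutral) auto
      moreover have "d 0 = 0" using False by (simp add: d_def)
      moreover have "dexp \<tau> z (t - \<tau>) = 0" using False t by (simp add: dexp_def)
      ultimately show ?thesis unfolding s by simp
    qed
  qed
  ultimately have "((\<lambda>t. 1 + (\<Sum>k = 1..Suc N. dterm \<tau> z k t)) has_vector_derivative z * dexp \<tau> z (t - \<tau>)) (at t)"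
    by simp
  then show ?thesis
  proof (rule has_vector_derivative_transform_within_open[of _ _ _ "{- \<tau><..<t + 1}"])
    fix u assume u: "u \<in> {- \<tau><..<t + 1}"
    have "real N * \<tau> \<le> real (Suc N) * \<tau>" using \<tau> by simp
    then show "1 + (\<Sum>k = 1..Suc N. dterm \<tau> z k u) = dexp \<tau> z u"
      using dexp_eq[OF \<tau>, of u "Suc N" z] u N by auto
  qed (use t in auto)
qed

text \<open>As a function of s the kernel jumps only at s = r + \<tau>: it is continuous up to
  there, with value 1 at the point itself, and 0 afterwards.\<close>

lemma dexp_piecewise_integrable:
  fixes f :: "real \<Rightarrow> complex"
  assumes \<tau>: "0 < \<tau>" and f: "continuous_on {p..q} f"
  shows "(\<lambda>s. dexp \<tau> z (r - s) * f s) integrable_on {p..q}"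
proof (cases "r + \<tau> \<in> {p..q}")
  case True
  have 1: "(\<lambda>s. dexp \<tau> z (r - s) * f s) integrable_on {p..r + \<tau>}"
  proof (intro integrable_continuous_real continuous_on_mult)
    show "continuous_on {p..r + \<tau>} (\<lambda>s. dexp \<tau> z (r - s))"
      by (rule continuous_on_compose2[OF dexp_continuous_on[OF \<tau>]]) (auto intro!: continuous_intros)
    show "continuous_on {p..r + \<tau>} f" by (rule continuous_on_subset[OF f]) (use True in auto)
  qed
  have 2: "(\<lambda>s. dexp \<tau> z (r - s) * f s) integrable_on {r + \<tau>..q}"
    by (rule integrable_spike_finite[of "{r + \<tau>}" _ _ "\<lambda>_. 0"]) (auto simp: dexp_def)
  show ?thesis using True by (intro Henstock_Kurzweil_Integration.integrable_combine[OF _ _ 1 2]) auto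
next
  case False
  show ?thesis
  proof (cases "r + \<tau> < p")
    case True
    show ?thesis
      by (rule integrable_spike_finite[of "{}" _ _ "\<lambda>_. 0"]) (use True in \<open>auto simp: dexp_def\<close>)
  next
    case F2: False
    then have "q \<le> r + \<tau> \<or> q < p" using False by auto
    then have sub: "(\<lambda>s. r - s) ` {p..q} \<subseteq> {- \<tau>..}" by auto
    have "continuous_on {p..q} (\<lambda>s. dexp \<tau> z (r - s))"
      by (rule continuous_on_compose2[OF dexp_continuous_on[OF \<tau>] _ sub]) (intro continuous_intros)
    then show ?thesis by (intro integrable_continuous_real continuous_on_mult f)
  qed
qed

text \<open>Variation of constants: integrate the derivative of \<open>s \<mapsto> Y(t - s) y(s)\<close> over \<open>[0,t]\<close>, where
  \<open>Y(u) = dexp \<tau> z (u - \<tau>)\<close> is the fundamental solution, and shift the delayed term by \<open>\<tau>\<close>.\<close>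

lemma delay_variation_of_constants:
  fixes y g :: "real \<Rightarrow> complex"
  assumes \<tau>: "0 < \<tau>" and t: "0 < t"
    and y: "continuous_on {- \<tau>..} y"
    and g: "continuous_on {0..} g"
    and der: "\<And>s. s > 0 \<Longrightarrow> (y has_vector_derivative z * y (s - \<tau>) + g s) (at s)"
  shows "y t = dexp \<tau> z (t - \<tau>) * y 0
    + z * integral {- \<tau>..0} (\<lambda>s. dexp \<tau> z (t - 2 * \<tau> - s) * y s)
    + integral {0..t} (\<lambda>s. dexp \<tau> z (t - \<tau> - s) * g s)"
proof -
  let ?E = "dexp \<tau> z"
  let ?A = "\<lambda>s. ?E (t - \<tau> - s) * y (s - \<tau>)" and ?D = "\<lambda>s. ?E (t - 2 * \<tau> - s) * y s"
  let ?G = "\<lambda>s. ?E (t - \<tau> - s) * g s"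
  have Ec: "continuous_on {0..t} (\<lambda>s. ?E (t - \<tau> - s))"
    by (intro continuous_on_compose2[OF dexp_continuous_on[OF \<tau>]] continuous_intros) (use t in auto)
  have yc: "continuous_on {0..t} y" "continuous_on {- \<tau>..t} y" "continuous_on {- \<tau>..t - \<tau>} y"
    by (rule continuous_on_subset[OF y]; use \<tau> in auto)+
  have gc: "continuous_on {0..t} g" by (rule continuous_on_subset[OF g]) auto
  have FTC: "((\<lambda>s. z * ?A s - z * ?D s + ?G s) has_integral (?E (t - \<tau> - t) * y t - ?E (t - \<tau> - 0) * y 0)) {0..t}"
  proof (rule fundamental_theorem_of_calculus_interior_strong[of "{t - \<tau>}"])
    \<comment> \<open>The exceptional point s = t - \<tau> is where the argument of the kernel is 0,
      the corner of \<open>dexp\<close>.\<close>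
    fix s assume s: "s \<in> {0<..<t} - {t - \<tau>}"
    have "((\<lambda>s. t - \<tau> - s) has_vector_derivative - 1) (at s)"
      by (rule has_vector_derivative_eq_rhs, (rule derivative_intros)+) simp
    then have "((\<lambda>s. ?E (t - \<tau> - s)) has_vector_derivative (- 1) *\<^sub>R (z * ?E (t - \<tau> - s - \<tau>))) (at s)"
      using vector_diff_chain_at[of "\<lambda>s. t - \<tau> - s" "-1" s ?E "z * ?E (t - \<tau> - s - \<tau>)"]
        dexp_has_derivative[OF \<tau>, of "t - \<tau> - s" z] s
      unfolding o_def by auto
    from has_vector_derivative_mult[OF this der[of s]]
    have "((\<lambda>s. ?E (t - \<tau> - s) * y s) has_vector_derivative
        ?E (t - \<tau> - s) * (z * y (s - \<tau>) + g s) + (- 1) *\<^sub>R (z * ?E (t - \<tau> - s - \<tau>)) * y s) (at s)"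
      using s by simp
    moreover have "t - \<tau> - s - \<tau> = t - 2 * \<tau> - s" by simp
    ultimately show "((\<lambda>s. ?E (t - \<tau> - s) * y s) has_vector_derivative z * ?A s - z * ?D s + ?G s) (at s)"
      by (simp add: algebra_simps)
  next
    show "continuous_on {0..t} (\<lambda>s. ?E (t - \<tau> - s) * y s)" by (intro continuous_on_mult Ec yc)
  qed (use t in auto)
  \<comment> \<open>The upper boundary term sits exactly at the jump, where \<open>dexp\<close>
    already has the value 1.\<close>
  have "?E (t - \<tau> - t) = 1"
    using dexp_eq[OF \<tau>, of "- \<tau>" 0 z] \<tau> by simp
  then have I: "integral {0..t} (\<lambda>s. z * ?A s - z * ?D s + ?G s) = y t - ?E (t - \<tau>) * y 0"
    unfolding integral_unique[OF FTC] by simp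
  have shift: "continuous_on {0..t} (\<lambda>s. y (s - \<tau>))"
    by (intro continuous_on_compose2[OF y] continuous_intros) (use \<tau> in auto)
  have iA: "?A integrable_on {0..t}" by (rule dexp_piecewise_integrable[OF \<tau> shift])
  have iG: "?G integrable_on {0..t}" by (rule dexp_piecewise_integrable[OF \<tau> gc])
  have iD: "?D integrable_on {- \<tau>..t}" by (rule dexp_piecewise_integrable[OF \<tau> yc(2)])
  have iD0: "?D integrable_on {0..t}" by (rule dexp_piecewise_integrable[OF \<tau> yc(1)])
  have split: "integral {0..t} (\<lambda>s. z * ?A s - z * ?D s + ?G s)
      = z * integral {0..t} ?A - z * integral {0..t} ?D + integral {0..t} ?G"
    by (intro integral_unique has_integral_add has_integral_diff has_integral_mult_right integrable_integral
        iA iD0 iG)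
  have "integral {0..t} ?A = integral {- \<tau>..t - \<tau>} ?D"
  proof -
    have *: "- \<tau> + s = s - \<tau>" "t - 2 * \<tau> - (s - \<tau>) = t - \<tau> - s" for s by simp_all
    have "?D \<circ> (+) (- \<tau>) = ?A" by (simp only: o_def *)
    then show ?thesis
      using integral_shift_Icc_real[of 0 t ?D "- \<tau>"] by simp
  qed
  \<comment> \<open>The kernel vanishes for s > t - \<tau>, so the shifted integral may be extended
    up to t. The parts over [0, t] then cancel and only the history over [-\<tau>, 0]
    remains.\<close>
  moreover have "integral {t - \<tau>..t} ?D = 0"
    by (rule integral_unique, rule has_integral_spike_finite[of "{t - \<tau>}" _ _ "\<lambda>_. 0"])
      (auto simp: dexp_def)
  moreover have "integral {- \<tau>..t - \<tau>} ?D + integral {t - \<tau>..t} ?D = integral {- \<tau>..t} ?D"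
    by (rule Henstock_Kurzweil_Integration.integral_combine[OF _ _ iD]) (use t \<tau> in auto)
  moreover have "integral {- \<tau>..0} ?D + integral {0..t} ?D = integral {- \<tau>..t} ?D"
    by (rule Henstock_Kurzweil_Integration.integral_combine[OF _ _ iD]) (use t \<tau> in auto)
  ultimately have "integral {0..t} ?A = integral {- \<tau>..0} ?D + integral {0..t} ?D" by simp
  then show ?thesis using I unfolding split by (simp add: algebra_simps)
qed

section \<open>The coefficients of the solution\<close>

lemma bounded_linear_axis: "bounded_linear (\<lambda>z. axis k z :: complex^'n)"
proof (rule linear_conv_bounded_linear[THEN iffD1], rule linearI)
  show "axis k (x + y) = (axis k x + axis k y :: complex^'n)" for x y by (simp add: vec_eq_iff axis_def)
  show "axis k (r *\<^sub>R x) = (r *\<^sub>R axis k x :: complex^'n)" for r x by (simp add: vec_eq_iff axis_def)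
qed

lemma has_integral_complex_vec:
  fixes f :: "real \<Rightarrow> complex^'n"
  assumes "\<And>k. ((\<lambda>s. f s $ k) has_integral I $ k) T"
  shows "(f has_integral I) T"
proof -
  have sum: "(\<Sum>k\<in>UNIV. axis k (x $ k)) = x" for x :: "complex^'n"
    by (simp add: vec_eq_iff sum_component axis_def if_distrib cong: if_cong)
  have "((\<lambda>s. \<Sum>k\<in>UNIV. axis k (f s $ k)) has_integral (\<Sum>k\<in>UNIV. axis k (I $ k))) T"
  proof (rule has_integral_sum)
    fix k
    show "((\<lambda>s. axis k (f s $ k) :: complex^'n) has_integral axis k (I $ k)) T"
      using has_integral_linear[OF assms[of k] bounded_linear_axis[of k]] by (simp add: o_def)
  qed simp
  then show ?thesis by (simp only: sum)
qed

lemma bounded_linear_matrix: "bounded_linear (\<lambda>x. S *v x)" for S :: "complex^'n^'m"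
proof (rule linear_conv_bounded_linear[THEN iffD1], rule linearI)
  show "S *v (x + y) = S *v x + S *v y" for x y by (rule matrix_vector_right_distrib)
  show "S *v (r *\<^sub>R x) = r *\<^sub>R (S *v x)" for r x
    by (simp add: vec_eq_iff matrix_vector_mult_def scaleR_sum_right)
qed

lemma diagonal_power:
  fixes A :: "complex^'n^'n"
  assumes "\<And>i j. i \<noteq> j \<Longrightarrow> A $ i $ j = 0"
  shows "((**) A ^^ k) (mat 1) $ i $ j = (if i = j then (A $ i $ i) ^ k else 0)"
proof (induction k arbitrary: i j)
  case 0
  then show ?case by (simp add: mat_def)
next
  case (Suc k)
  have "((**) A ^^ Suc k) (mat 1) $ i $ j = (\<Sum>m\<in>UNIV. A $ i $ m * ((**) A ^^ k) (mat 1) $ m $ j)"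
    by (simp add: matrix_matrix_mult_def)
  also have "\<dots> = (\<Sum>m\<in>UNIV. if m = i then A $ i $ i * ((**) A ^^ k) (mat 1) $ i $ j else 0)"
    by (rule sum.cong) (use assms in auto)
  also have "\<dots> = A $ i $ i * ((**) A ^^ k) (mat 1) $ i $ j" by simp
  finally show ?case by (simp add: Suc)
qed

lemma delayed_exp_diagonal:
  fixes A :: "complex^'n^'n"
  assumes "\<And>i j. i \<noteq> j \<Longrightarrow> A $ i $ j = 0"
  shows "(delayed_exp \<tau> A t *v y) $ j = dexp \<tau> (A $ j $ j) t * y $ j"
proof -
  have pw: "((**) A ^^ k) (mat 1) $ i $ j = (if i = j then (A $ i $ i) ^ k else 0)" for k i j
    by (rule diagonal_power) (rule assms)
  have e: "delayed_exp \<tau> A t $ i $ j = (if i = j then dexp \<tau> (A $ i $ i) t else 0)" for i j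
  proof (cases "t < - \<tau>")
    case False
    then have "delayed_exp \<tau> A t $ i $ j = mat 1 $ i $ j + (\<Sum>k = 1..nat (\<lfloor>t / \<tau>\<rfloor> + 1).
        ((t - (real k - 1) * \<tau>) ^ k / fact k) *\<^sub>R (((**) A ^^ k) (mat 1) $ i $ j))"
      by (simp only: delayed_exp_def if_False sum_component vector_add_component vector_scaleR_component)
    then show ?thesis using False
      by (simp only: pw) (simp add: dexp_def mat_def scaleR_conv_of_real)
  qed (simp add: delayed_exp_def dexp_def)
  have "(delayed_exp \<tau> A t *v y) $ j = (\<Sum>m\<in>UNIV. delayed_exp \<tau> A t $ j $ m * y $ m)"
    by (simp add: matrix_vector_mult_def)
  also have "\<dots> = (\<Sum>m\<in>UNIV. if m = j then dexp \<tau> (A $ j $ j) t * y $ j else 0)"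
    by (rule sum.cong) (auto simp: e)
  finally have "(delayed_exp \<tau> A t *v y) $ j = (\<Sum>m\<in>UNIV. if m = j then dexp \<tau> (A $ j $ j) t * y $ j else 0)" .
  then show ?thesis by simp
qed

lemma diagonal_matrix_vector:
  fixes A :: "complex^'n^'n"
  assumes "\<And>i j. i \<noteq> j \<Longrightarrow> A $ i $ j = 0"
  shows "(A *v y) $ j = A $ j $ j * y $ j"
proof -
  have "(A *v y) $ j = (\<Sum>m\<in>UNIV. A $ j $ m * y $ m)"
    by (simp add: matrix_vector_mult_def)
  also have "\<dots> = (\<Sum>m\<in>UNIV. if m = j then A $ j $ j * y $ j else 0)"
    by (rule sum.cong) (use assms in auto)
  finally have "(A *v y) $ j = (\<Sum>m\<in>UNIV. if m = j then A $ j $ j * y $ j else 0)" .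
  then show ?thesis by simp
qed

text \<open>Multiplying by \<open>S'\<close> decouples the system into scalar equations with z the
  negative diagonal entries of \<open>D\<close>, which gives the minus sign in front of the history
  integral.\<close>

lemma delay_system_solution:
  fixes S D S' :: "complex^'n^'n" and w f :: "real \<Rightarrow> complex^'n"
  assumes \<tau>: "0 < \<tau>" and t: "0 < t"
    and D: "\<And>i j. i \<noteq> j \<Longrightarrow> D $ i $ j = 0"
    and S: "S ** S' = mat 1" "S' ** S = mat 1"
    and w: "\<And>k. continuous_on {- \<tau>..} (\<lambda>s. w s $ k)"
    and f: "\<And>k. continuous_on {0..} (\<lambda>s. f s $ k)"
    and der: "\<And>s k. s > 0 \<Longrightarrow>
      ((\<lambda>s. w s $ k) has_vector_derivative (f s - (S ** D ** S') *v w (s - \<tau>)) $ k) (at s)"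
  shows "w t = S *v (delayed_exp \<tau> (- D) (t - \<tau>) *v (S' *v w 0))
    - (S ** D) *v integral {- \<tau>..0} (\<lambda>s. delayed_exp \<tau> (- D) (t - 2 * \<tau> - s) *v (S' *v w s))
    + integral {0..t} (\<lambda>s. S *v (delayed_exp \<tau> (- D) (t - \<tau> - s) *v (S' *v f s)))"
proof -
  define y where "y s = S' *v w s" for s
  define g where "g s = S' *v f s" for s
  define E where "E = delayed_exp \<tau> (- D)"
  have E: "(E u *v x) $ j = dexp \<tau> (- D $ j $ j) u * x $ j" for u x j
    unfolding E_def using delayed_exp_diagonal[of "- D" \<tau> u x j] D by simp
  have comp: "(S' *v x) $ j = (\<Sum>k\<in>UNIV. S' $ j $ k * x $ k)" for x j
    by (simp add: matrix_vector_mult_def)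
  have yc: "continuous_on {- \<tau>..} (\<lambda>s. y s $ j)" for j
    unfolding y_def comp by (intro continuous_intros w)
  have gc: "continuous_on {0..} (\<lambda>s. g s $ j)" for j
    unfolding g_def comp by (intro continuous_intros f)
  have yder: "((\<lambda>s. y s $ j) has_vector_derivative - D $ j $ j * y (s - \<tau>) $ j + g s $ j) (at s)"
    if s: "s > 0" for s j
  proof -
    have "((\<lambda>s. y s $ j) has_vector_derivative (S' *v (f s - (S ** D ** S') *v w (s - \<tau>))) $ j) (at s)"
      unfolding y_def comp
      by (intro has_vector_derivative_sum has_vector_derivative_mult_right der s)
    moreover have "S' *v (f s - (S ** D ** S') *v w (s - \<tau>)) = g s - D *v y (s - \<tau>)"
    proof -
      have "S' *v ((S ** D ** S') *v w (s - \<tau>)) = (S' ** S) *v (D *v y (s - \<tau>))"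
        by (simp add: y_def matrix_vector_mul_assoc matrix_mul_assoc)
      then show ?thesis by (simp add: g_def matrix_vector_mult_diff_distrib S)
    qed
    ultimately show ?thesis by (simp add: diagonal_matrix_vector[OF D])
  qed
  define I1 where "I1 = (\<chi> j. integral {- \<tau>..0} (\<lambda>s. dexp \<tau> (- D $ j $ j) (t - 2 * \<tau> - s) * y s $ j))"
  define I2 where "I2 = (\<chi> j. integral {0..t} (\<lambda>s. dexp \<tau> (- D $ j $ j) (t - \<tau> - s) * g s $ j))"
  have I1: "((\<lambda>s. E (t - 2 * \<tau> - s) *v y s) has_integral I1) {- \<tau>..0}"
  proof (rule has_integral_complex_vec)
    fix j
    have "continuous_on {- \<tau>..0} (\<lambda>s. y s $ j)" by (rule continuous_on_subset[OF yc]) auto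
    from dexp_piecewise_integrable[OF \<tau> this, of "- D $ j $ j" "t - 2 * \<tau>"]
    show "((\<lambda>s. (E (t - 2 * \<tau> - s) *v y s) $ j) has_integral I1 $ j) {- \<tau>..0}"
      unfolding E I1_def by (simp add: integrable_integral)
  qed
  have I2: "((\<lambda>s. E (t - \<tau> - s) *v g s) has_integral I2) {0..t}"
  proof (rule has_integral_complex_vec)
    fix j
    have "continuous_on {0..t} (\<lambda>s. g s $ j)" by (rule continuous_on_subset[OF gc]) auto
    from dexp_piecewise_integrable[OF \<tau> this, of "- D $ j $ j" "t - \<tau>"]
    show "((\<lambda>s. (E (t - \<tau> - s) *v g s) $ j) has_integral I2 $ j) {0..t}"
      unfolding E I2_def by (simp add: integrable_integral)
  qed
  have "y t = E (t - \<tau>) *v y 0 - D *v I1 + I2"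
  proof (rule vec_eq_iff[THEN iffD2], rule allI)
    fix j
    show "y t $ j = (E (t - \<tau>) *v y 0 - D *v I1 + I2) $ j"
      using delay_variation_of_constants[OF \<tau> t yc gc yder]
      by (simp add: E diagonal_matrix_vector[OF D] I1_def I2_def)
  qed
  then have "S *v y t = S *v (E (t - \<tau>) *v y 0) - (S ** D) *v I1 + S *v I2"
    by (simp add: matrix_vector_right_distrib matrix_vector_mult_diff_distrib matrix_vector_mul_assoc)
  moreover have "S *v y t = w t" by (simp add: y_def matrix_vector_mul_assoc S)
  moreover have "integral {0..t} (\<lambda>s. S *v (E (t - \<tau> - s) *v g s)) = S *v I2"
    using has_integral_linear[OF I2 bounded_linear_matrix[of S]] by (simp add: o_def integral_unique)
  ultimately show ?thesis
    using integral_unique[OF I1] unfolding E_def y_def g_def by simp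
qed

lemma cvec_nth: "cvec v $ k = of_real (v $ k)"
  by (simp add: cvec_def)

context wave_heat_system begin

lemma matB_cvec:
  assumes "smooth_vec V"
  shows "(matB l a b c d n *v cvec (coeff3 n V)) $ k = of_real (coeff3 n (B V) $ k)"
  using exhaust_3[of k] coeff_B[OF assms, of n]
  by (elim disjE) (simp_all add: matrix_vector_mult_def sum_3 matB_def Let_def cvec_nth)

theorem sol_coeff_eq:
  assumes \<tau>: "0 < \<tau>"
    and V\<tau>: "V\<tau> \<in> C0_Xinf l a b c d {-\<tau>..0}" and init: "\<forall>x\<in>{0..l}. V\<tau> 0 x = V0 x"
    and F: "F \<in> C0_Xinf l a b c d {0..}"
    and sol: "classical_solution l a b c d \<tau> V0 V\<tau> F V"
    and nd: "nondegenerate l a b c d n" and t: "t \<ge> - \<tau>"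
  shows "sol_coeff l a b c d \<tau> V0 V\<tau> F n t = cvec (coeff3 n (V t))"
proof -
  have VC0: "V \<in> C0_Xinf l a b c d {-\<tau>..}" and VC1: "V \<in> C1_Xinf l a b c d {0..}"
    and eq: "\<And>t x. t > 0 \<Longrightarrow> x \<in> {0<..<l} \<Longrightarrow>
      ((\<lambda>s. V s x) has_vector_derivative (F t x - B (V (t - \<tau>)) x)) (at t)"
    and V0: "\<And>x. x \<in> {0..l} \<Longrightarrow> V 0 x = V0 x"
    and hist: "\<And>t x. t \<in> {-\<tau><..<0} \<Longrightarrow> x \<in> {0..l} \<Longrightarrow> V t x = V\<tau> t x"
    using sol unfolding classical_solution_def by blast+
  have coeff_cong: "coeff3 n U = coeff3 n W" if "\<And>x. x \<in> {0..l} \<Longrightarrow> U x = W x" for U W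
    unfolding fourier_coeff_def vec_eq_iff by (auto intro!: L2_inner_cong simp: that)
  have Vc: "continuous_on {-\<tau>..} (\<lambda>s. coeff3 n (V s) $ k)" for k by (rule coeff_continuous[OF VC0])
  have c0: "coeff3 n (V 0) = coeff3 n V0" by (rule coeff_cong) (rule V0)
  \<comment> \<open>The solution is prescribed only on the open interval before 0; continuity of the
    coefficients of \<open>V\<close> and \<open>V\<tau>\<close> extends the equality to both
    ends.\<close>
  have h: "coeff3 n (V s) = coeff3 n (V\<tau> s)" if s: "s \<in> {-\<tau>..0}" for s
  proof -
    have "coeff3 n (V s) $ k - coeff3 n (V\<tau> s) $ k = 0" for k
    proof (rule continuous_constant_on_closure[of "{-\<tau><..<0}" "\<lambda>s. coeff3 n (V s) $ k - coeff3 n (V\<tau> s) $ k"])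
      show "continuous_on (closure {-\<tau><..<0}) (\<lambda>s. coeff3 n (V s) $ k - coeff3 n (V\<tau> s) $ k)"
        using \<tau> by (auto intro!: continuous_intros coeff_continuous[OF V\<tau>] continuous_on_subset[OF Vc])
      show "s \<in> closure {-\<tau><..<0}" using s \<tau> by simp
      fix u assume "u \<in> {-\<tau><..<0}"
      then have "coeff3 n (V u) = coeff3 n (V\<tau> u)" by (intro coeff_cong hist)
      then show "coeff3 n (V u) $ k - coeff3 n (V\<tau> u) $ k = 0" by simp
    qed
    then show ?thesis by (simp add: vec_eq_iff)
  qed
  consider "t < 0" | "t = 0" | "t > 0" by linarith
  then show ?thesis
  proof cases
    case 1
    then show ?thesis using t h[of t] by (simp add: sol_coeff_def Let_def)
  next
    case 2
    then show ?thesis using c0 by (simp add: sol_coeff_def Let_def)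
  next
    case 3
    let ?S = "matS l a b c d n" and ?D = "matD l a b c d n"
    let ?S' = "matrix_inv ?S"
    have b: "b \<noteq> 0" using bd by auto
    note diag = matS_diagonalises[OF l b nd]
    have "cvec (coeff3 n (V t)) = ?S *v (delayed_exp \<tau> (- ?D) (t - \<tau>) *v (?S' *v cvec (coeff3 n (V 0))))
      - (?S ** ?D) *v integral {- \<tau>..0} (\<lambda>s. delayed_exp \<tau> (- ?D) (t - 2 * \<tau> - s) *v (?S' *v cvec (coeff3 n (V s))))
      + integral {0..t} (\<lambda>s. ?S *v (delayed_exp \<tau> (- ?D) (t - \<tau> - s) *v (?S' *v cvec (coeff3 n (F s)))))"
    proof (rule delay_system_solution[OF \<tau> 3])
      show "?D $ i $ j = 0" if "i \<noteq> j" for i j using that by (simp add: matD_nth)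
      show "?S ** ?S' = mat 1" "?S' ** ?S = mat 1" by (rule matrix_inv_inverse[OF diag(3)])+
      show "continuous_on {-\<tau>..} (\<lambda>s. cvec (coeff3 n (V s)) $ k)" for k
        unfolding cvec_nth by (intro continuous_intros Vc)
      show "continuous_on {0..} (\<lambda>s. cvec (coeff3 n (F s)) $ k)" for k
        unfolding cvec_nth by (intro continuous_intros coeff_continuous[OF F])
      fix s :: real and k assume s: "s > 0"
      \<comment> \<open>The right-hand side of the equation. It is continuous on the closed interval
        because \<open>B\<close> preserves smooth vectors, as the comparison of the two time
        derivatives requires.\<close>
      define G where "G x = F s x - B (V (s - \<tau>)) x" for x
      have VX: "smooth_vec (V (s - \<tau>))"
        using VC0 s by (intro Xinf_imp_smooth_vec) (auto simp: C0_Xinf_def)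
      have FX: "smooth_vec (F s)"
        using F s by (intro Xinf_imp_smooth_vec) (auto simp: C0_Xinf_def)
      note FC = smooth_vec_comp[OF FX] and BC = smooth_vec_comp[OF smooth_vec_B[OF VX]]
      have "((\<lambda>s. coeff3 n (V s) $ k) has_real_derivative coeff3 n G $ k) (at s)"
      proof (rule norm_derivative_eq_pointwise[OF VC1 s])
        show "continuous_on {0..l} (comp k G)" for k
          using continuous_on_diff[OF FC[of k] BC[of k]] by (simp add: G_def)
        show "((\<lambda>s. V s x) has_vector_derivative G x) (at s)" if "x \<in> {0<..<l}" for x
          unfolding G_def by (rule eq[OF s that])
      qed
      moreover have "coeff3 n G $ k = coeff3 n (F s) $ k - coeff3 n (B (V (s - \<tau>))) $ k"
        using coeff_lincomb[OF continuous_imp_L2[OF FC] continuous_imp_L2[OF BC], of n "-1" k]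
        by (simp add: G_def[abs_def])
      ultimately have "((\<lambda>s. complex_of_real (coeff3 n (V s) $ k)) has_vector_derivative
          complex_of_real (coeff3 n (F s) $ k - coeff3 n (B (V (s - \<tau>))) $ k)) (at s)"
        by (intro has_vector_derivative_of_real) (simp add: has_real_derivative_iff_has_vector_derivative)
      then show "((\<lambda>s. cvec (coeff3 n (V s)) $ k) has_vector_derivative
          (cvec (coeff3 n (F s)) - (?S ** ?D ** ?S') *v cvec (coeff3 n (V (s - \<tau>)))) $ k) (at s)"
        unfolding diag(4)[symmetric] by (simp add: cvec_nth matB_cvec[OF VX])
    qed
    moreover have "integral {- \<tau>..0} (\<lambda>s. delayed_exp \<tau> (- ?D) (t - 2 * \<tau> - s) *v (?S' *v cvec (coeff3 n (V s))))
      = integral {- \<tau>..0} (\<lambda>s. delayed_exp \<tau> (- ?D) (t - 2 * \<tau> - s) *v (?S' *v cvec (coeff3 n (V\<tau> s))))"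
      by (rule Henstock_Kurzweil_Integration.integral_cong) (simp add: h)
    ultimately show ?thesis using 3 c0 by (simp add: sol_coeff_def Let_def)
  qed
qed

end

section \<open>Passage to complex coefficients and conclusion\<close>

lemma norm_cvec: "norm (cvec v) = norm v"
  by (simp add: norm_vec_def cvec_nth)

lemma unif_fourier_expansion_complex_cvec:
  assumes "unif_fourier_expansion l v V"
  shows "unif_fourier_expansion_complex l (\<lambda>n. cvec (v n)) V"
proof -
  have "(\<Sum>n<N. (\<chi> k. cvec (v n) $ k * of_real (Phi l n x $ k))) = cvec (\<Sum>n<N. (\<chi> k. v n $ k * Phi l n x $ k))" for N x
    by (simp add: vec_eq_iff sum_component cvec_nth)
  moreover have "dist (cvec u) (cvec w) = dist u w" for u w
  proof -
    have "cvec u - cvec w = cvec (u - w)" by (simp add: vec_eq_iff cvec_nth)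
    then show ?thesis by (simp add: dist_norm norm_cvec)
  qed
  ultimately show ?thesis
    using assms unfolding unif_fourier_expansion_complex_def unif_fourier_expansion_def uniform_limit_iff
    by simp
qed

theorem mainTheorem3:
  fixes l a b c d \<tau> :: real
    and V0 :: "real \<Rightarrow> real^3"
    and V\<tau> F V :: "real \<Rightarrow> real \<Rightarrow> real^3"
  assumes "l > 0" and "a > 0" and "c > 0" and "b / d > 0" and "\<tau> > 0"
    and "V0 \<in> Xinf l a b c d"
    and "V\<tau> \<in> C0_Xinf l a b c d {-\<tau>..0}"
    and "\<forall>x\<in>{0..l}. V\<tau> 0 x = V0 x"
    and "F \<in> C0_Xinf l a b c d {0..}"
    and "classical_solution l a b c d \<tau> V0 V\<tau> F V"
  shows
    "(unif_fourier_expansion l (\<lambda>n. fourier_coeff l n V0) V0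
      \<and> (\<forall>t\<in>{-\<tau>..0}. unif_fourier_expansion l (\<lambda>n. fourier_coeff l n (V\<tau> t)) (V\<tau> t))
      \<and> (\<forall>t\<ge>0. unif_fourier_expansion l (\<lambda>n. fourier_coeff l n (F t)) (F t)))
     \<and>
     ((\<forall>n. nondegenerate l a b c d n \<longrightarrow>
        inj_on (eigvec l a b c d n) {0, 1, 2}
        \<and> vec.independent (eigvec l a b c d n ` {0, 1, 2})
        \<and> invertible (matS l a b c d n)
        \<and> matB l a b c d n = matS l a b c d n ** matD l a b c d n ** matrix_inv (matS l a b c d n))
      \<and> (\<exists>n. nondegenerate l a b c d n \<and> \<not> orthonormal_family (eigvec l a b c d n) {0, 1, 2}))
     \<and>
     ((\<forall>n. nondegenerate l a b c d n) \<longrightarrow>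
       (\<forall>t\<ge>-\<tau>. unif_fourier_expansion_complex l (\<lambda>n. sol_coeff l a b c d \<tau> V0 V\<tau> F n t) (V t)))
     \<and>
     (\<forall>n. let S = matS l a b c d n in
       det S = S$1$1 * S$2$2 * S$3$3 + S$1$2 * S$2$3 * S$3$1 + S$1$3 * S$2$1 * S$3$2
             - S$3$1 * S$2$2 * S$1$3 - S$3$2 * S$2$3 * S$1$1 - S$3$3 * S$2$1 * S$1$2
       \<and> (nondegenerate l a b c d n \<longrightarrow>
          matrix_inv S = mat (1 / det S) ** vector
            [vector [S$2$2 * S$3$3 - S$2$3 * S$3$2, - S$1$2 * S$3$3 + S$1$3 * S$3$2,
                     S$1$2 * S$2$3 - S$1$3 * S$2$2],
             vector [- S$2$1 * S$3$3 + S$2$3 * S$3$1, S$1$1 * S$3$3 - S$1$3 * S$3$1,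
                     - S$1$1 * S$2$3 + S$1$3 * S$2$1],
             vector [S$2$1 * S$3$2 - S$2$2 * S$3$1, - S$1$1 * S$3$2 + S$1$2 * S$3$1,
                     S$1$1 * S$2$2 - S$1$2 * S$2$1]]))"
proof -
  interpret wave_heat_system l a b c d by (rule wave_heat_system.intro[OF assms(1-4)])
  have b: "b \<noteq> 0" using assms(4) by auto
  have X: "unif_fourier_expansion l (\<lambda>n. fourier_coeff l n U) U" if "U \<in> Xinf l a b c d" for U
    by (rule smooth_vec_expansion[OF Xinf_imp_smooth_vec[OF that]])
  have i: "unif_fourier_expansion l (\<lambda>n. fourier_coeff l n V0) V0
      \<and> (\<forall>t\<in>{-\<tau>..0}. unif_fourier_expansion l (\<lambda>n. fourier_coeff l n (V\<tau> t)) (V\<tau> t))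
      \<and> (\<forall>t\<ge>0. unif_fourier_expansion l (\<lambda>n. fourier_coeff l n (F t)) (F t))"
    using X assms(6,7,9) by (auto simp: C0_Xinf_def)
  have ii: "\<forall>n. nondegenerate l a b c d n \<longrightarrow>
        inj_on (eigvec l a b c d n) {0, 1, 2}
        \<and> vec.independent (eigvec l a b c d n ` {0, 1, 2})
        \<and> invertible (matS l a b c d n)
        \<and> matB l a b c d n = matS l a b c d n ** matD l a b c d n ** matrix_inv (matS l a b c d n)"
    using matS_diagonalises[OF assms(1) b] by blast
  have iii: "unif_fourier_expansion_complex l (\<lambda>n. sol_coeff l a b c d \<tau> V0 V\<tau> F n t) (V t)"
    if nd: "\<forall>n. nondegenerate l a b c d n" and t: "t \<ge> - \<tau>" for t
  proof -
    have "V t \<in> Xinf l a b c d" using assms(10) t by (auto simp: classical_solution_def C0_Xinf_def)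
    then show ?thesis
      using unif_fourier_expansion_complex_cvec[OF X] sol_coeff_eq[OF assms(5,7,8,9,10) _ t] nd by simp
  qed
  have iv: "let S = matS l a b c d n in
       det S = S$1$1 * S$2$2 * S$3$3 + S$1$2 * S$2$3 * S$3$1 + S$1$3 * S$2$1 * S$3$2
             - S$3$1 * S$2$2 * S$1$3 - S$3$2 * S$2$3 * S$1$1 - S$3$3 * S$2$1 * S$1$2
       \<and> (nondegenerate l a b c d n \<longrightarrow>
          matrix_inv S = mat (1 / det S) ** vector
            [vector [S$2$2 * S$3$3 - S$2$3 * S$3$2, - S$1$2 * S$3$3 + S$1$3 * S$3$2,
                     S$1$2 * S$2$3 - S$1$3 * S$2$2],
             vector [- S$2$1 * S$3$3 + S$2$3 * S$3$1, S$1$1 * S$3$3 - S$1$3 * S$3$1,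
                     - S$1$1 * S$2$3 + S$1$3 * S$2$1],
             vector [S$2$1 * S$3$2 - S$2$2 * S$3$1, - S$1$1 * S$3$2 + S$1$2 * S$3$1,
                     S$1$1 * S$2$2 - S$1$2 * S$2$1]])" for n
    unfolding Let_def
  proof (intro conjI impI, goal_cases)
    case 1
    show ?case by (simp add: det_3 mult_ac)
  next
    case 2
    show ?case by (rule matrix_inv_3[OF det_matS_nonzero[OF assms(1) b 2]])
  qed
  show ?thesis
    using i ii exists_nonorthonormal[OF assms(1,2,3) b] iii iv by blast
qed

end
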